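(* Let $\Bbbk$ be a subfield of $\mathbb{C}$ and $A$ a positively based $\Bbbk$-algebra of finite dimension $n$. Let $(V,\mathbf{v})$ be a transitive $A$-module with apex $\mathcal{J}$. Then $L_{(V,\mathbf{v})}\cong L_{\mathcal{L}}$ for any left cell $\mathcal{L}$ in $\mathcal{J}$.
   Context: Positively based algebra: $A$ is a unital associative $\Bbbk$-algebra with a fixed basis $\mathbf{B}=\{a_1,\dots,a_n\}$ such that $a_ia_j=\sum_{k}\gamma_{i,j}^{(k)}a_k$ with all $\gamma_{i,j}^{(k)}\in\mathbb{R}_{\ge 0}$; it is assumed that $a_1$ is the unit of $A$. Modules are left modules. Cells: put $\mathbf{n}=\{1,\dots,n\}$ and $i\star j=\{k:\gamma_{i,j}^{(k)}>0\}$, extended to subsets by taking unions. Write $i\le_L j$ if $j\in s\star i$ for some $s\in\mathbf{n}$, and $i\le_J j$ if $j\in s_1\star i\star s_2$ for some $s_1,s_2\in\mathbf{n}$; these are preorders. The equivalence classes of the associated equivalence relations (where $i\sim j$ iff $i\le j$ and $j\le i$) are the left cells, respectively two-sided cells; each two-sided cell is a union of left cells. The preorders induce partial orders on the sets of left, respectively two-sided, cells. Transitive modules: a based $A$-module $(V,\mathbf{v})$ is a (nonzero) finite-dimensional $A$-module $V$ with a fixed basis $\mathbf{v}$. It is positively based if, for all $a_i\in\mathbf{B}$ and $v_s\in\mathbf{v}$, the element $a_iv_s$ is a linear combination of elements of $\mathbf{v}$ with non-negative real coefficients. It is transitive if it is positively based and for all $v_s,v_t\in\mathbf{v}$ there is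 $a_i\in\mathbf{B}$ such that $v_t$ appears in $a_iv_s$ with a non-zero coefficient. The apex of a transitive module $(V,\mathbf{v})$ is the maximum element, with respect to $\le_J$ (it exists), of the set of two-sided cells $\mathcal{J}$ containing some $i$ with $a_i\cdot V\ne 0$. Special subquotients: for $\mathbf{c}\in(\mathbb{R}_{>0}\cap\Bbbk)^n$ put $a(\mathbf{c})=\sum_ic_ia_i$. On a transitive module $(V,\mathbf{v})$ the matrix of $a(\mathbf{c})$ in the basis $\mathbf{v}$ has positive real entries; let $\lambda$ be its Perron-Frobenius eigenvalue. $L_{(V,\mathbf{v})}$ is the simple subquotient of $V$ (unique up to isomorphism, of composition multiplicity one) such that $\lambda$ is an eigenvalue of $a(\mathbf{c})$ acting on it; up to isomorphism it does not depend on $\mathbf{c}$. Cell modules: for a left cell $\mathcal{L}$, let $\overline{\mathcal{L}}$ be the union of all left cells $\mathcal{L}'\ge_L\mathcal{L}$. Let $M_{\mathcal{L}}$ be the span of all $a_j$, $j\in\overline{\mathcal{L}}$, and $N_{\mathcal{L}}$ the span of all $a_j$, $j\in\overline{\mathcal{L}}\setminus\mathcal{L}$ (submodules of ${}_AA$). Set $C_{\mathcal{L}}=M_{\mathcal{L}}/N_{\mathcal{L}}$, with basis $\mathbf{B}_{\mathcal{L}}$ given by the images of $a_i$, $i\in\mathcal{L}$. Then $(C_{\mathcal{L}},\mathbf{B}_{\mathcal{L}})$ is transitive, and $L_{\mathcal{L}}:=L_{(C_{\mathcal{L}},\mathbf{B}_{\mathcal{L}})}$. *)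

theory Defs
  imports
    "HOL-Library.Nonpos_Ints"
    "HOL-Algebra.Subrings"
    "Jordan_Normal_Form.VS_Connect"
    "Jordan_Normal_Form.Spectral_Radius"
begin

hide_const (open) Multiset.mult Polynomial.smult Modules.module

section \<open>Algebras, left modules and bases\<close>

text \<open>
  The ground field is a set \<open>K\<close> of complex numbers with \<open>subfield K class_ring\<close>, where
  \<open>class_ring\<close> is the field of all complex numbers as a ring record.
\<close>

abbreviation ground_field :: "complex set \<Rightarrow> complex ring" where
  "ground_field K \<equiv> class_ring\<lparr>carrier := K\<rparr>"

text \<open>
  The locale \<open>algebra\<close> of HOL-Algebra is restricted to commutative algebras, and \<open>module\<close> to
  modules over commutative rings; hence the following two locales.
\<close>

locale unital_algebra = vectorspace k A + ring A
  for k :: "'k ring" and A :: "('k, 'a) module" (structure) +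
  assumes smult_mult_left:
      "\<lbrakk>r \<in> carrier k; x \<in> carrier A; y \<in> carrier A\<rbrakk> \<Longrightarrow> (r \<odot> x) \<otimes> y = r \<odot> (x \<otimes> y)"
    and smult_mult_right:
      "\<lbrakk>r \<in> carrier k; x \<in> carrier A; y \<in> carrier A\<rbrakk> \<Longrightarrow> x \<otimes> (r \<odot> y) = r \<odot> (x \<otimes> y)"

text \<open>
  A record for left modules over an algebra: a vector space (\<open>smult\<close> is the action of the ground
  field) together with an action of the algebra. The fields \<open>mult\<close> and \<open>one\<close> inherited from
  \<open>module\<close> play no role.
\<close>

record ('k, 'a, 'v) lmodule = "('k, 'v) module" +
  act :: "'a \<Rightarrow> 'v \<Rightarrow> 'v"

locale left_module = A: unital_algebra k A + V: vectorspace k V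
  for k :: "'k ring" and A :: "('k, 'a) module" and V :: "('k, 'a, 'v) lmodule" +
  assumes act_closed:
      "\<lbrakk>a \<in> carrier A; x \<in> carrier V\<rbrakk> \<Longrightarrow> act V a x \<in> carrier V"
    and act_add_left:
      "\<lbrakk>a \<in> carrier A; b \<in> carrier A; x \<in> carrier V\<rbrakk>
        \<Longrightarrow> act V (a \<oplus>\<^bsub>A\<^esub> b) x = act V a x \<oplus>\<^bsub>V\<^esub> act V b x"
    and act_add_right:
      "\<lbrakk>a \<in> carrier A; x \<in> carrier V; y \<in> carrier V\<rbrakk>
        \<Longrightarrow> act V a (x \<oplus>\<^bsub>V\<^esub> y) = act V a x \<oplus>\<^bsub>V\<^esub> act V a y"
    and act_smult_left:
      "\<lbrakk>r \<in> carrier k; a \<in> carrier A; x \<in> carrier V\<rbrakk>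
        \<Longrightarrow> act V (r \<odot>\<^bsub>A\<^esub> a) x = r \<odot>\<^bsub>V\<^esub> act V a x"
    and act_smult_right:
      "\<lbrakk>r \<in> carrier k; a \<in> carrier A; x \<in> carrier V\<rbrakk>
        \<Longrightarrow> act V a (r \<odot>\<^bsub>V\<^esub> x) = r \<odot>\<^bsub>V\<^esub> act V a x"
    and act_mult:
      "\<lbrakk>a \<in> carrier A; b \<in> carrier A; x \<in> carrier V\<rbrakk>
        \<Longrightarrow> act V (a \<otimes>\<^bsub>A\<^esub> b) x = act V a (act V b x)"
    and act_one:
      "x \<in> carrier V \<Longrightarrow> act V \<one>\<^bsub>A\<^esub> x = x"

definition regular_module :: "('k, 'a) module \<Rightarrow> ('k, 'a, 'a) lmodule" where
  "regular_module A =
    \<lparr>carrier = carrier A, mult = mult A, one = one A, zero = zero A, add = add A,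
     smult = smult A, act = mult A\<rparr>"

definition is_lsubmodule ::
    "'k ring \<Rightarrow> ('k, 'a) module \<Rightarrow> ('k, 'a, 'v) lmodule \<Rightarrow> 'v set \<Rightarrow> bool" where
  "is_lsubmodule k A V W \<longleftrightarrow>
    submodule k W V \<and> (\<forall>a\<in>carrier A. \<forall>w\<in>W. act V a w \<in> W)"

text \<open>The module \<open>W / U\<close> for submodules \<open>U \<subseteq> W\<close> of \<open>V\<close>, whose elements are cosets of \<open>U\<close>.\<close>

definition subquotient ::
    "('k, 'a, 'v) lmodule \<Rightarrow> 'v set \<Rightarrow> 'v set \<Rightarrow> ('k, 'a, 'v set) lmodule" where
  "subquotient V W U =
    \<lparr>carrier = (\<lambda>w. U +>\<^bsub>V\<^esub> w) ` W, mult = undefined, one = undefined,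
     zero = U, add = set_add V,
     smult = (\<lambda>r X. \<Union>x\<in>X. U +>\<^bsub>V\<^esub> (r \<odot>\<^bsub>V\<^esub> x)),
     act = (\<lambda>a X. \<Union>x\<in>X. U +>\<^bsub>V\<^esub> act V a x)\<rparr>"

definition simple_module ::
    "'k ring \<Rightarrow> ('k, 'a) module \<Rightarrow> ('k, 'a, 'v) lmodule \<Rightarrow> bool" where
  "simple_module k A S \<longleftrightarrow>
    left_module k A S \<and> carrier S \<noteq> {\<zero>\<^bsub>S\<^esub>} \<and>
    (\<forall>W. is_lsubmodule k A S W \<longrightarrow> W = {\<zero>\<^bsub>S\<^esub>} \<or> W = carrier S)"

definition is_simple_subquotient ::
    "'k ring \<Rightarrow> ('k, 'a) module \<Rightarrow> ('k, 'a, 'v) lmodule \<Rightarrow> ('k, 'a, 'v set) lmodule \<Rightarrow> bool" where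
  "is_simple_subquotient k A V S \<longleftrightarrow>
    (\<exists>W U. is_lsubmodule k A V W \<and> is_lsubmodule k A V U \<and> U \<subseteq> W \<and>
      S = subquotient V W U \<and> simple_module k A S)"

definition lmodule_iso ::
    "'k ring \<Rightarrow> ('k, 'a) module \<Rightarrow> ('k, 'a, 'v) lmodule \<Rightarrow> ('k, 'a, 'w) lmodule \<Rightarrow> bool" where
  "lmodule_iso k A S T \<longleftrightarrow>
    (\<exists>f\<in>module_hom k S T. bij_betw f (carrier S) (carrier T) \<and>
      (\<forall>a\<in>carrier A. \<forall>x\<in>carrier S. f (act S a x) = act T a (f x)))"

text \<open>Finite ordered bases; indices start at \<open>0\<close>.\<close>

definition is_basis :: "'k ring \<Rightarrow> ('k, 'v, 'm) module_scheme \<Rightarrow> 'v list \<Rightarrow> bool" where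
  "is_basis k V vs \<longleftrightarrow> distinct vs \<and> vectorspace.basis k V (set vs)"

text \<open>The coefficient of the \<open>i\<close>-th basis vector in \<open>x\<close>.\<close>

definition coord ::
    "'k ring \<Rightarrow> ('k, 'v, 'm) module_scheme \<Rightarrow> 'v list \<Rightarrow> 'v \<Rightarrow> nat \<Rightarrow> 'k" where
  "coord k V vs x i =
    (THE f. f \<in> set vs \<rightarrow>\<^sub>E carrier k \<and> module.lincomb V f (set vs) = x) (vs ! i)"

definition matrix_of ::
    "'k ring \<Rightarrow> ('k, 'v, 'm) module_scheme \<Rightarrow> 'v list \<Rightarrow> ('v \<Rightarrow> 'v) \<Rightarrow> 'k mat" where
  "matrix_of k V vs f =
    mat (length vs) (length vs) (\<lambda>(s, t). coord k V vs (f (vs ! t)) s)"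

section \<open>Positively based algebras and their cells\<close>

definition structure_const ::
    "complex set \<Rightarrow> (complex, 'a) module \<Rightarrow> 'a list \<Rightarrow> nat \<Rightarrow> nat \<Rightarrow> nat \<Rightarrow> complex" where
  "structure_const K A bs i j l = coord (ground_field K) A bs (bs ! i \<otimes>\<^bsub>A\<^esub> bs ! j) l"

definition positively_based_algebra ::
    "complex set \<Rightarrow> (complex, 'a) module \<Rightarrow> 'a list \<Rightarrow> bool" where
  "positively_based_algebra K A bs \<longleftrightarrow>
    unital_algebra (ground_field K) A \<and> is_basis (ground_field K) A bs \<and>
    bs \<noteq> [] \<and> bs ! 0 = \<one>\<^bsub>A\<^esub> \<and>
    (\<forall>i<length bs. \<forall>j<length bs. \<forall>l<length bs. structure_const K A bs i j l \<in> \<real>\<^sub>\<ge>\<^sub>0)"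

definition star ::
    "complex set \<Rightarrow> (complex, 'a) module \<Rightarrow> 'a list \<Rightarrow> nat set \<Rightarrow> nat set \<Rightarrow> nat set" where
  "star K A bs I J =
    (\<Union>i\<in>I. \<Union>j\<in>J. {l. l < length bs \<and> structure_const K A bs i j l \<in> \<real>\<^sub>\<ge>\<^sub>0 - {0}})"

definition le_L :: "complex set \<Rightarrow> (complex, 'a) module \<Rightarrow> 'a list \<Rightarrow> nat \<Rightarrow> nat \<Rightarrow> bool" where
  "le_L K A bs i j \<longleftrightarrow> (\<exists>s<length bs. j \<in> star K A bs {s} {i})"

definition le_J :: "complex set \<Rightarrow> (complex, 'a) module \<Rightarrow> 'a list \<Rightarrow> nat \<Rightarrow> nat \<Rightarrow> bool" where
  "le_J K A bs i j \<longleftrightarrow>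
    (\<exists>s<length bs. \<exists>t<length bs. j \<in> star K A bs (star K A bs {s} {i}) {t})"

definition left_cells :: "complex set \<Rightarrow> (complex, 'a) module \<Rightarrow> 'a list \<Rightarrow> nat set set" where
  "left_cells K A bs =
    {..<length bs} // {(i, j). i < length bs \<and> j < length bs \<and> le_L K A bs i j \<and> le_L K A bs j i}"

definition two_sided_cells :: "complex set \<Rightarrow> (complex, 'a) module \<Rightarrow> 'a list \<Rightarrow> nat set set" where
  "two_sided_cells K A bs =
    {..<length bs} // {(i, j). i < length bs \<and> j < length bs \<and> le_J K A bs i j \<and> le_J K A bs j i}"

text \<open>The orders on cells induced by the preorders on indices.\<close>

definition cell_le_L ::
    "complex set \<Rightarrow> (complex, 'a) module \<Rightarrow> 'a list \<Rightarrow> nat set \<Rightarrow> nat set \<Rightarrow> bool" where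
  "cell_le_L K A bs X Y \<longleftrightarrow> (\<exists>i\<in>X. \<exists>j\<in>Y. le_L K A bs i j)"

definition cell_le_J ::
    "complex set \<Rightarrow> (complex, 'a) module \<Rightarrow> 'a list \<Rightarrow> nat set \<Rightarrow> nat set \<Rightarrow> bool" where
  "cell_le_J K A bs X Y \<longleftrightarrow> (\<exists>i\<in>X. \<exists>j\<in>Y. le_J K A bs i j)"

section \<open>Transitive modules, apex and cell modules\<close>

definition positively_based_module ::
    "complex set \<Rightarrow> (complex, 'a) module \<Rightarrow> 'a list \<Rightarrow> (complex, 'a, 'v) lmodule \<Rightarrow> 'v list \<Rightarrow> bool"
  where
  "positively_based_module K A bs V vs \<longleftrightarrow>
    left_module (ground_field K) A V \<and> carrier V \<noteq> {\<zero>\<^bsub>V\<^esub>} \<and> is_basis (ground_field K) V vs \<and>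
    (\<forall>i<length bs. \<forall>s<length vs. \<forall>t<length vs.
      coord (ground_field K) V vs (act V (bs ! i) (vs ! s)) t \<in> \<real>\<^sub>\<ge>\<^sub>0)"

definition transitive_module ::
    "complex set \<Rightarrow> (complex, 'a) module \<Rightarrow> 'a list \<Rightarrow> (complex, 'a, 'v) lmodule \<Rightarrow> 'v list \<Rightarrow> bool"
  where
  "transitive_module K A bs V vs \<longleftrightarrow>
    positively_based_module K A bs V vs \<and>
    (\<forall>s<length vs. \<forall>t<length vs. \<exists>i<length bs.
      coord (ground_field K) V vs (act V (bs ! i) (vs ! s)) t \<noteq> 0)"

definition nonannihilating_cells ::
    "complex set \<Rightarrow> (complex, 'a) module \<Rightarrow> 'a list \<Rightarrow> (complex, 'a, 'v) lmodule \<Rightarrow> nat set set" where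
  "nonannihilating_cells K A bs V =
    {X \<in> two_sided_cells K A bs. \<exists>i\<in>X. \<exists>x\<in>carrier V. act V (bs ! i) x \<noteq> \<zero>\<^bsub>V\<^esub>}"

definition is_apex ::
    "complex set \<Rightarrow> (complex, 'a) module \<Rightarrow> 'a list \<Rightarrow> (complex, 'a, 'v) lmodule \<Rightarrow> nat set \<Rightarrow> bool"
  where
  "is_apex K A bs V J \<longleftrightarrow>
    J \<in> nonannihilating_cells K A bs V \<and>
    (\<forall>X\<in>nonannihilating_cells K A bs V. cell_le_J K A bs X J)"

definition upper_closure ::
    "complex set \<Rightarrow> (complex, 'a) module \<Rightarrow> 'a list \<Rightarrow> nat set \<Rightarrow> nat set" where
  "upper_closure K A bs L = \<Union>{L' \<in> left_cells K A bs. cell_le_L K A bs L L'}"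

definition cell_M :: "complex set \<Rightarrow> (complex, 'a) module \<Rightarrow> 'a list \<Rightarrow> nat set \<Rightarrow> 'a set" where
  "cell_M K A bs L = module.span (ground_field K) A ((!) bs ` upper_closure K A bs L)"

definition cell_N :: "complex set \<Rightarrow> (complex, 'a) module \<Rightarrow> 'a list \<Rightarrow> nat set \<Rightarrow> 'a set" where
  "cell_N K A bs L = module.span (ground_field K) A ((!) bs ` (upper_closure K A bs L - L))"

definition cell_module ::
    "complex set \<Rightarrow> (complex, 'a) module \<Rightarrow> 'a list \<Rightarrow> nat set \<Rightarrow> (complex, 'a, 'a set) lmodule" where
  "cell_module K A bs L = subquotient (regular_module A) (cell_M K A bs L) (cell_N K A bs L)"

definition cell_basis ::
    "complex set \<Rightarrow> (complex, 'a) module \<Rightarrow> 'a list \<Rightarrow> nat set \<Rightarrow> 'a set list" where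
  "cell_basis K A bs L = map (\<lambda>i. cell_N K A bs L +>\<^bsub>A\<^esub> bs ! i) (sorted_list_of_set L)"

section \<open>Special subquotients\<close>

definition positive_coeffs :: "complex set \<Rightarrow> nat \<Rightarrow> (nat \<Rightarrow> complex) \<Rightarrow> bool" where
  "positive_coeffs K n c \<longleftrightarrow> (\<forall>i<n. c i \<in> K \<and> c i \<in> \<real>\<^sub>\<ge>\<^sub>0 - {0})"

definition weighted_sum :: "('k, 'a) module \<Rightarrow> 'a list \<Rightarrow> (nat \<Rightarrow> 'k) \<Rightarrow> 'a" where
  "weighted_sum A bs c = (\<Oplus>\<^bsub>A\<^esub>i\<in>{..<length bs}. c i \<odot>\<^bsub>A\<^esub> bs ! i)"

definition perron_frobenius_eigenvalue :: "complex mat \<Rightarrow> real \<Rightarrow> bool" where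
  "perron_frobenius_eigenvalue M r \<longleftrightarrow>
    r > 0 \<and> eigenvalue M (of_real r) \<and>
    (\<forall>\<mu>. eigenvalue M \<mu> \<and> \<mu> \<noteq> of_real r \<longrightarrow> cmod \<mu> < r)"

text \<open>
  The Perron-Frobenius eigenvalue need not lie in \<open>K\<close>. Eigenvalues of an operator on a
  finite-dimensional \<open>K\<close>-space are therefore taken in the complex numbers, i.e. they are the
  eigenvalues of a matrix of the operator (over \<open>K\<close>) regarded as a complex matrix.
\<close>

definition operator_eigenvalue ::
    "complex set \<Rightarrow> (complex, 'v, 'm) module_scheme \<Rightarrow> ('v \<Rightarrow> 'v) \<Rightarrow> complex \<Rightarrow> bool" where
  "operator_eigenvalue K V f \<mu> \<longleftrightarrow>
    (\<exists>us. is_basis (ground_field K) V us \<and> eigenvalue (matrix_of (ground_field K) V us f) \<mu>)"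

text \<open>
  \<open>S\<close> is a representative, among the subquotients of \<open>V\<close>, of the isomorphism class of the
  special subquotient of \<open>(V, vs)\<close> determined by \<open>c\<close>.
\<close>

definition is_special_subquotient ::
    "complex set \<Rightarrow> (complex, 'a) module \<Rightarrow> 'a list \<Rightarrow> (nat \<Rightarrow> complex) \<Rightarrow>
     (complex, 'a, 'v) lmodule \<Rightarrow> 'v list \<Rightarrow> (complex, 'a, 'v set) lmodule \<Rightarrow> bool" where
  "is_special_subquotient K A bs c V vs S \<longleftrightarrow>
    is_simple_subquotient (ground_field K) A V S \<and>
    (\<exists>r. perron_frobenius_eigenvalue
           (matrix_of (ground_field K) V vs (act V (weighted_sum A bs c))) r \<and>
         operator_eigenvalue K S (act S (weighted_sum A bs c)) (of_real r))"

end

theory Submission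
  imports Defs "HOL-Analysis.Function_Topology"
begin

text \<open>
  Throughout, \<open>a(c)\<close> stands for the positive combination of the basis elements of the algebra with
  coefficients \<open>c\<close>. On a transitive module its matrix is positive. The Perron-Frobenius eigenvalue
  \<open>\<lambda>\<close> of this matrix need not lie in the ground field \<open>K\<close>, so \<open>V\<close> need not contain an eigenvector
  for it. The role of eigenvectors is therefore taken by \<open>K\<close>-linear functionals with complex
  values: \<open>\<lambda>\<close> is an eigenvalue of an operator \<open>T\<close> iff some nonzero functional \<open>f\<close> satisfies
  \<open>f (T x) = \<lambda> f x\<close>.

  Perron-Frobenius theory provides such a functional \<open>l\<close> on \<open>V\<close>, positive on the basis, together
  with the limit formula that \<open>g (a(c)^k x) / \<lambda>^k\<close> tends to \<open>\<langle>g, v\<rangle> l x\<close> for every functional \<open>g\<close>,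
  where \<open>v\<close> is a positive eigenvector and \<open>\<langle>g, v\<rangle>\<close> the pairing of \<open>g\<close> with it
  (\<open>positive_operator_perron_data\<close>). The limit formula carries most of the proof.
  \<^item> Functionals on submodules extend to \<open>V\<close>. Hence an eigenfunctional for \<open>\<lambda>\<close> on a submodule is a
    multiple of \<open>l\<close> (\<open>perron_dominant\<close>), and \<open>\<lambda>\<close> occurs on a subquotient \<open>W / U\<close> iff \<open>l\<close> vanishes on
    \<open>U\<close> but not on \<open>W\<close> (\<open>subquotient_eigenvalue_iff\<close>). So the special subquotient is described by
    the functional \<open>l\<close> alone.
  \<^item> A nonzero functional that is nonnegative on the basis pairs nontrivially with \<open>v\<close>. If it vanishes
    on a submodule, then so does \<open>l\<close> (\<open>perron_vanishing\<close>). Thus the functionals obtained from two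
    different coefficient vectors vanish on the same submodules, which is why the special subquotient
    does not depend on \<open>c\<close>.

  The second ingredient is combinatorial. If \<open>i\<close> and \<open>j\<close> lie in one two-sided cell and
  \<open>i \<le>\<^sub>L j\<close>, then \<open>j \<le>\<^sub>L i\<close> (\<open>stability\<close>). This again follows from Perron-Frobenius theory: the
  matrices of the sums of all left and of all right multiplications, restricted to the cell, commute
  and have a positive product, so the former is block diagonal along its invariant index sets.
  Consequently, for \<open>i\<close> in the apex of \<open>V\<close>, every basis element strictly above \<open>i\<close> in the left order
  lies strictly above the apex and annihilates \<open>V\<close>. If \<open>v\<close> is a basis vector with \<open>a\<^sub>i v \<noteq> 0\<close>, the
  map \<open>a \<mapsto> a v\<close> therefore induces a homomorphism \<open>\<phi>\<close> from the cell module of the left cell of \<open>i\<close>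
  to \<open>V\<close>.

  The composition of \<open>l\<close> with \<open>\<phi>\<close> is a nonzero eigenfunctional of \<open>a(c)\<close> on the cell module that is
  nonnegative on its basis, hence a multiple of the Perron functional there. So \<open>\<phi>\<close> matches the
  functionals that single out the two special subquotients, and both are quotients of one submodule
  of the cell module by one and the same kernel (\<open>iso_of_dominant_map\<close>).
\<close>

section \<open>Perron-Frobenius theory of positive matrices\<close>

text \<open>
  The eigenvalue is the largest \<open>r\<close> such that \<open>r x \<le> M x\<close> for some \<open>x\<close> in the standard simplex. If the
  inequality were strict in some coordinate for the optimal \<open>x\<close>, then, \<open>M\<close> being positive, it would be
  strict in all coordinates for \<open>M x\<close>, and \<open>r\<close> could be increased.
\<close>

lemma positive_matrix_right_eigenvector:
  fixes M :: "'i \<Rightarrow> 'i \<Rightarrow> real"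
  assumes fin: "finite I" and ne: "I \<noteq> {}"
    and pos: "\<And>i j. i \<in> I \<Longrightarrow> j \<in> I \<Longrightarrow> M i j > 0"
  shows "\<exists>r v. r > 0 \<and> (\<forall>i\<in>I. v i > 0) \<and> (\<forall>i\<in>I. (\<Sum>j\<in>I. M i j * v j) = r * v i)"
proof -
  \<comment> \<open>Summing \<open>r x \<le> M x\<close> over the coordinates gives \<open>r \<le> B\<close>, so the admissible pairs \<open>(r, x)\<close> form
    the compact set \<open>T\<close>. Vectors are functions on the whole index type that vanish off \<open>I\<close>.\<close>
  define B where "B = (\<Sum>i\<in>I. \<Sum>j\<in>I. M i j)"
  define S where "S = {x. (\<forall>i. x i \<in> (if i \<in> I then {0..1} else {0::real}))}"
  define T where "T = {p \<in> {0..B} \<times> S. (\<Sum>i\<in>I. snd p i) = 1 \<and>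
      (\<forall>i\<in>I. fst p * snd p i \<le> (\<Sum>j\<in>I. M i j * snd p j))}"
  have B0: "B \<ge> 0" unfolding B_def by (intro sum_nonneg) (use pos in \<open>force intro: less_imp_le\<close>)
  have S_compact: "compact S"
  proof -
    have "S = PiE UNIV (\<lambda>i. if i \<in> I then {0..1} else {0::real})"
      by (auto simp: S_def PiE_def Pi_def)
    moreover have "compactin (product_topology (\<lambda>i. euclidean) UNIV) \<dots>"
      by (subst compactin_PiE) auto
    ultimately show ?thesis
      by (simp add: euclidean_product_topology)
  qed
  have T_eq: "T = ({0..B} \<times> S) \<inter> ({p. (\<Sum>i\<in>I. snd p i) = 1} \<inter>
      (\<Inter>i\<in>I. {p. fst p * snd p i \<le> (\<Sum>j\<in>I. M i j * snd p j)}))"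
    unfolding T_def by auto
  have coord: "continuous_on UNIV (\<lambda>p::real \<times> ('i \<Rightarrow> real). snd p i)" for i
    by (rule continuous_on_product_then_coordinatewise[OF continuous_on_snd[OF continuous_on_id]])
  have T_compact: "compact T"
    unfolding T_eq
    by (intro compact_Int_closed compact_Times S_compact compact_Icc closed_Int closed_INT
          closed_Collect_eq closed_Collect_le continuous_intros ballI coord)
  \<comment> \<open>Normalising a positive vector to a point of the simplex preserves the inequality.\<close>
  have T_intro: "(r, \<lambda>i. if i \<in> I then y i / (\<Sum>i\<in>I. y i) else 0) \<in> T"
    if y: "\<And>i. i \<in> I \<Longrightarrow> y i > 0" and r: "r \<ge> 0"
      and le: "\<And>i. i \<in> I \<Longrightarrow> r * y i \<le> (\<Sum>j\<in>I. M i j * y j)" for r y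
  proof -
    define s where "s = (\<Sum>i\<in>I. y i)"
    have s: "s > 0" unfolding s_def using fin ne y by (intro sum_pos) auto
    define x where "x = (\<lambda>i. if i \<in> I then y i / s else 0)"
    have x0: "x i > 0" if "i \<in> I" for i using that y s by (auto simp: x_def)
    have x1: "(\<Sum>i\<in>I. x i) = 1"
      using s by (simp add: x_def s_def flip: sum_divide_distrib)
    have xle1: "x i \<le> 1" if "i \<in> I" for i
      using member_le_sum[of i I x] x0 fin that x1 by (auto intro: less_imp_le)
    have xle: "r * x i \<le> (\<Sum>j\<in>I. M i j * x j)" if "i \<in> I" for i
    proof -
      have "r * y i / s \<le> (\<Sum>j\<in>I. M i j * y j) / s"
        using le[OF that] s by (simp add: divide_right_mono)
      also have "\<dots> = (\<Sum>j\<in>I. M i j * x j)"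
        by (simp add: x_def sum_divide_distrib)
      finally show ?thesis using that by (simp add: x_def)
    qed
    have "r = (\<Sum>i\<in>I. r * x i)" using x1 by (simp flip: sum_distrib_left)
    also have "\<dots> \<le> (\<Sum>i\<in>I. \<Sum>j\<in>I. M i j * x j)" by (intro sum_mono xle)
    also have "\<dots> \<le> B" unfolding B_def
      by (intro sum_mono mult_left_le) (use pos xle1 in \<open>auto intro: less_imp_le\<close>)
    finally have "r \<le> B" .
    moreover have "x \<in> S" using x0 xle1 by (auto simp: S_def x_def less_imp_le)
    ultimately have "(r, x) \<in> T" using r x1 xle by (auto simp: T_def)
    then show ?thesis by (simp only: x_def s_def)
  qed
  have "T \<noteq> {}"
    using T_intro[of "\<lambda>_. 1" 0] pos by (force intro: sum_nonneg less_imp_le)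
  moreover have "continuous_on T fst" by (intro continuous_intros)
  ultimately obtain p where p: "p \<in> T" and max: "\<And>q. q \<in> T \<Longrightarrow> fst q \<le> fst p"
    using continuous_attains_sup[OF T_compact] by metis
  obtain r x where rx: "p = (r, x)" by (cases p)
  have r0: "r \<ge> 0" and x0: "\<And>i. i \<in> I \<Longrightarrow> x i \<ge> 0" and x1: "(\<Sum>i\<in>I. x i) = 1"
    and le: "\<And>i. i \<in> I \<Longrightarrow> r * x i \<le> (\<Sum>j\<in>I. M i j * x j)"
    using p by (auto simp: T_def rx S_def split: if_splits)
  define y where "y = (\<lambda>i. \<Sum>j\<in>I. M i j * x j)"
  obtain k where k: "k \<in> I" "x k > 0"
    using x1 x0 by (metis less_eq_real_def sum.neutral zero_neq_one)
  have y0: "y i > 0" if "i \<in> I" for i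
    unfolding y_def
    by (rule sum_pos2[OF fin k(1)]) (use pos x0 k that in \<open>simp_all add: less_imp_le\<close>)
  have eq: "y i = r * x i" if "i \<in> I" for i
  proof (rule ccontr)
    assume "y i \<noteq> r * x i"
    then have lt: "r * x i < y i" using le[OF that] by (simp add: y_def)
    have gt: "r * y j < (\<Sum>l\<in>I. M j l * y l)" if j: "j \<in> I" for j
    proof -
      have "0 < (\<Sum>l\<in>I. M j l * (y l - r * x l))"
        by (rule sum_pos2[OF fin \<open>i \<in> I\<close>])
          (use pos j \<open>i \<in> I\<close> lt le in \<open>simp_all add: less_imp_le y_def\<close>)
      also have "\<dots> = (\<Sum>l\<in>I. M j l * y l) - r * y j"
        by (simp add: algebra_simps sum_subtractf y_def sum_distrib_left)
      finally show ?thesis by simp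
    qed
    \<comment> \<open>The slack by which \<open>r\<close> can be increased without violating any of the strict inequalities.\<close>
    define e where "e = Min ((\<lambda>j. ((\<Sum>l\<in>I. M j l * y l) - r * y j) / y j) ` I)"
    have e: "e > 0" unfolding e_def using fin ne gt y0 by (subst Min_gr_iff) auto
    have "(r + e) * y j \<le> (\<Sum>l\<in>I. M j l * y l)" if "j \<in> I" for j
    proof -
      have "e \<le> ((\<Sum>l\<in>I. M j l * y l) - r * y j) / y j"
        unfolding e_def using fin that by (intro Min_le) auto
      then show ?thesis using y0[OF that] by (simp add: field_simps)
    qed
    from max[OF T_intro[OF y0 _ this]] r0 e show False by (simp add: rx)
  qed
  have "r > 0" using eq[OF k(1)] y0[OF k(1)] k(2) by (simp add: zero_less_mult_iff)
  moreover have "x i > 0" if "i \<in> I" for i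
    using eq[OF that] y0[OF that] \<open>r > 0\<close> by (simp add: zero_less_mult_iff)
  ultimately show ?thesis using eq by (intro exI[of _ r] exI[of _ x]) (simp add: y_def)
qed

text \<open>
  The left and the right eigenvalue agree, since both are computed by the pairing of the left with the
  right eigenvector.
\<close>

lemma positive_matrix_perron:
  fixes M :: "'i \<Rightarrow> 'i \<Rightarrow> real"
  assumes fin: "finite I" and ne: "I \<noteq> {}"
    and pos: "\<And>i j. i \<in> I \<Longrightarrow> j \<in> I \<Longrightarrow> M i j > 0"
  obtains r v l where "r > 0" "\<And>i. i \<in> I \<Longrightarrow> v i > 0" "\<And>i. i \<in> I \<Longrightarrow> l i > 0"
    "\<And>i. i \<in> I \<Longrightarrow> (\<Sum>j\<in>I. M i j * v j) = r * v i"
    "\<And>j. j \<in> I \<Longrightarrow> (\<Sum>i\<in>I. l i * M i j) = r * l j"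
    "(\<Sum>i\<in>I. l i * v i) = 1"
proof -
  obtain r v where r: "r > 0" and v: "\<And>i. i \<in> I \<Longrightarrow> v i > 0"
    and Mv: "\<And>i. i \<in> I \<Longrightarrow> (\<Sum>j\<in>I. M i j * v j) = r * v i"
    using positive_matrix_right_eigenvector[of I M] fin ne pos by blast
  obtain q l where q: "q > 0" and l: "\<And>i. i \<in> I \<Longrightarrow> l i > 0"
    and lM: "\<And>j. j \<in> I \<Longrightarrow> (\<Sum>i\<in>I. M i j * l i) = q * l j"
    using positive_matrix_right_eigenvector[of I "\<lambda>i j. M j i"] fin ne pos by blast
  define s where "s = (\<Sum>i\<in>I. l i * v i)"
  have s: "s > 0" unfolding s_def using fin ne l v by (intro sum_pos) auto
  have "r * s = (\<Sum>i\<in>I. l i * (\<Sum>j\<in>I. M i j * v j))"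
    unfolding s_def sum_distrib_left[of r] by (intro sum.cong refl) (simp add: Mv)
  also have "\<dots> = (\<Sum>j\<in>I. (\<Sum>i\<in>I. M i j * l i) * v j)"
    by (simp add: sum_distrib_left sum_distrib_right mult_ac) (rule sum.swap)
  also have "\<dots> = q * s" unfolding s_def sum_distrib_left[of q] by (intro sum.cong refl) (simp add: lM)
  finally have "r = q" using s by simp
  show ?thesis
  proof (rule that[of r v "\<lambda>i. l i / s"])
    show "(\<Sum>i\<in>I. l i / s * M i j) = r * (l j / s)" if "j \<in> I" for j
      using lM[OF that] \<open>r = q\<close> by (simp add: mult_ac flip: sum_divide_distrib)
    show "(\<Sum>i\<in>I. l i / s * v i) = 1"
      using s by (simp add: s_def flip: sum_divide_distrib)
  qed (use r v l Mv s in auto)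
qed

text \<open>
  On row vectors \<open>g\<close> with \<open>\<langle>g, v\<rangle> = 0\<close>, the matrix \<open>M\<close> acts like \<open>M - e v 1\<^sup>T\<close>, where \<open>1\<close> is the
  all-one vector. For small \<open>e\<close> this matrix is still nonnegative, but its eigenvalue at \<open>v\<close> has
  dropped below \<open>r\<close>. That eigenvalue bounds the growth of the \<open>v\<close>-weighted sum norm.
\<close>

lemma positive_matrix_contraction:
  fixes M :: "'i \<Rightarrow> 'i \<Rightarrow> real"
  assumes fin: "finite I" and ne: "I \<noteq> {}"
    and pos: "\<And>i j. i \<in> I \<Longrightarrow> j \<in> I \<Longrightarrow> M i j > 0"
    and r: "r > 0" and v: "\<And>i. i \<in> I \<Longrightarrow> v i > 0"
    and Mv: "\<And>i. i \<in> I \<Longrightarrow> (\<Sum>j\<in>I. M i j * v j) = r * v i"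
  obtains q where "0 \<le> q" "q < r"
    "\<And>g :: 'i \<Rightarrow> complex. (\<Sum>i\<in>I. g i * of_real (v i)) = 0 \<Longrightarrow>
      (\<Sum>j\<in>I. cmod (\<Sum>i\<in>I. g i * of_real (M i j)) * v j) \<le> q * (\<Sum>i\<in>I. cmod (g i) * v i)"
proof -
  \<comment> \<open>The largest \<open>e\<close> for which \<open>M - e v 1\<^sup>T\<close> is nonnegative.\<close>
  define e where "e = Min ((\<lambda>(i, j). M i j / v i) ` (I \<times> I))"
  define s where "s = (\<Sum>j\<in>I. v j)"
  have e: "e > 0" unfolding e_def using fin ne pos v by (subst Min_gr_iff) auto
  have eM: "e * v i \<le> M i j" if "i \<in> I" "j \<in> I" for i j
  proof -
    have "e \<le> M i j / v i" unfolding e_def using fin that by (intro Min_le) force+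
    then show ?thesis using v[OF that(1)] by (simp add: field_simps)
  qed
  have s: "s > 0" unfolding s_def using fin ne v by (intro sum_pos) auto
  have rem: "(\<Sum>j\<in>I. (M i j - e * v i) * v j) = (r - e * s) * v i" if "i \<in> I" for i
    using Mv[OF that]
    by (simp add: algebra_simps sum_subtractf s_def sum_distrib_left sum_distrib_right)
  have q0: "0 \<le> r - e * s"
  proof -
    obtain i where i: "i \<in> I" using ne by auto
    have "0 \<le> (\<Sum>j\<in>I. (M i j - e * v i) * v j)"
      by (intro sum_nonneg mult_nonneg_nonneg) (use eM i v in \<open>auto intro: less_imp_le\<close>)
    then show ?thesis using rem[OF i] v[OF i] by (simp add: zero_le_mult_iff)
  qed
  have "(\<Sum>j\<in>I. cmod (\<Sum>i\<in>I. g i * of_real (M i j)) * v j) \<le> (r - e * s) * (\<Sum>i\<in>I. cmod (g i) * v i)"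
    if g: "(\<Sum>i\<in>I. g i * of_real (v i)) = 0" for g :: "'i \<Rightarrow> complex"
  proof -
    have bound: "cmod (\<Sum>i\<in>I. g i * of_real (M i j)) \<le> (\<Sum>i\<in>I. cmod (g i) * (M i j - e * v i))"
      if j: "j \<in> I" for j
    proof -
      have "(\<Sum>i\<in>I. g i * of_real (M i j - e * v i)) =
          (\<Sum>i\<in>I. g i * of_real (M i j)) - of_real e * (\<Sum>i\<in>I. g i * of_real (v i))"
        by (simp add: algebra_simps sum_subtractf sum_distrib_left)
      then have "(\<Sum>i\<in>I. g i * of_real (M i j)) = (\<Sum>i\<in>I. g i * of_real (M i j - e * v i))"
        using g by simp
      also have "cmod \<dots> \<le> (\<Sum>i\<in>I. cmod (g i * of_real (M i j - e * v i)))"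
        by (rule norm_sum)
      also have "\<dots> = (\<Sum>i\<in>I. cmod (g i) * (M i j - e * v i))"
        by (intro sum.cong refl) (use eM j in \<open>simp only: norm_mult norm_of_real, simp\<close>)
      finally show ?thesis .
    qed
    have "(\<Sum>j\<in>I. cmod (\<Sum>i\<in>I. g i * of_real (M i j)) * v j)
        \<le> (\<Sum>j\<in>I. (\<Sum>i\<in>I. cmod (g i) * (M i j - e * v i)) * v j)"
      by (intro sum_mono mult_right_mono bound) (use v in \<open>auto intro: less_imp_le\<close>)
    also have "\<dots> = (\<Sum>i\<in>I. cmod (g i) * (\<Sum>j\<in>I. (M i j - e * v i) * v j))"
      by (simp add: sum_distrib_left sum_distrib_right mult.assoc) (rule sum.swap)
    also have "\<dots> = (r - e * s) * (\<Sum>i\<in>I. cmod (g i) * v i)"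
      unfolding sum_distrib_left[of "r - e * s"] by (intro sum.cong refl) (simp add: rem)
    finally show ?thesis .
  qed
  then show ?thesis using that[of "r - e * s"] q0 e s by simp
qed

text \<open>
  The complement of the Perron line in the space of row vectors consists of the \<open>g\<close> with
  \<open>\<langle>g, v\<rangle> = 0\<close>; it is preserved by \<open>M\<close>, so the contraction estimate can be iterated.
\<close>

lemma positive_matrix_iterates_vanish:
  fixes M :: "'i \<Rightarrow> 'i \<Rightarrow> real" and h :: "nat \<Rightarrow> 'i \<Rightarrow> complex"
  assumes fin: "finite I" and ne: "I \<noteq> {}"
    and pos: "\<And>i j. i \<in> I \<Longrightarrow> j \<in> I \<Longrightarrow> M i j > 0"
    and r: "r > 0" and v: "\<And>i. i \<in> I \<Longrightarrow> v i > 0"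
    and Mv: "\<And>i. i \<in> I \<Longrightarrow> (\<Sum>j\<in>I. M i j * v j) = r * v i"
    and h: "\<And>k j. j \<in> I \<Longrightarrow> h (Suc k) j = (\<Sum>i\<in>I. h k i * of_real (M i j))"
    and h0: "(\<Sum>i\<in>I. h 0 i * of_real (v i)) = 0" and j: "j \<in> I"
  shows "(\<lambda>k. h k j / of_real r ^ k) \<longlonglongrightarrow> 0"
proof -
  obtain q where q: "0 \<le> q" "q < r"
    and contract: "\<And>g :: 'i \<Rightarrow> complex. (\<Sum>i\<in>I. g i * of_real (v i)) = 0 \<Longrightarrow>
      (\<Sum>j\<in>I. cmod (\<Sum>i\<in>I. g i * of_real (M i j)) * v j) \<le> q * (\<Sum>i\<in>I. cmod (g i) * v i)"
    using positive_matrix_contraction[of I M r v] fin ne pos r v Mv by blast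
  define N where "N = (\<lambda>k. \<Sum>i\<in>I. cmod (h k i) * v i)"
  have hv: "(\<Sum>i\<in>I. h k i * of_real (v i)) = 0" for k
  proof (induction k)
    case (Suc k)
    have "(\<Sum>j\<in>I. h (Suc k) j * of_real (v j)) = (\<Sum>j\<in>I. \<Sum>i\<in>I. h k i * of_real (M i j) * of_real (v j))"
      by (intro sum.cong refl) (simp add: h sum_distrib_right)
    also have "\<dots> = (\<Sum>i\<in>I. h k i * of_real (\<Sum>j\<in>I. M i j * v j))"
      by (subst sum.swap) (simp add: sum_distrib_left mult.assoc)
    also have "\<dots> = of_real r * (\<Sum>i\<in>I. h k i * of_real (v i))"
      unfolding sum_distrib_left[of "of_real r"] by (intro sum.cong refl) (simp add: Mv)
    finally show ?case using Suc.IH by simp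
  qed (rule h0)
  have N: "N k \<le> q ^ k * N 0" for k
  proof (induction k)
    case (Suc k)
    have "N (Suc k) = (\<Sum>j\<in>I. cmod (\<Sum>i\<in>I. h k i * of_real (M i j)) * v j)"
      unfolding N_def by (intro sum.cong refl) (simp add: h)
    also have "\<dots> \<le> q * N k" unfolding N_def by (rule contract[OF hv])
    also have "\<dots> \<le> q * (q ^ k * N 0)" by (rule mult_left_mono[OF Suc.IH q(1)])
    finally show ?case by simp
  qed simp
  have bound: "cmod (h k j / of_real r ^ k) \<le> (q / r) ^ k * (N 0 / v j)" for k
  proof -
    have "cmod (h k j) * v j \<le> N k"
      unfolding N_def by (rule member_le_sum[OF j]) (use fin v in \<open>simp_all add: less_imp_le\<close>)
    also have "\<dots> \<le> q ^ k * N 0" by (rule N)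
    finally have "cmod (h k j) \<le> q ^ k * N 0 / v j"
      using v[OF j] by (simp add: field_simps)
    then show ?thesis
      using r by (simp add: norm_divide norm_power power_divide field_simps)
  qed
  have "(\<lambda>k. (q / r) ^ k * (N 0 / v j)) \<longlonglongrightarrow> 0 * (N 0 / v j)"
    by (intro tendsto_mult_right LIMSEQ_power_zero) (use q r in simp)
  then have "(\<lambda>k. (q / r) ^ k * (N 0 / v j)) \<longlonglongrightarrow> 0" by simp
  then show ?thesis
  proof (rule tendsto_0_le[where K = 1])
    have "cmod (h k j / of_real r ^ k) \<le> norm ((q / r) ^ k * (N 0 / v j)) * 1" for k
      using order_trans[OF bound abs_ge_self] by simp
    then show "\<forall>\<^sub>F k in sequentially. cmod (h k j / of_real r ^ k) \<le> norm ((q / r) ^ k * (N 0 / v j)) * 1"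
      by (rule always_eventually[OF allI])
  qed
qed

text \<open>
  If \<open>\<Lambda>\<close> commutes with \<open>P\<close>, then \<open>l \<Lambda>\<close> is again a left eigenvector of \<open>P\<close> for \<open>r\<close>. Subtracting the right
  multiple of \<open>l\<close> makes it orthogonal to \<open>v\<close>, where \<open>P\<close> contracts by less than \<open>r\<close>; so the difference
  is zero.
\<close>

lemma left_eigenvector_of_commuting_matrix:
  fixes P \<Lambda> :: "'i \<Rightarrow> 'i \<Rightarrow> real"
  assumes fin: "finite I" and ne: "I \<noteq> {}"
    and pos: "\<And>i j. i \<in> I \<Longrightarrow> j \<in> I \<Longrightarrow> P i j > 0"
    and r: "r > 0" and v: "\<And>i. i \<in> I \<Longrightarrow> v i > 0"
    and Pv: "\<And>i. i \<in> I \<Longrightarrow> (\<Sum>j\<in>I. P i j * v j) = r * v i"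
    and lP: "\<And>j. j \<in> I \<Longrightarrow> (\<Sum>i\<in>I. l i * P i j) = r * l j"
    and lv: "(\<Sum>i\<in>I. l i * v i) = 1"
    and comm: "\<And>i j. i \<in> I \<Longrightarrow> j \<in> I \<Longrightarrow> (\<Sum>m\<in>I. P i m * \<Lambda> m j) = (\<Sum>m\<in>I. \<Lambda> i m * P m j)"
  shows "\<exists>\<kappa>. \<forall>j\<in>I. (\<Sum>i\<in>I. l i * \<Lambda> i j) = \<kappa> * l j"
proof -
  obtain q where q: "0 \<le> q" "q < r"
    and contract: "\<And>g :: 'i \<Rightarrow> complex. (\<Sum>i\<in>I. g i * of_real (v i)) = 0 \<Longrightarrow>
      (\<Sum>j\<in>I. cmod (\<Sum>i\<in>I. g i * of_real (P i j)) * v j) \<le> q * (\<Sum>i\<in>I. cmod (g i) * v i)"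
    using positive_matrix_contraction[of I P r v] fin ne pos r v Pv by blast
  define y where "y = (\<lambda>j. \<Sum>i\<in>I. l i * \<Lambda> i j)"
  define \<kappa> where "\<kappa> = (\<Sum>i\<in>I. y i * v i)"
  define g where "g = (\<lambda>j. y j - \<kappa> * l j)"
  have yP: "(\<Sum>i\<in>I. y i * P i j) = r * y j" if j: "j \<in> I" for j
  proof -
    have "(\<Sum>i\<in>I. y i * P i j) = (\<Sum>i\<in>I. \<Sum>k\<in>I. l k * (\<Lambda> k i * P i j))"
      by (simp add: y_def sum_distrib_right mult.assoc)
    also have "\<dots> = (\<Sum>k\<in>I. l k * (\<Sum>i\<in>I. \<Lambda> k i * P i j))"
      by (subst sum.swap) (simp add: sum_distrib_left)
    also have "\<dots> = (\<Sum>k\<in>I. l k * (\<Sum>i\<in>I. P k i * \<Lambda> i j))"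
      by (intro sum.cong refl) (simp add: comm j)
    also have "\<dots> = (\<Sum>i\<in>I. (\<Sum>k\<in>I. l k * P k i) * \<Lambda> i j)"
      by (simp add: sum_distrib_left sum_distrib_right mult.assoc) (rule sum.swap)
    also have "\<dots> = r * y j"
      unfolding y_def sum_distrib_left by (intro sum.cong refl) (simp add: lP)
    finally show ?thesis .
  qed
  have gP: "(\<Sum>i\<in>I. g i * P i j) = r * g j" if j: "j \<in> I" for j
  proof -
    have "(\<Sum>i\<in>I. g i * P i j) = (\<Sum>i\<in>I. y i * P i j) - \<kappa> * (\<Sum>i\<in>I. l i * P i j)"
      by (simp add: g_def left_diff_distrib sum_subtractf sum_distrib_left mult.assoc)
    then show ?thesis by (simp add: yP lP j g_def algebra_simps)
  qed
  have "(\<Sum>i\<in>I. g i * v i) = (\<Sum>i\<in>I. y i * v i) - \<kappa> * (\<Sum>i\<in>I. l i * v i)"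
    by (simp add: g_def left_diff_distrib sum_subtractf sum_distrib_left mult.assoc)
  then have "(\<Sum>i\<in>I. g i * v i) = 0" by (simp add: lv \<kappa>_def)
  then have "(\<Sum>i\<in>I. of_real (g i) * of_real (v i)) = (0 :: complex)"
    by (simp flip: of_real_mult of_real_sum)
  from contract[OF this]
  have "(\<Sum>j\<in>I. \<bar>\<Sum>i\<in>I. g i * P i j\<bar> * v j) \<le> q * (\<Sum>i\<in>I. \<bar>g i\<bar> * v i)"
    by (simp flip: of_real_mult of_real_sum)
  also have "(\<Sum>j\<in>I. \<bar>\<Sum>i\<in>I. g i * P i j\<bar> * v j) = r * (\<Sum>i\<in>I. \<bar>g i\<bar> * v i)"
    unfolding sum_distrib_left[of r] by (intro sum.cong refl) (use r in \<open>simp add: gP abs_mult\<close>)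
  finally have "(r - q) * (\<Sum>i\<in>I. \<bar>g i\<bar> * v i) \<le> 0" by (simp add: algebra_simps)
  then have "(\<Sum>i\<in>I. \<bar>g i\<bar> * v i) \<le> 0" using q by (simp add: mult_le_0_iff)
  moreover have nn: "\<bar>g i\<bar> * v i \<ge> 0" if "i \<in> I" for i using v[OF that] by simp
  ultimately have "(\<Sum>i\<in>I. \<bar>g i\<bar> * v i) = 0" by (intro antisym sum_nonneg)
  then have "\<forall>i\<in>I. \<bar>g i\<bar> * v i = 0" using sum_nonneg_eq_0_iff[OF fin nn] by simp
  then have "\<forall>i\<in>I. g i = 0" using v by force
  then show ?thesis by (intro exI[of _ \<kappa>]) (simp add: g_def y_def)
qed

text \<open>
  The Perron vectors \<open>l\<close> and \<open>v\<close> of \<open>P\<close> are eigenvectors of \<open>\<Lambda>\<close> for a common eigenvalue \<open>\<kappa>\<close>. Give the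
  entry \<open>(i, j)\<close> the mass \<open>l\<^sub>i \<Lambda>\<^sub>i\<^sub>j v\<^sub>j\<close>. The rows in \<open>U\<close> carry the same total mass \<open>\<kappa> \<Sum>(i \<in> U) l\<^sub>i v\<^sub>i\<close> as the
  columns in \<open>U\<close>. If there is no mass in rows outside and columns inside \<open>U\<close>, there is none in rows
  inside and columns outside either.
\<close>

lemma commuting_matrix_blocks:
  fixes P \<Lambda> :: "'i \<Rightarrow> 'i \<Rightarrow> real"
  assumes fin: "finite I"
    and pos: "\<And>i j. i \<in> I \<Longrightarrow> j \<in> I \<Longrightarrow> P i j > 0"
    and nonneg: "\<And>i j. i \<in> I \<Longrightarrow> j \<in> I \<Longrightarrow> \<Lambda> i j \<ge> 0"
    and comm: "\<And>i j. i \<in> I \<Longrightarrow> j \<in> I \<Longrightarrow> (\<Sum>m\<in>I. P i m * \<Lambda> m j) = (\<Sum>m\<in>I. \<Lambda> i m * P m j)"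
    and UI: "U \<subseteq> I" and closed: "\<And>i j. i \<in> I - U \<Longrightarrow> j \<in> U \<Longrightarrow> \<Lambda> i j = 0"
    and i: "i \<in> U" and j: "j \<in> I - U"
  shows "\<Lambda> i j = 0"
proof -
  have ne: "I \<noteq> {}" using j by auto
  obtain r v l where r: "r > 0" and v: "\<And>i. i \<in> I \<Longrightarrow> v i > 0" and l: "\<And>i. i \<in> I \<Longrightarrow> l i > 0"
    and Pv: "\<And>i. i \<in> I \<Longrightarrow> (\<Sum>j\<in>I. P i j * v j) = r * v i"
    and lP: "\<And>j. j \<in> I \<Longrightarrow> (\<Sum>i\<in>I. l i * P i j) = r * l j"
    and lv: "(\<Sum>i\<in>I. l i * v i) = 1"
    using positive_matrix_perron[of I P] fin ne pos by blast
  obtain \<kappa> where \<kappa>: "\<And>j. j \<in> I \<Longrightarrow> (\<Sum>i\<in>I. l i * \<Lambda> i j) = \<kappa> * l j"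
    using left_eigenvector_of_commuting_matrix[OF fin ne pos r v Pv lP lv comm] by blast
  have "\<exists>\<kappa>. \<forall>j\<in>I. (\<Sum>i\<in>I. v i * \<Lambda> j i) = \<kappa> * v j"
  proof (rule left_eigenvector_of_commuting_matrix[of I "\<lambda>i j. P j i" r l])
    show "(\<Sum>m\<in>I. P m i * \<Lambda> j m) = (\<Sum>m\<in>I. \<Lambda> m i * P j m)" if "i \<in> I" "j \<in> I" for i j
      using comm[OF that(2,1)] by (simp add: mult.commute)
  qed (use fin ne pos r l Pv lP lv in \<open>simp_all add: mult.commute\<close>)
  then obtain \<kappa>' where "\<forall>i\<in>I. (\<Sum>j\<in>I. v j * \<Lambda> i j) = \<kappa>' * v i" by (elim exE)
  then have \<kappa>': "(\<Sum>j\<in>I. \<Lambda> i j * v j) = \<kappa>' * v i" if "i \<in> I" for i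
    using that by (simp add: mult.commute)
  have "\<kappa>' = (\<Sum>i\<in>I. l i * (\<Sum>j\<in>I. \<Lambda> i j * v j))"
    using lv by (simp add: \<kappa>' mult.left_commute flip: sum_distrib_left)
  also have "\<dots> = (\<Sum>j\<in>I. (\<Sum>i\<in>I. l i * \<Lambda> i j) * v j)"
    by (simp add: sum_distrib_left sum_distrib_right mult.assoc) (rule sum.swap)
  also have "\<dots> = \<kappa>" using lv by (simp add: \<kappa> mult.assoc flip: sum_distrib_left)
  finally have eq: "\<kappa>' = \<kappa>" .
  have finU: "finite U" by (rule finite_subset[OF UI fin])
  have split: "(\<Sum>j\<in>I. f j) = (\<Sum>j\<in>U. f j) + (\<Sum>j\<in>I - U. f j)" for f :: "'i \<Rightarrow> real"
    using sum.subset_diff[OF UI fin, of f] by simp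
  \<comment> \<open>Mass of the rows in \<open>U\<close>, and below it the mass of the columns in \<open>U\<close>.\<close>
  have "(\<Sum>i\<in>U. \<Sum>j\<in>I. l i * \<Lambda> i j * v j) = \<kappa> * (\<Sum>i\<in>U. l i * v i)"
    unfolding sum_distrib_left[of \<kappa>]
  proof (intro sum.cong refl)
    fix i assume "i \<in> U"
    then have "(\<Sum>j\<in>I. \<Lambda> i j * v j) = \<kappa> * v i" using \<kappa>' UI eq by blast
    then show "(\<Sum>j\<in>I. l i * \<Lambda> i j * v j) = \<kappa> * (l i * v i)"
      by (simp add: mult.assoc mult.left_commute flip: sum_distrib_left)
  qed
  moreover have "(\<Sum>i\<in>U. \<Sum>j\<in>U. l i * \<Lambda> i j * v j) = \<kappa> * (\<Sum>j\<in>U. l j * v j)"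
  proof -
    have "(\<Sum>i\<in>U. l i * \<Lambda> i j) = \<kappa> * l j" if j: "j \<in> U" for j
    proof -
      have "(\<Sum>i\<in>I - U. l i * \<Lambda> i j) = 0" by (intro sum.neutral ballI) (simp add: closed j)
      then show ?thesis using \<kappa>[of j] split[of "\<lambda>i. l i * \<Lambda> i j"] j UI by auto
    qed
    then have "(\<Sum>j\<in>U. \<Sum>i\<in>U. l i * \<Lambda> i j * v j) = \<kappa> * (\<Sum>j\<in>U. l j * v j)"
      unfolding sum_distrib_left[of \<kappa>] by (intro sum.cong refl) (simp only: mult.assoc[symmetric] sum_distrib_right[symmetric])
    then show ?thesis by (subst sum.swap)
  qed
  ultimately have "(\<Sum>i\<in>U. \<Sum>j\<in>I - U. l i * \<Lambda> i j * v j) = 0"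
    by (simp add: split[of "\<lambda>j. l _ * \<Lambda> _ j * v j"] sum.distrib)
  moreover have nn: "l i * \<Lambda> i j * v j \<ge> 0" if "i \<in> U" "j \<in> I - U" for i j
    using that UI l v nonneg by (intro mult_nonneg_nonneg) (auto intro: less_imp_le)
  ultimately have "(\<Sum>j\<in>I - U. l i * \<Lambda> i j * v j) = 0"
    using sum_nonneg_eq_0_iff[OF finU, of "\<lambda>i. \<Sum>j\<in>I - U. l i * \<Lambda> i j * v j"] i by (auto intro: sum_nonneg)
  then have "l i * \<Lambda> i j * v j = 0"
    using sum_nonneg_eq_0_iff[of "I - U" "\<lambda>j. l i * \<Lambda> i j * v j"] nn[OF i] fin j by auto
  moreover have "l i > 0" using l i UI by auto
  moreover have "v j > 0" using v j by auto
  ultimately show ?thesis by simp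
qed

section \<open>Complex-valued functionals over a subfield of the complex numbers\<close>

text \<open>
  The functional is \<open>K\<close>-linear but takes arbitrary complex values, as eigenvalues outside \<open>K\<close> require. It
  is constrained on the subset \<open>W\<close> of \<open>V\<close> only, so that functionals on subspaces need no separate
  carrier.
\<close>

definition linear_functional ::
    "complex set \<Rightarrow> (complex, 'v, 'm) module_scheme \<Rightarrow> 'v set \<Rightarrow> ('v \<Rightarrow> complex) \<Rightarrow> bool" where
  "linear_functional K V W f \<longleftrightarrow>
    (\<forall>x\<in>W. \<forall>y\<in>W. f (x \<oplus>\<^bsub>V\<^esub> y) = f x + f y) \<and> (\<forall>r\<in>K. \<forall>x\<in>W. f (r \<odot>\<^bsub>V\<^esub> x) = r * f x)"

text \<open>
  The dual description of a basis: \<open>k x i\<close> is the coefficient of the \<open>i\<close>-th vector in \<open>x\<close>. It replaces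
  linear combinations indexed by sets of vectors by coordinate functionals indexed by numbers, and
  for cell modules the coordinate functionals are at hand before any basis is known.
\<close>

definition coordinate_system ::
    "complex set \<Rightarrow> (complex, 'v, 'm) module_scheme \<Rightarrow> 'v list \<Rightarrow> ('v \<Rightarrow> nat \<Rightarrow> complex) \<Rightarrow> bool" where
  "coordinate_system K V us k \<longleftrightarrow> set us \<subseteq> carrier V \<and>
    (\<forall>i<length us. linear_functional K V (carrier V) (\<lambda>x. k x i)) \<and>
    (\<forall>x\<in>carrier V. \<forall>i<length us. k x i \<in> K) \<and>
    (\<forall>i<length us. \<forall>j<length us. k (us ! j) i = (if i = j then 1 else 0)) \<and>
    (\<forall>x\<in>carrier V. (\<forall>i<length us. k x i = 0) \<longrightarrow> x = \<zero>\<^bsub>V\<^esub>)"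

locale ground_vectorspace = vectorspace "ground_field K" V
  for K :: "complex set" and V :: "(complex, 'v, 'm) module_scheme" (structure)
begin

lemma K_closed:
  "0 \<in> K" "1 \<in> K"
  "a \<in> K \<Longrightarrow> b \<in> K \<Longrightarrow> a + b \<in> K"
  "a \<in> K \<Longrightarrow> b \<in> K \<Longrightarrow> a * b \<in> K"
  using R.zero_closed R.one_closed R.a_closed[of a b] R.m_closed[of a b] by auto

lemma K_uminus: "a \<in> K \<Longrightarrow> - a \<in> K"
proof -
  assume a: "a \<in> K"
  have "\<ominus>\<^bsub>ground_field K\<^esub> a \<in> K" "\<ominus>\<^bsub>ground_field K\<^esub> a + a = 0"
    using R.a_inv_closed[of a] R.l_neg[of a] a by auto
  then obtain b where b: "b \<in> K" "b + a = 0" by blast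
  then have "- a = b" by (metis add_eq_0_iff2)
  then show ?thesis using b by simp
qed

lemma K_inverse: "a \<in> K \<Longrightarrow> a \<noteq> 0 \<Longrightarrow> inverse a \<in> K"
proof -
  assume a: "a \<in> K" "a \<noteq> 0"
  then have "a \<in> Units (ground_field K)" using field_Units by auto
  then obtain b where b: "b \<in> K" "b * a = 1" by (auto simp: Units_def)
  then have "inverse a = b" by (metis inverse_unique mult.commute)
  then show ?thesis using b by simp
qed

lemma K_rules:
  "x \<in> carrier V \<Longrightarrow> 0 \<odot> x = \<zero>"
  "x \<in> carrier V \<Longrightarrow> 1 \<odot> x = x"
  "a \<in> K \<Longrightarrow> x \<in> carrier V \<Longrightarrow> a \<odot> x \<in> carrier V"
  "a \<in> K \<Longrightarrow> b \<in> K \<Longrightarrow> x \<in> carrier V \<Longrightarrow> (a + b) \<odot> x = a \<odot> x \<oplus> b \<odot> x"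
  "a \<in> K \<Longrightarrow> x \<in> carrier V \<Longrightarrow> y \<in> carrier V \<Longrightarrow> a \<odot> (x \<oplus> y) = a \<odot> x \<oplus> a \<odot> y"
  "a \<in> K \<Longrightarrow> b \<in> K \<Longrightarrow> x \<in> carrier V \<Longrightarrow> (a * b) \<odot> x = a \<odot> (b \<odot> x)"
  using lmult_0[of x] smult_one[of x] smult_closed[of a x] smult_l_distr[of a b x]
    smult_r_distr[of a x y] smult_assoc1[of a b x] by auto

lemma vector_rules:
  "x \<in> carrier V \<Longrightarrow> y \<in> carrier V \<Longrightarrow> x \<oplus> y = y \<oplus> x"
  "x \<in> carrier V \<Longrightarrow> y \<in> carrier V \<Longrightarrow> z \<in> carrier V \<Longrightarrow> (x \<oplus> y) \<oplus> z = x \<oplus> (y \<oplus> z)"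
  "x \<in> carrier V \<Longrightarrow> x \<oplus> \<zero> = x"
  "x \<in> carrier V \<Longrightarrow> x \<oplus> \<ominus> x = \<zero>"
  "x \<in> carrier V \<Longrightarrow> y \<in> carrier V \<Longrightarrow> x \<oplus> y \<in> carrier V"
  "x \<in> carrier V \<Longrightarrow> \<ominus> x \<in> carrier V"
  "x \<in> carrier V \<Longrightarrow> y \<in> carrier V \<Longrightarrow> x \<ominus> y \<in> carrier V"
  "\<zero> \<in> carrier V"
  "x \<in> carrier V \<Longrightarrow> y \<in> carrier V \<Longrightarrow> (x \<ominus> y) \<oplus> y = x"
  "x \<in> carrier V \<Longrightarrow> y \<in> carrier V \<Longrightarrow> (x \<oplus> y) \<ominus> y = x"
  "x \<in> carrier V \<Longrightarrow> x \<ominus> x = \<zero>"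
  "x \<in> carrier V \<Longrightarrow> x \<ominus> \<zero> = x"
  by (simp_all add: M.a_ac M.r_neg M.minus_eq M.r_neg1 M.r_neg2)

lemma smult_uminus_one: "x \<in> carrier V \<Longrightarrow> (- 1) \<odot> x = \<ominus> x"
proof -
  assume x: "x \<in> carrier V"
  have "(- 1) \<odot> x \<oplus> x = (- 1 + 1) \<odot> x"
    using x K_rules(2)[of x] K_rules(4)[of "-1" 1 x] K_uminus[of 1] K_closed by simp
  then show ?thesis
    using x K_rules K_uminus[of 1] K_closed by (intro minus_equality[symmetric]) auto
qed

lemma functional_zero:
  assumes "linear_functional K V W f" "submodule (ground_field K) W V"
  shows "f \<zero> = 0"
proof -
  interpret W: submodule "ground_field K" W V by fact
  have "f (0 \<odot> \<zero>) = 0 * f \<zero>"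
    using assms(1) K_closed W.zero_closed unfolding linear_functional_def by blast
  then show ?thesis by (simp add: K_rules)
qed

lemma carrier_submodule: "submodule (ground_field K) (carrier V) V"
  by (rule submodule.intro[OF module_axioms]) (auto simp: K_rules)

lemma submodule_minus:
  assumes "submodule (ground_field K) W V" "x \<in> W" "y \<in> W"
  shows "x \<ominus> y \<in> W" "\<ominus> y \<in> W"
proof -
  interpret W: submodule "ground_field K" W V by fact
  have y: "y \<in> carrier V" using W.subset assms(3) by blast
  have "(- 1) \<odot> y \<in> W" using W.smult_closed[of "-1" y] K_uminus[of 1] K_closed assms(3) by simp
  then show "\<ominus> y \<in> W" unfolding smult_uminus_one[OF y] .
  then show "x \<ominus> y \<in> W" unfolding a_minus_def by (rule W.m_closed[OF assms(2)])
qed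

lemma functional_minus:
  assumes "linear_functional K V W f" "submodule (ground_field K) W V" "x \<in> W" "y \<in> W"
  shows "f (x \<ominus> y) = f x - f y"
proof -
  interpret W: submodule "ground_field K" W V by fact
  have y: "y \<in> carrier V" using assms W.subset by auto
  have "f (\<ominus> y) = - f y"
    using assms K_uminus[of 1] K_closed unfolding smult_uminus_one[OF y, symmetric] linear_functional_def
    by auto
  then show ?thesis
    using assms submodule_minus[OF assms(2,3,4)] unfolding a_minus_def linear_functional_def by auto
qed

lemma functional_finsum:
  assumes "linear_functional K V W f" "submodule (ground_field K) W V"
    and "finite I" "\<And>i. i \<in> I \<Longrightarrow> g i \<in> W"
  shows "(\<Oplus>i\<in>I. g i) \<in> W \<and> f (\<Oplus>i\<in>I. g i) = (\<Sum>i\<in>I. f (g i))"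
  using assms(3,4)
proof (induction I rule: finite_induct)
  case empty
  then show ?case using functional_zero[OF assms(1,2)] submodule.zero_closed[OF assms(2)] by simp
next
  case (insert i I)
  interpret W: submodule "ground_field K" W V by fact
  have "(\<Oplus>i\<in>insert i I. g i) = g i \<oplus> (\<Oplus>i\<in>I. g i)"
    using insert W.subset by (intro finsum_insert) auto
  then show ?case
    using insert assms(1) unfolding linear_functional_def by auto
qed

lemma basis_coordinate_system:
  assumes "is_basis (ground_field K) V us"
  shows "coordinate_system K V us (coord (ground_field K) V us)"
proof -
  let ?c = "coord (ground_field K) V us" and ?n = "length us"
  have dist: "distinct us" and sub: "set us \<subseteq> carrier V" and bas: "basis (set us)"
    using assms unfolding is_basis_def basis_def by blast+
  have ex1: "\<exists>!a. a \<in> set us \<rightarrow>\<^sub>E K \<and> lincomb a (set us) = x" if "x \<in> carrier V" for x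
    using bas that unfolding basis_criterion[OF finite_set sub] by simp
  have c: "(\<lambda>v\<in>set us. a v) = (THE a. a \<in> set us \<rightarrow>\<^sub>E K \<and> lincomb a (set us) = x)"
    if "x \<in> carrier V" "a \<in> set us \<rightarrow> K" "lincomb a (set us) = x" for a x
  proof (rule the1_equality[OF ex1[OF that(1)], symmetric])
    have "lincomb (\<lambda>v\<in>set us. a v) (set us) = lincomb a (set us)"
      using that sub by (intro lincomb_cong) auto
    then show "(\<lambda>v\<in>set us. a v) \<in> set us \<rightarrow>\<^sub>E K \<and> lincomb (\<lambda>v\<in>set us. a v) (set us) = x"
      using that by auto
  qed
  have coordI: "?c x i = a (us ! i)"
    if "x \<in> carrier V" "a \<in> set us \<rightarrow> K" "lincomb a (set us) = x" "i < ?n" for a x i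
    unfolding coord_def using c[OF that(1-3)] that(4) by (simp flip: c[OF that(1-3)])
  have ex: "\<exists>a. a \<in> set us \<rightarrow> K \<and> lincomb a (set us) = x \<and> (\<forall>i<?n. ?c x i = a (us ! i))"
    if x: "x \<in> carrier V" for x
  proof -
    obtain a where "a \<in> set us \<rightarrow>\<^sub>E K" "lincomb a (set us) = x" using ex1[OF x] by blast
    then show ?thesis using coordI[OF x, of a] by (intro exI[of _ a]) (auto simp: PiE_def)
  qed
  have add: "?c (x \<oplus> y) i = ?c x i + ?c y i" if xy: "x \<in> carrier V" "y \<in> carrier V" "i < ?n" for x y i
  proof -
    obtain a where a: "a \<in> set us \<rightarrow> K" "lincomb a (set us) = x" "\<forall>i<?n. ?c x i = a (us ! i)"
      using ex[OF xy(1)] by auto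
    obtain b where b: "b \<in> set us \<rightarrow> K" "lincomb b (set us) = y" "\<forall>i<?n. ?c y i = b (us ! i)"
      using ex[OF xy(2)] by auto
    have "lincomb (\<lambda>v. a v + b v) (set us) = x \<oplus> y"
      using lincomb_sum[of "set us" a b] sub a b by simp
    then show ?thesis
      using coordI[of "x \<oplus> y" "\<lambda>v. a v + b v" i] a b xy K_closed by (auto simp: Pi_def)
  qed
  have smult: "?c (r \<odot> x) i = r * ?c x i" if xy: "x \<in> carrier V" "r \<in> K" "i < ?n" for x r i
  proof -
    obtain a where a: "a \<in> set us \<rightarrow> K" "lincomb a (set us) = x" "\<forall>i<?n. ?c x i = a (us ! i)"
      using ex[OF xy(1)] by auto
    have "lincomb (\<lambda>v. r * a v) (set us) = r \<odot> x"
      using lincomb_smult[of "set us" a r] sub a xy by simp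
    then show ?thesis
      using coordI[of "r \<odot> x" "\<lambda>v. r * a v" i] a xy K_closed K_rules by (auto simp: Pi_def)
  qed
  have delta: "?c (us ! j) i = (if i = j then 1 else 0)" if ij: "i < ?n" "j < ?n" for i j
  proof -
    have v: "us ! j \<in> carrier V" using sub ij by auto
    have "lincomb (\<lambda>v. if v = us ! j then 1 else 0) (set us) = (\<Oplus>v\<in>set us. if v = us ! j then v else \<zero>)"
      unfolding lincomb_def using sub
      by (intro finsum_cong') (auto simp: K_rules)
    also have "\<dots> = us ! j"
      using finsum_singleton[of "us ! j" "set us" "\<lambda>v. v"] sub ij by (simp add: eq_commute subset_iff Pi_def)
    finally show ?thesis
      using coordI[OF v, of "\<lambda>v. if v = us ! j then 1 else 0" i] ij dist K_closed
      by (auto simp: nth_eq_iff_index_eq)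
  qed
  have zero: "x = \<zero>" if x: "x \<in> carrier V" "\<forall>i<?n. ?c x i = 0" for x
  proof -
    obtain a where a: "a \<in> set us \<rightarrow> K" "lincomb a (set us) = x" "\<forall>i<?n. ?c x i = a (us ! i)"
      using ex[OF x(1)] by auto
    have "a v = 0" if "v \<in> set us" for v using a x that by (metis in_set_conv_nth)
    then have "lincomb a (set us) = lincomb (\<lambda>_. 0) (set us)"
      using sub K_closed by (intro lincomb_cong) auto
    also have "\<dots> = \<zero>" using lincomb_zero[of "set us" "\<lambda>_. 0"] sub by simp
    finally show ?thesis using a by simp
  qed
  have "?c x i \<in> K" if "x \<in> carrier V" "i < ?n" for x i
    using ex[OF that(1)] that(2) by (metis Pi_mem nth_mem)
  moreover have "linear_functional K V (carrier V) (\<lambda>x. ?c x i)" if "i < ?n" for i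
    unfolding linear_functional_def using add smult that by blast
  ultimately show ?thesis
    unfolding coordinate_system_def using delta zero sub by (intro conjI) blast+
qed

lemma coordinates_unique:
  assumes "coordinate_system K V us k" "x \<in> carrier V" "y \<in> carrier V"
    and "\<And>i. i < length us \<Longrightarrow> k x i = k y i"
  shows "x = y"
proof -
  have "k (x \<ominus> y) i = 0" if "i < length us" for i
    using functional_minus[OF _ carrier_submodule assms(2,3), of "\<lambda>x. k x i"] assms that
    by (simp add: coordinate_system_def)
  then have "x \<ominus> y = \<zero>" using assms unfolding coordinate_system_def by auto
  then show ?thesis using assms by simp
qed

lemma coordinate_expansion:
  assumes k: "coordinate_system K V us k" and x: "x \<in> carrier V"
  shows "x = (\<Oplus>j\<in>{..<length us}. k x j \<odot> us ! j)"
proof (rule coordinates_unique[OF k x])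
  have in_V: "us ! j \<in> carrier V" if "j < length us" for j
    using k that unfolding coordinate_system_def by auto
  have kK: "k x j \<in> K" if "j < length us" for j
    using k x that unfolding coordinate_system_def by auto
  have term_in: "k x j \<odot> us ! j \<in> carrier V" if "j \<in> {..<length us}" for j
    using in_V kK K_rules that by simp
  then show "(\<Oplus>j\<in>{..<length us}. k x j \<odot> us ! j) \<in> carrier V" by (intro finsum_closed) auto
  fix i assume i: "i < length us"
  have lin: "linear_functional K V (carrier V) (\<lambda>x. k x i)"
    using k i by (simp add: coordinate_system_def)
  have "k (\<Oplus>j\<in>{..<length us}. k x j \<odot> us ! j) i = (\<Sum>j<length us. k (k x j \<odot> us ! j) i)"
    using functional_finsum[OF lin carrier_submodule, of "{..<length us}" "\<lambda>j. k x j \<odot> us ! j"] term_in by auto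
  also have "\<dots> = (\<Sum>j<length us. if i = j then k x j else 0)"
    using lin in_V kK k i by (intro sum.cong refl) (auto simp: linear_functional_def coordinate_system_def)
  finally show "k x i = k (\<Oplus>j\<in>{..<length us}. k x j \<odot> us ! j) i" using i by simp
qed

lemma functional_expansion:
  assumes k: "coordinate_system K V us k" and x: "x \<in> carrier V"
    and f: "linear_functional K V (carrier V) f"
  shows "f x = (\<Sum>j<length us. k x j * f (us ! j))"
proof -
  have in_V: "us ! j \<in> carrier V" if "j < length us" for j
    using k that unfolding coordinate_system_def by auto
  have kK: "k x j \<in> K" if "j < length us" for j
    using k x that unfolding coordinate_system_def by auto
  have "f x = f (\<Oplus>j\<in>{..<length us}. k x j \<odot> us ! j)"
    using coordinate_expansion[OF k x] by simp
  also have "\<dots> = (\<Sum>j<length us. f (k x j \<odot> us ! j))"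
    using functional_finsum[OF f carrier_submodule, of "{..<length us}" "\<lambda>j. k x j \<odot> us ! j"] in_V kK K_rules
    by simp
  also have "\<dots> = (\<Sum>j<length us. k x j * f (us ! j))"
    using f in_V kK by (intro sum.cong refl) (auto simp: linear_functional_def)
  finally show ?thesis .
qed

lemma basis_of_coordinate_system:
  assumes k: "coordinate_system K V us k"
  shows "is_basis (ground_field K) V us"
    and "x \<in> carrier V \<Longrightarrow> i < length us \<Longrightarrow> coord (ground_field K) V us x i = k x i"
proof -
  let ?n = "length us"
  have sub: "set us \<subseteq> carrier V" using k by (simp add: coordinate_system_def)
  have delta: "k (us ! j) i = (if i = j then 1 else 0)" if "i < ?n" "j < ?n" for i j
    using k that by (simp add: coordinate_system_def)
  have dist: "distinct us"
    unfolding distinct_conv_nth using delta by (metis zero_neq_one)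
  have reindex: "lincomb a (set us) = (\<Oplus>j\<in>{..<?n}. a (us ! j) \<odot> us ! j)" if "a \<in> set us \<rightarrow> K" for a
  proof -
    have "set us = (!) us ` {..<?n}" by (auto simp: set_conv_nth)
    then have "lincomb a (set us) = (\<Oplus>v\<in>(!) us ` {..<?n}. a v \<odot> v)"
      unfolding lincomb_def by simp
    also have "\<dots> = (\<Oplus>j\<in>{..<?n}. a (us ! j) \<odot> us ! j)"
      using that sub dist by (intro finsum_reindex) (auto simp: inj_on_nth intro!: K_rules)
    finally show ?thesis .
  qed
  have k_lincomb: "k (lincomb a (set us)) i = a (us ! i)" if a: "a \<in> set us \<rightarrow> K" and i: "i < ?n" for a i
  proof -
    have lin: "linear_functional K V (carrier V) (\<lambda>x. k x i)" using k i by (simp add: coordinate_system_def)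
    have "a (us ! j) \<odot> us ! j \<in> carrier V" if "j < ?n" for j
      using sub a that by (intro K_rules) auto
    then have "k (\<Oplus>j\<in>{..<?n}. a (us ! j) \<odot> us ! j) i = (\<Sum>j<?n. k (a (us ! j) \<odot> us ! j) i)"
      using functional_finsum[OF lin carrier_submodule, of "{..<?n}" "\<lambda>j. a (us ! j) \<odot> us ! j"] by auto
    also have "\<dots> = (\<Sum>j<?n. if i = j then a (us ! j) else 0)"
      using lin sub a delta i by (intro sum.cong refl) (auto simp: linear_functional_def subset_iff Pi_def)
    finally show ?thesis using i reindex[OF a] by simp
  qed
  have inj: "a = b" if "a \<in> set us \<rightarrow>\<^sub>E K" "b \<in> set us \<rightarrow>\<^sub>E K" "lincomb a (set us) = lincomb b (set us)" for a b
  proof (rule PiE_ext[OF that(1,2)])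
    fix v assume "v \<in> set us"
    then obtain i where "i < ?n" "v = us ! i" by (auto simp: in_set_conv_nth)
    then show "a v = b v" using that k_lincomb[of a i] k_lincomb[of b i] by (auto simp: PiE_def)
  qed
  have ex: "\<exists>a. a \<in> set us \<rightarrow>\<^sub>E K \<and> lincomb a (set us) = x \<and> (\<forall>i<?n. a (us ! i) = k x i)" if x: "x \<in> carrier V" for x
  proof -
    define a where "a = (\<lambda>v\<in>set us. k x (the_inv_into {..<?n} ((!) us) v))"
    have a: "a (us ! i) = k x i" if "i < ?n" for i
      using that dist by (simp add: a_def the_inv_into_f_f inj_on_nth)
    have aK: "a \<in> set us \<rightarrow>\<^sub>E K"
    proof -
      have "a v \<in> K" if v: "v \<in> set us" for v
      proof -
        obtain i where "i < ?n" "v = us ! i" using v by (auto simp: in_set_conv_nth)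
        then show ?thesis using a k x by (auto simp: coordinate_system_def)
      qed
      then show ?thesis by (auto simp: a_def PiE_def)
    qed
    then have aK': "a \<in> set us \<rightarrow> K" by (auto simp: PiE_def)
    have "lincomb a (set us) = x"
    proof (rule coordinates_unique[OF k _ x])
      show "lincomb a (set us) \<in> carrier V" using aK' sub by (intro lincomb_closed) auto
    qed (use k_lincomb[OF aK'] a in auto)
    then show ?thesis using aK a by blast
  qed
  have "basis (set us)"
    unfolding basis_criterion[OF finite_set sub] using ex inj by simp metis
  then show "is_basis (ground_field K) V us" using dist by (simp add: is_basis_def)
  assume x: "x \<in> carrier V" and i: "i < ?n"
  obtain a where a: "a \<in> set us \<rightarrow>\<^sub>E K" "lincomb a (set us) = x" "\<forall>i<?n. a (us ! i) = k x i"
    using ex[OF x] by blast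
  have "(THE f. f \<in> set us \<rightarrow>\<^sub>E K \<and> lincomb f (set us) = x) = a"
    using a inj by (intro the_equality) auto
  then show "coord (ground_field K) V us x i = k x i"
    using a i by (simp add: coord_def)
qed

lemma sum_submodule:
  assumes "submodule (ground_field K) X V" "submodule (ground_field K) Y V"
  shows "submodule (ground_field K) {x \<oplus> y | x y. x \<in> X \<and> y \<in> Y} V"
proof -
  have "{x \<oplus> y | x y. x \<in> X \<and> y \<in> Y} = submodule_sum X Y"
    unfolding submodule_sum_def by auto
  then show ?thesis using sum_is_submodule[OF assms] by (simp only:)
qed

text \<open>
  A functional on \<open>X\<close> that vanishes on \<open>X \<inter> Y\<close> extends by zero along \<open>Y\<close>. This is the common source of the
  extension of functionals to the whole space and of the uniqueness of special subquotients.
\<close>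

lemma functional_glue:
  assumes X: "submodule (ground_field K) X V" and Y: "submodule (ground_field K) Y V"
    and f: "linear_functional K V X f" and zero: "\<And>z. z \<in> X \<Longrightarrow> z \<in> Y \<Longrightarrow> f z = 0"
  shows "\<exists>g. linear_functional K V {x \<oplus> y | x y. x \<in> X \<and> y \<in> Y} g \<and> (\<forall>x\<in>X. \<forall>y\<in>Y. g (x \<oplus> y) = f x)"
proof -
  interpret X: submodule "ground_field K" X V by (rule X)
  interpret Y: submodule "ground_field K" Y V by (rule Y)
  have XV: "x \<in> carrier V" if "x \<in> X" for x using that X.subset by blast
  have YV: "y \<in> carrier V" if "y \<in> Y" for y using that Y.subset by blast
  have fD: "f (x \<oplus> y) = f x + f y" "r \<in> K \<Longrightarrow> f (r \<odot> x) = r * f x" if "x \<in> X" "y \<in> X" for x y r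
    using f that unfolding linear_functional_def by blast+
  let ?Z = "{x \<oplus> y | x y. x \<in> X \<and> y \<in> Y}"
  define g where "g = (\<lambda>z. f (SOME x. x \<in> X \<and> (\<exists>y\<in>Y. z = x \<oplus> y)))"
  have g: "g (x \<oplus> y) = f x" if x: "x \<in> X" and y: "y \<in> Y" for x y
  proof -
    define x' where "x' = (SOME x'. x' \<in> X \<and> (\<exists>y'\<in>Y. x \<oplus> y = x' \<oplus> y'))"
    have "x' \<in> X \<and> (\<exists>y'\<in>Y. x \<oplus> y = x' \<oplus> y')"
      unfolding x'_def by (rule someI[of _ x]) (use x y in blast)
    then obtain y' where x': "x' \<in> X" and y': "y' \<in> Y" and eq: "x \<oplus> y = x' \<oplus> y'" by blast
    have "x' \<ominus> x = y \<ominus> y'"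
    proof -
      have "x' = (x \<oplus> y) \<ominus> y'"
        unfolding eq by (simp only: vector_rules(10) XV[OF x'] YV[OF y'])
      also have "\<dots> = (y \<ominus> y') \<oplus> x"
        using XV[OF x] YV[OF y] YV[OF y'] by (simp add: M.minus_eq M.a_ac)
      finally show ?thesis
        by (simp only: vector_rules(10)[OF vector_rules(7)[OF YV[OF y] YV[OF y']] XV[OF x]])
    qed
    then have "f (x' \<ominus> x) = 0"
      using zero[OF submodule_minus(1)[OF X x' x]] submodule_minus(1)[OF Y y y'] by simp
    then have "f x' = f x" using functional_minus[OF f X x' x] by simp
    then show ?thesis unfolding g_def x'_def .
  qed
  have "linear_functional K V ?Z g"
    unfolding linear_functional_def
  proof (intro conjI ballI)
    fix z z' assume "z \<in> ?Z" "z' \<in> ?Z"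
    then obtain x y x' y' where z: "x \<in> X" "y \<in> Y" "z = x \<oplus> y" and z': "x' \<in> X" "y' \<in> Y" "z' = x' \<oplus> y'" by blast
    have "z \<oplus> z' = (x \<oplus> x') \<oplus> (y \<oplus> y')"
      unfolding z z' using XV[OF z(1)] YV[OF z(2)] XV[OF z'(1)] YV[OF z'(2)] by (simp add: M.a_ac)
    then show "g (z \<oplus> z') = g z + g z'"
      by (simp only: g X.m_closed Y.m_closed z z' fD(1))
  next
    fix r z assume r: "r \<in> K" and "z \<in> ?Z"
    then obtain x y where z: "x \<in> X" "y \<in> Y" "z = x \<oplus> y" by blast
    have "r \<odot> x \<in> X" "r \<odot> y \<in> Y" using X.smult_closed[of r x] Y.smult_closed[of r y] r z by simp_all
    then show "g (r \<odot> z) = r * g z"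
      unfolding z K_rules(5)[OF r XV[OF z(1)] YV[OF z(2)]] by (simp only: g z fD(2)[OF z(1) z(1) r])
  qed
  then show ?thesis using g by (intro exI[of _ g]) blast
qed

text \<open>
  The largest domain of an extension, measured by the number of basis vectors it contains, is the
  whole space: a missing basis vector spans a line that meets the domain in zero only, and the
  functional can be extended by zero along that line.
\<close>

lemma functional_extension:
  assumes bas: "is_basis (ground_field K) V us" and W: "submodule (ground_field K) W V"
    and f: "linear_functional K V W f"
  obtains g where "linear_functional K V (carrier V) g" "\<And>x. x \<in> W \<Longrightarrow> g x = f x"
proof -
  define P where "P = (\<lambda>W'. submodule (ground_field K) W' V \<and> W \<subseteq> W' \<and>
      (\<exists>g. linear_functional K V W' g \<and> (\<forall>x\<in>W. g x = f x)))"
  have "P W" using W f by (auto simp: P_def)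
  moreover have "\<forall>W'. P W' \<longrightarrow> card (W' \<inter> set us) < Suc (card (set us))"
    by (auto simp: less_Suc_eq_le intro: card_mono)
  ultimately obtain W' where W': "P W'" and max: "\<And>W''. P W'' \<Longrightarrow> card (W'' \<inter> set us) \<le> card (W' \<inter> set us)"
    using ex_has_greatest_nat[of P W "\<lambda>W'. card (W' \<inter> set us)"] by blast
  interpret W': submodule "ground_field K" W' V using W' by (simp add: P_def)
  obtain g where g: "linear_functional K V W' g" "\<forall>x\<in>W. g x = f x" and WW': "W \<subseteq> W'"
    using W' by (auto simp: P_def)
  have sub: "set us \<subseteq> carrier V" using bas unfolding is_basis_def basis_def by blast
  have "set us \<subseteq> W'"
  proof (rule ccontr)
    assume "\<not> set us \<subseteq> W'"
    then obtain v where v: "v \<in> set us" "v \<notin> W'" by auto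
    then have vV: "v \<in> carrier V" using sub by auto
    \<comment> \<open>The line through the missing basis vector.\<close>
    let ?Y = "(\<lambda>r. r \<odot> v) ` K"
    have Y: "submodule (ground_field K) ?Y V"
    proof (rule submodule.intro[OF module_axioms])
      show "?Y \<subseteq> carrier V" using K_rules(3) vV by blast
      show "\<zero> \<in> ?Y" using imageI[OF K_closed(1), of "\<lambda>r. r \<odot> v"] unfolding K_rules(1)[OF vV] .
      show "x \<oplus> y \<in> ?Y" if "x \<in> ?Y" "y \<in> ?Y" for x y
        using that by (elim imageE) (simp only: K_rules(4)[OF _ _ vV, symmetric], intro imageI K_closed(3))
      show "c \<odot> x \<in> ?Y" if c: "c \<in> carrier (ground_field K)" and x: "x \<in> ?Y" for c x
      proof -
        have cK: "c \<in> K" using c by simp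
        show ?thesis
          using x by (elim imageE) (simp only: K_rules(6)[OF cK _ vV, symmetric], intro imageI K_closed(4) cK)
      qed
    qed
    have meet: "g z = 0" if z: "z \<in> W'" "z \<in> ?Y" for z
    proof -
      obtain r where r: "r \<in> K" "z = r \<odot> v" using z(2) by blast
      have "r = 0"
      proof (rule ccontr)
        assume "r \<noteq> 0"
        note rK = K_inverse[OF r(1) this]
        have "inverse r \<odot> z = v"
          unfolding r(2) K_rules(6)[OF rK r(1) vV, symmetric] using \<open>r \<noteq> 0\<close> K_rules(2)[OF vV] by simp
        moreover have "inverse r \<odot> z \<in> W'" by (rule W'.smult_closed) (use rK z(1) in simp_all)
        ultimately show False using v(2) by simp
      qed
      then have "z = \<zero>" using r(2) K_rules(1)[OF vV] by simp
      then show ?thesis using functional_zero[OF g(1) W'.submodule_axioms] by simp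
    qed
    let ?W = "{x \<oplus> y | x y. x \<in> W' \<and> y \<in> ?Y}"
    obtain h where h: "linear_functional K V ?W h" and hg: "\<And>x y. x \<in> W' \<Longrightarrow> y \<in> ?Y \<Longrightarrow> h (x \<oplus> y) = g x"
      using functional_glue[OF W'.submodule_axioms Y g(1) meet] by blast
    have mem: "x \<oplus> y \<in> ?W" if "x \<in> W'" "y \<in> ?Y" for x y using that by blast
    have W'V: "w \<in> carrier V" if "w \<in> W'" for w using that W'.subset by blast
    have Y0: "\<zero> \<in> ?Y" by (rule submodule.zero_closed[OF Y])
    have W'W: "w \<in> ?W" "h w = g w" if w: "w \<in> W'" for w
      using mem[OF w Y0] hg[OF w Y0] by (simp_all only: M.r_zero W'V[OF w])
    have "\<one>\<^bsub>ground_field K\<^esub> \<odot> v \<in> ?Y" by (rule imageI) (simp add: K_closed)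
    then have "\<zero> \<oplus> v \<in> ?W" using mem[OF W'.zero_closed] by (simp only: smult_one vV)
    then have vW: "v \<in> ?W" by (simp only: M.l_zero vV)
    have "P ?W"
      unfolding P_def
    proof (intro conjI exI[of _ h] ballI)
      show "submodule (ground_field K) ?W V" by (rule sum_submodule[OF W'.submodule_axioms Y])
      show "W \<subseteq> ?W" by (rule subsetI, rule W'W(1)) (rule subsetD[OF WW'])
      show "h x = f x" if "x \<in> W" for x using W'W(2)[OF subsetD[OF WW' that]] g(2) that by simp
    qed (rule h)
    have "W' \<inter> set us \<subset> ?W \<inter> set us"
    proof
      show "W' \<inter> set us \<subseteq> ?W \<inter> set us" by (intro Int_mono subset_refl subsetI W'W(1))
      show "W' \<inter> set us \<noteq> ?W \<inter> set us"
      proof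
        assume eq: "W' \<inter> set us = ?W \<inter> set us"
        have "v \<in> W' \<inter> set us" unfolding eq by (rule IntI[OF vW v(1)])
        then have "v \<in> W'" by (rule IntD1)
        then show False using v(2) by contradiction
      qed
    qed
    then have "card (W' \<inter> set us) < card (?W \<inter> set us)" by (intro psubset_card_mono) simp_all
    then show False using max[OF \<open>P ?W\<close>] by simp
  qed
  then have "span (set us) \<subseteq> W'" using span_is_subset[OF _ W'.submodule_axioms] by simp
  moreover have "span (set us) = carrier V" using bas unfolding is_basis_def basis_def by blast
  ultimately have "W' = carrier V" using W'.subset by simp
  with g(1) have g': "linear_functional K V (carrier V) g" by (simp only:)
  show ?thesis
  proof (rule that[OF g'])
    fix x assume "x \<in> W"
    then show "g x = f x" by (rule g(2)[rule_format])
  qed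
qed

end

section \<open>Ranks and bases of subspaces\<close>

context ground_vectorspace
begin

text \<open>
  The maximal size of a linearly independent subset grows strictly with the subspace. This
  is used to choose minimal submodules without passing to subspaces as vector spaces of their own.
\<close>

lemma submodule_rank:
  assumes fd: "fin_dim"
  shows "\<exists>rank :: 'v set \<Rightarrow> nat. \<forall>W W'. submodule (ground_field K) W V \<longrightarrow>
    submodule (ground_field K) W' V \<longrightarrow> W \<subset> W' \<longrightarrow> rank W < rank W'"
proof -
  define rank where "rank = (\<lambda>W. Max (card ` {A. A \<subseteq> W \<and> lin_indpt A}))"
  have *: "rank W < rank W'"
    if W: "submodule (ground_field K) W V" and W': "submodule (ground_field K) W' V" and lt: "W \<subset> W'" for W W'
  proof -
    interpret W: submodule "ground_field K" W V by fact
    interpret W': submodule "ground_field K" W' V by fact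
    have fin: "finite (card ` {A. A \<subseteq> X \<and> lin_indpt A})" if "X \<subseteq> carrier V" for X
    proof (rule finite_subset[of _ "{..dim}"])
      show "card ` {A. A \<subseteq> X \<and> lin_indpt A} \<subseteq> {..dim}"
        using li_le_dim(2)[OF fd] subset_trans[OF _ that] by blast
    qed simp
    have "lin_indpt {}" unfolding lin_dep_def by blast
    then have "rank W \<in> card ` {A. A \<subseteq> W \<and> lin_indpt A}"
      unfolding rank_def by (intro Max_in fin[OF W.subset]) blast
    then obtain A where A: "A \<subseteq> W" "lin_indpt A" "rank W = card A" by blast
    obtain x where x: "x \<in> W'" "x \<notin> W" using lt by blast
    have AV: "A \<subseteq> carrier V" using A(1) W.subset by (rule subset_trans)
    have xV: "x \<in> carrier V" using x(1) W'.subset by blast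
    have xA: "x \<notin> A" using x(2) A(1) by blast
    have "span A \<subseteq> W" using span_is_subset[OF A(1) W] .
    then have "x \<notin> span A" using x(2) by blast
    then have "lin_indpt (A \<union> {x})"
      using lin_dep_iff_in_span[OF AV A(2) xV xA] by blast
    moreover have "A \<union> {x} \<subseteq> W'" using A(1) x(1) lt by blast
    ultimately have "card (A \<union> {x}) \<in> card ` {A. A \<subseteq> W' \<and> lin_indpt A}" by blast
    then have "card (A \<union> {x}) \<le> rank W'" unfolding rank_def by (intro Max_ge fin[OF W'.subset])
    moreover have "card (A \<union> {x}) = Suc (card A)"
      using card_insert_disjoint[OF li_le_dim(1)[OF fd AV A(2)] xA] by simp
    ultimately show ?thesis unfolding A(3) by linarith
  qed
  show ?thesis by (intro exI[of _ rank] allI impI) (rule *)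
qed

lemma submodule_fin_dim:
  assumes fd: "fin_dim" and W: "submodule (ground_field K) W V"
  shows "vectorspace (ground_field K) (V\<lparr>carrier := W\<rparr>)" "vectorspace.fin_dim (ground_field K) (V\<lparr>carrier := W\<rparr>)"
proof -
  interpret W: submodule "ground_field K" W V by fact
  have "subspace (ground_field K) W V" using W vectorspace_axioms by (simp add: subspace_def)
  then show vsW: "vectorspace (ground_field K) (V\<lparr>carrier := W\<rparr>)" by (rule subspace_is_vs)
  then interpret WV: vectorspace "ground_field K" "V\<lparr>carrier := W\<rparr>" .
  have "\<exists>A. finite A \<and> maximal A (\<lambda>S. S \<subseteq> carrier (V\<lparr>carrier := W\<rparr>) \<and> WV.lin_indpt S)"
  proof (rule maximal_exists[where N = dim and B = "{}"])
    fix A assume A: "A \<subseteq> carrier (V\<lparr>carrier := W\<rparr>) \<and> WV.lin_indpt A"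
    then have sub: "A \<subseteq> W" and li: "WV.lin_indpt A" by simp_all
    have A: "A \<subseteq> carrier V" using sub W.subset by (rule subset_trans)
    have "lin_indpt A" using span_li_not_depend(2)[OF sub W] li by blast
    then show "finite A \<and> card A \<le> dim" using li_le_dim[OF fd A] by blast
    next
    show "{} \<subseteq> carrier (V\<lparr>carrier := W\<rparr>) \<and> WV.lin_indpt {}" unfolding WV.lin_dep_def by auto
  qed
  then obtain A where A: "finite A" "maximal A (\<lambda>S. S \<subseteq> carrier (V\<lparr>carrier := W\<rparr>) \<and> WV.lin_indpt S)"
    by blast
  have "WV.basis A" by (rule WV.max_li_is_basis[OF A(2)])
  then show "WV.fin_dim" unfolding WV.fin_dim_def WV.basis_def using A(1) by blast
qed

lemma basis_fin_dim: "is_basis (ground_field K) V us \<Longrightarrow> fin_dim"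
  unfolding is_basis_def basis_def fin_dim_def by blast

lemma fin_dim_basis:
  assumes "fin_dim" obtains us where "is_basis (ground_field K) V us"
proof -
  obtain B where B: "finite B" "basis B" using finite_basis_exists[OF assms] by blast
  obtain us where us: "set us = B" "distinct us" using finite_distinct_list[OF B(1)] by blast
  have "is_basis (ground_field K) V us" unfolding is_basis_def us(1) using us(2) B(2) by (rule conjI)
  then show ?thesis by (rule that)
qed

end

section \<open>Cosets, eigenvalues and images of modules\<close>

text \<open>
  A homomorphism into \<open>S\<close> that is defined on a subset \<open>Z\<close> of \<open>V\<close>. The target enters only through its operations,
  so the notion applies to a quotient before that is known to be a module.
\<close>

definition module_map_on where
  "module_map_on K A V Z S p \<longleftrightarrow> (\<forall>x\<in>Z. p x \<in> carrier S) \<and>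
    (\<forall>x\<in>Z. \<forall>y\<in>Z. p (x \<oplus>\<^bsub>V\<^esub> y) = p x \<oplus>\<^bsub>S\<^esub> p y) \<and>
    (\<forall>r\<in>K. \<forall>x\<in>Z. p (r \<odot>\<^bsub>V\<^esub> x) = r \<odot>\<^bsub>S\<^esub> p x) \<and>
    (\<forall>a\<in>carrier A. \<forall>x\<in>Z. p (act V a x) = act S a (p x))"

lemma module_map_onD:
  assumes "module_map_on K A V Z S p"
  shows "x \<in> Z \<Longrightarrow> p x \<in> carrier S"
    and "x \<in> Z \<Longrightarrow> y \<in> Z \<Longrightarrow> p (x \<oplus>\<^bsub>V\<^esub> y) = p x \<oplus>\<^bsub>S\<^esub> p y"
    and "r \<in> K \<Longrightarrow> x \<in> Z \<Longrightarrow> p (r \<odot>\<^bsub>V\<^esub> x) = r \<odot>\<^bsub>S\<^esub> p x"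
    and "a \<in> carrier A \<Longrightarrow> x \<in> Z \<Longrightarrow> p (act V a x) = act S a (p x)"
  using assms unfolding module_map_on_def by blast+

context ground_vectorspace
begin

lemma submodule_abelian_subgroup:
  assumes "submodule (ground_field K) U V" shows "abelian_subgroup U V"
proof (rule abelian_subgroupI3[OF additive_subgroup.intro abelian_group_axioms])
  show "subgroup U (add_monoid V)"
  proof (rule subgroup.intro)
    show "U \<subseteq> carrier (add_monoid V)" using submodule.subset[OF assms] by simp
    show "x \<otimes>\<^bsub>add_monoid V\<^esub> y \<in> U" if "x \<in> U" "y \<in> U" for x y
      using submodule.m_closed[OF assms that] by simp
    show "\<one>\<^bsub>add_monoid V\<^esub> \<in> U" using submodule.zero_closed[OF assms] by simp
    show "inv\<^bsub>add_monoid V\<^esub> x \<in> U" if "x \<in> U" for x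
      using submodule_minus(2)[OF assms that that] by (simp add: a_inv_def)
  qed
qed

lemma coset_eq_iff:
  assumes U: "submodule (ground_field K) U V" and x: "x \<in> carrier V" and y: "y \<in> carrier V"
  shows "U +> x = U +> y \<longleftrightarrow> x \<ominus> y \<in> U"
proof -
  interpret abelian_subgroup U V by (rule submodule_abelian_subgroup[OF U])
  have "x \<in> U +> y \<longleftrightarrow> x \<ominus> y \<in> U"
    unfolding a_minus_def by (rule a_rcos_module[OF y x])
  moreover have "x \<in> U +> y \<longleftrightarrow> U +> x = U +> y"
    using a_repr_independence'[OF _ y] a_repr_independenceD[OF x] by metis
  ultimately show ?thesis by blast
qed

lemma coset_self:
  assumes U: "submodule (ground_field K) U V" and x: "x \<in> carrier V"
  shows "x \<in> U +> x"
proof -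
  interpret abelian_subgroup U V by (rule submodule_abelian_subgroup[OF U])
  show ?thesis by (rule a_rcos_self[OF x])
qed

lemma coset_memD:
  assumes U: "submodule (ground_field K) U V" and x: "x \<in> carrier V" and y: "y \<in> U +> x"
  shows "y \<in> carrier V" "U +> y = U +> x"
proof -
  interpret abelian_subgroup U V by (rule submodule_abelian_subgroup[OF U])
  show "U +> y = U +> x" using a_repr_independence'[OF y x] by simp
  show "y \<in> carrier V" using a_elemrcos_carrier[OF x y] .
qed

lemma coset_add:
  assumes U: "submodule (ground_field K) U V" and x: "x \<in> carrier V" and y: "y \<in> carrier V"
  shows "(U +> x) <+> (U +> y) = U +> (x \<oplus> y)"
proof -
  interpret abelian_subgroup U V by (rule submodule_abelian_subgroup[OF U])
  show ?thesis by (rule a_rcos_sum[OF x y])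
qed

end

text \<open>
  A matrix and its transpose have the same characteristic polynomial; so eigenvalues may be tested on
  row vectors, which are the coordinates of functionals.
\<close>

lemma eigenvalue_mat_iff_left_eigenvector:
  fixes F :: "nat \<times> nat \<Rightarrow> complex"
  shows "eigenvalue (mat n n F) \<mu> \<longleftrightarrow>
    (\<exists>y. (\<exists>i<n. y i \<noteq> 0) \<and> (\<forall>t<n. (\<Sum>s<n. F (s, t) * y s) = \<mu> * y t))"
proof -
  let ?N = "mat n n F" and ?T = "transpose_mat (mat n n F)"
  have T: "?T \<in> carrier_mat n n" by simp
  have "eigenvalue ?N \<mu> \<longleftrightarrow> eigenvalue ?T \<mu>"
    using eigenvalue_root_char_poly[of ?N n] eigenvalue_root_char_poly[OF T] char_poly_transpose_mat[of ?N n]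
    by simp
  also have "\<dots> \<longleftrightarrow> (\<exists>v\<in>carrier_vec n. v \<noteq> 0\<^sub>v n \<and> ?T *\<^sub>v v = \<mu> \<cdot>\<^sub>v v)"
    by (auto simp: eigenvalue_def eigenvector_def)
  also have "\<dots> \<longleftrightarrow> (\<exists>y. (\<exists>i<n. y i \<noteq> 0) \<and> (\<forall>t<n. (\<Sum>s<n. F (s, t) * y s) = \<mu> * y t))"
  proof
    assume "\<exists>v\<in>carrier_vec n. v \<noteq> 0\<^sub>v n \<and> ?T *\<^sub>v v = \<mu> \<cdot>\<^sub>v v"
    then obtain v where v: "v \<in> carrier_vec n" "v \<noteq> 0\<^sub>v n" "?T *\<^sub>v v = \<mu> \<cdot>\<^sub>v v" by blast
    have "(\<Sum>s<n. F (s, t) * v $ s) = \<mu> * v $ t" if "t < n" for t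
    proof -
      have "(?T *\<^sub>v v) $ t = (\<mu> \<cdot>\<^sub>v v) $ t" using v(3) by simp
      then show ?thesis using that v(1)
        by (simp add: scalar_prod_def atLeast0LessThan)
    qed
    moreover have "\<exists>i<n. v $ i \<noteq> 0"
    proof (rule ccontr)
      assume "\<not> (\<exists>i<n. v $ i \<noteq> 0)"
      then have "v = 0\<^sub>v n" using v(1) by (intro eq_vecI) auto
      then show False using v(2) by simp
    qed
    ultimately show "\<exists>y. (\<exists>i<n. y i \<noteq> 0) \<and> (\<forall>t<n. (\<Sum>s<n. F (s, t) * y s) = \<mu> * y t)"
      by (intro exI[of _ "\<lambda>i. v $ i"]) blast
  next
    assume "\<exists>y. (\<exists>i<n. y i \<noteq> 0) \<and> (\<forall>t<n. (\<Sum>s<n. F (s, t) * y s) = \<mu> * y t)"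
    then obtain y i where y: "i < n" "y i \<noteq> 0" "\<And>t. t < n \<Longrightarrow> (\<Sum>s<n. F (s, t) * y s) = \<mu> * y t" by blast
    have "vec n y \<noteq> 0\<^sub>v n"
    proof
      assume "vec n y = 0\<^sub>v n"
      then have "vec n y $ i = 0\<^sub>v n $ i" by simp
      then show False using y by simp
    qed
    moreover have "?T *\<^sub>v vec n y = \<mu> \<cdot>\<^sub>v vec n y"
      using y(3) by (intro eq_vecI) (auto simp: scalar_prod_def atLeast0LessThan)
    ultimately show "\<exists>v\<in>carrier_vec n. v \<noteq> 0\<^sub>v n \<and> ?T *\<^sub>v v = \<mu> \<cdot>\<^sub>v v"
      by (intro bexI[of _ "vec n y"]) auto
  qed
  finally show ?thesis .
qed

context ground_vectorspace
begin

lemma eigenvalue_matrix_of_iff: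
  assumes bas: "is_basis (ground_field K) V us"
    and T: "\<And>x. x \<in> carrier V \<Longrightarrow> T x \<in> carrier V"
    and T_add: "\<And>x y. x \<in> carrier V \<Longrightarrow> y \<in> carrier V \<Longrightarrow> T (x \<oplus> y) = T x \<oplus> T y"
    and T_smult: "\<And>r x. r \<in> K \<Longrightarrow> x \<in> carrier V \<Longrightarrow> T (r \<odot> x) = r \<odot> T x"
  shows "eigenvalue (matrix_of (ground_field K) V us T) \<mu> \<longleftrightarrow>
    (\<exists>g. linear_functional K V (carrier V) g \<and> (\<exists>x\<in>carrier V. g x \<noteq> 0) \<and>
      (\<forall>x\<in>carrier V. g (T x) = \<mu> * g x))" (is "?L \<longleftrightarrow> ?R")
proof -
  let ?c = "coord (ground_field K) V us" and ?n = "length us"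
  note cs = basis_coordinate_system[OF bas]
  have us: "us ! i \<in> carrier V" if "i < ?n" for i
    using cs that unfolding coordinate_system_def by auto
  have L: "?L \<longleftrightarrow> (\<exists>y. (\<exists>i<?n. y i \<noteq> 0) \<and> (\<forall>t<?n. (\<Sum>s<?n. ?c (T (us ! t)) s * y s) = \<mu> * y t))"
    unfolding matrix_of_def eigenvalue_mat_iff_left_eigenvector by simp
  have gT: "linear_functional K V (carrier V) (\<lambda>x. g (T x))" if "linear_functional K V (carrier V) g" for g
    using that T T_add T_smult by (auto simp: linear_functional_def)
  show ?thesis
  proof
    assume ?L
    then obtain y i where i: "i < ?n" "y i \<noteq> 0"
      and y: "\<And>t. t < ?n \<Longrightarrow> (\<Sum>s<?n. ?c (T (us ! t)) s * y s) = \<mu> * y t" unfolding L by blast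
    define g where "g = (\<lambda>x. \<Sum>s<?n. ?c x s * y s)"
    have g: "linear_functional K V (carrier V) g"
      using cs unfolding g_def coordinate_system_def linear_functional_def
      by (simp add: sum.distrib sum_distrib_left algebra_simps)
    have gu: "g (us ! t) = y t" if "t < ?n" for t
    proof -
      have "g (us ! t) = (\<Sum>s<?n. if s = t then y s else 0)"
        unfolding g_def using cs that by (intro sum.cong refl) (simp add: coordinate_system_def)
      then show ?thesis using that by simp
    qed
    have "g (T x) = \<mu> * g x" if x: "x \<in> carrier V" for x
    proof -
      have "g (T x) = (\<Sum>t<?n. ?c x t * g (T (us ! t)))"
        by (rule functional_expansion[OF cs x gT[OF g]])
      also have "\<dots> = (\<Sum>t<?n. ?c x t * (\<mu> * y t))"
          using y by (intro sum.cong refl) (simp add: g_def)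
      also have "\<dots> = \<mu> * g x" by (simp add: g_def sum_distrib_left mult_ac)
      finally show ?thesis .
    qed
    moreover have "\<exists>x\<in>carrier V. g x \<noteq> 0" using gu[OF i(1)] i us by metis
    ultimately show ?R using g by blast
  next
    assume ?R
    then obtain g where g: "linear_functional K V (carrier V) g" and nz: "\<exists>x\<in>carrier V. g x \<noteq> 0"
      and gTx: "\<And>x. x \<in> carrier V \<Longrightarrow> g (T x) = \<mu> * g x" by blast
    have "(\<Sum>s<?n. ?c (T (us ! t)) s * g (us ! s)) = \<mu> * g (us ! t)" if "t < ?n" for t
      using functional_expansion[OF cs T[OF us[OF that]] g] gTx[OF us[OF that]] by simp
    moreover have "\<exists>i<?n. g (us ! i) \<noteq> 0"
    proof (rule ccontr)
      assume "\<not> (\<exists>i<?n. g (us ! i) \<noteq> 0)"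
      then have "g x = 0" if "x \<in> carrier V" for x
        using functional_expansion[OF cs that g] by simp
      then show False using nz by blast
    qed
    ultimately show ?L unfolding L by (intro exI[of _ "\<lambda>i. g (us ! i)"]) blast
  qed
qed

end

lemma algebra_ring_rules:
  assumes "unital_algebra k A"
  shows "\<one>\<^bsub>A\<^esub> \<in> carrier A"
    and "x \<in> carrier A \<Longrightarrow> y \<in> carrier A \<Longrightarrow> x \<otimes>\<^bsub>A\<^esub> y \<in> carrier A"
    and "x \<in> carrier A \<Longrightarrow> y \<in> carrier A \<Longrightarrow> z \<in> carrier A \<Longrightarrow>
      (x \<otimes>\<^bsub>A\<^esub> y) \<otimes>\<^bsub>A\<^esub> z = x \<otimes>\<^bsub>A\<^esub> (y \<otimes>\<^bsub>A\<^esub> z)"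
    and "x \<in> carrier A \<Longrightarrow> \<one>\<^bsub>A\<^esub> \<otimes>\<^bsub>A\<^esub> x = x"
    and "x \<in> carrier A \<Longrightarrow> x \<otimes>\<^bsub>A\<^esub> \<one>\<^bsub>A\<^esub> = x"
    and "x \<in> carrier A \<Longrightarrow> y \<in> carrier A \<Longrightarrow> z \<in> carrier A \<Longrightarrow>
      (x \<oplus>\<^bsub>A\<^esub> y) \<otimes>\<^bsub>A\<^esub> z = x \<otimes>\<^bsub>A\<^esub> z \<oplus>\<^bsub>A\<^esub> y \<otimes>\<^bsub>A\<^esub> z"
    and "x \<in> carrier A \<Longrightarrow> y \<in> carrier A \<Longrightarrow> z \<in> carrier A \<Longrightarrow>
      z \<otimes>\<^bsub>A\<^esub> (x \<oplus>\<^bsub>A\<^esub> y) = z \<otimes>\<^bsub>A\<^esub> x \<oplus>\<^bsub>A\<^esub> z \<otimes>\<^bsub>A\<^esub> y"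
proof -
  interpret ring A using assms by (simp add: unital_algebra_def)
  show "\<one>\<^bsub>A\<^esub> \<in> carrier A" by simp
  show "x \<in> carrier A \<Longrightarrow> y \<in> carrier A \<Longrightarrow> x \<otimes>\<^bsub>A\<^esub> y \<in> carrier A" by simp
  show "x \<in> carrier A \<Longrightarrow> \<one>\<^bsub>A\<^esub> \<otimes>\<^bsub>A\<^esub> x = x" "x \<in> carrier A \<Longrightarrow> x \<otimes>\<^bsub>A\<^esub> \<one>\<^bsub>A\<^esub> = x" by simp_all
  show "x \<in> carrier A \<Longrightarrow> y \<in> carrier A \<Longrightarrow> z \<in> carrier A \<Longrightarrow>
      (x \<otimes>\<^bsub>A\<^esub> y) \<otimes>\<^bsub>A\<^esub> z = x \<otimes>\<^bsub>A\<^esub> (y \<otimes>\<^bsub>A\<^esub> z)" by (simp add: m_assoc)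
  show "x \<in> carrier A \<Longrightarrow> y \<in> carrier A \<Longrightarrow> z \<in> carrier A \<Longrightarrow>
      (x \<oplus>\<^bsub>A\<^esub> y) \<otimes>\<^bsub>A\<^esub> z = x \<otimes>\<^bsub>A\<^esub> z \<oplus>\<^bsub>A\<^esub> y \<otimes>\<^bsub>A\<^esub> z" by (simp add: l_distr)
  show "x \<in> carrier A \<Longrightarrow> y \<in> carrier A \<Longrightarrow> z \<in> carrier A \<Longrightarrow>
      z \<otimes>\<^bsub>A\<^esub> (x \<oplus>\<^bsub>A\<^esub> y) = z \<otimes>\<^bsub>A\<^esub> x \<oplus>\<^bsub>A\<^esub> z \<otimes>\<^bsub>A\<^esub> y" by (simp add: r_distr)
qed

lemma ground_field_simps:
  "carrier (ground_field K) = K" "a \<otimes>\<^bsub>ground_field K\<^esub> b = a * b" "a \<oplus>\<^bsub>ground_field K\<^esub> b = a + b"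
  "\<one>\<^bsub>ground_field K\<^esub> = 1" "\<zero>\<^bsub>ground_field K\<^esub> = 0"
  by simp_all

text \<open>
  All axioms of a left module are identities, apart from closure and the existence of negatives, and
  thus pass to surjective images. For subquotients this reduces the axioms to the compatibility of
  the projection with the operations.
\<close>

lemma image_of_left_module:
  assumes V: "left_module (ground_field K) A V" and Z: "is_lsubmodule (ground_field K) A V Z"
    and p: "module_map_on K A V Z S p" and surj: "p ` Z = carrier S" and zero: "\<zero>\<^bsub>S\<^esub> = p \<zero>\<^bsub>V\<^esub>"
  shows "left_module (ground_field K) A S"
proof -
  interpret V: left_module "ground_field K" A V by fact
  interpret gv: ground_vectorspace K V by (rule ground_vectorspace.intro[OF V.V.vectorspace_axioms])
  interpret ga: ground_vectorspace K A by (rule ground_vectorspace.intro[OF V.A.vectorspace_axioms])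
  have Zs: "submodule (ground_field K) Z V" and Za: "\<And>a x. a \<in> carrier A \<Longrightarrow> x \<in> Z \<Longrightarrow> act V a x \<in> Z"
    using Z unfolding is_lsubmodule_def by blast+
  interpret Z: submodule "ground_field K" Z V by (rule Zs)
  have Zr: "r \<odot>\<^bsub>V\<^esub> x \<in> Z" if "r \<in> K" "x \<in> Z" for r x using Z.smult_closed[of r x] that by simp
  have ZV: "x \<in> carrier V" if "x \<in> Z" for x using Z.subset that by blast
  note pD = module_map_onD[OF p] and arr = algebra_ring_rules[OF V.A.unital_algebra_axioms]
    and act_smult = V.act_smult_left[unfolded ground_field_simps] V.act_smult_right[unfolded ground_field_simps]
  note collapse = pD(2-4)[symmetric] and closed = pD(1) Zr Za Z.m_closed ZV
  have vS: "vectorspace (ground_field K) S"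
  proof (rule vs_criteria)
    show "Ring.field (ground_field K)" by (rule V.A.field_axioms)
    show "\<zero>\<^bsub>S\<^esub> \<in> carrier S" using pD(1)[OF Z.zero_closed] by (simp only: zero)
    show "\<forall>v\<in>carrier S. \<exists>neg_v\<in>carrier S. v \<oplus>\<^bsub>S\<^esub> neg_v = \<zero>\<^bsub>S\<^esub>"
    proof
      fix v assume "v \<in> carrier S"
      then obtain x where x: "x \<in> Z" "v = p x" unfolding surj[symmetric] by blast
      have m: "\<ominus>\<^bsub>V\<^esub> x \<in> Z" by (rule gv.submodule_minus(2)[OF Zs x(1) x(1)])
      have "v \<oplus>\<^bsub>S\<^esub> p (\<ominus>\<^bsub>V\<^esub> x) = \<zero>\<^bsub>S\<^esub>"
        by (simp only: x zero m collapse gv.vector_rules(4)[OF ZV[OF x(1)]])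
      then show "\<exists>neg_v\<in>carrier S. v \<oplus>\<^bsub>S\<^esub> neg_v = \<zero>\<^bsub>S\<^esub>" using pD(1)[OF m] by blast
    qed
    show "\<forall>v w. v \<in> carrier S \<and> w \<in> carrier S \<longrightarrow> v \<oplus>\<^bsub>S\<^esub> w = w \<oplus>\<^bsub>S\<^esub> v"
    proof (intro allI impI, elim conjE)
      fix v w assume "v \<in> carrier S" "w \<in> carrier S"
      then obtain x y where xy: "x \<in> Z" "y \<in> Z" "v = p x" "w = p y" unfolding surj[symmetric] by blast
      show "v \<oplus>\<^bsub>S\<^esub> w = w \<oplus>\<^bsub>S\<^esub> v"
        unfolding xy(3,4) pD(2)[OF xy(1,2), symmetric] pD(2)[OF xy(2,1), symmetric]
        by (rule arg_cong[OF gv.vector_rules(1)[OF ZV[OF xy(1)] ZV[OF xy(2)]]])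
    qed
  qed (unfold surj[symmetric] zero,
      (intro allI ballI impI; elim conjE imageE;
        simp only: imageI ground_field_simps collapse closed Z.zero_closed gv.K_closed gv.K_rules gv.vector_rules(2,3))+)
  show ?thesis
    by (intro left_module.intro left_module_axioms.intro vS V.A.unital_algebra_axioms;
        unfold surj[symmetric]; elim imageE;
        simp only: imageI ground_field_simps collapse closed arr(1,2) ga.vector_rules(5) ga.K_rules(3)
          V.act_add_left V.act_add_right V.act_mult V.act_one act_smult)
qed

section \<open>Submodules and simple subquotients\<close>

locale ground_module = ground_vectorspace K V
  for K :: "complex set" and A :: "(complex, 'a) module" and V :: "(complex, 'a, 'v) lmodule" (structure) +
  assumes left_module_axiom: "left_module (ground_field K) A V"
begin

abbreviation "lsub \<equiv> is_lsubmodule (ground_field K) A V"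

lemma algebra: "unital_algebra (ground_field K) A"
  using left_module_axiom unfolding left_module_def by blast

lemma act_rules:
  "a \<in> carrier A \<Longrightarrow> x \<in> carrier V \<Longrightarrow> act V a x \<in> carrier V"
  "a \<in> carrier A \<Longrightarrow> x \<in> carrier V \<Longrightarrow> y \<in> carrier V \<Longrightarrow> act V a (x \<oplus> y) = act V a x \<oplus> act V a y"
  "a \<in> carrier A \<Longrightarrow> b \<in> carrier A \<Longrightarrow> x \<in> carrier V \<Longrightarrow> act V (a \<oplus>\<^bsub>A\<^esub> b) x = act V a x \<oplus> act V b x"
  "r \<in> K \<Longrightarrow> a \<in> carrier A \<Longrightarrow> x \<in> carrier V \<Longrightarrow> act V (r \<odot>\<^bsub>A\<^esub> a) x = r \<odot> act V a x"
  "r \<in> K \<Longrightarrow> a \<in> carrier A \<Longrightarrow> x \<in> carrier V \<Longrightarrow> act V a (r \<odot> x) = r \<odot> act V a x"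
  "a \<in> carrier A \<Longrightarrow> b \<in> carrier A \<Longrightarrow> x \<in> carrier V \<Longrightarrow> act V (a \<otimes>\<^bsub>A\<^esub> b) x = act V a (act V b x)"
  "x \<in> carrier V \<Longrightarrow> act V \<one>\<^bsub>A\<^esub> x = x"
proof -
  interpret L: left_module "ground_field K" A V by (rule left_module_axiom)
  show "a \<in> carrier A \<Longrightarrow> x \<in> carrier V \<Longrightarrow> act V a x \<in> carrier V" by (rule L.act_closed)
  show "a \<in> carrier A \<Longrightarrow> x \<in> carrier V \<Longrightarrow> y \<in> carrier V \<Longrightarrow> act V a (x \<oplus> y) = act V a x \<oplus> act V a y"
    by (rule L.act_add_right)
  show "a \<in> carrier A \<Longrightarrow> b \<in> carrier A \<Longrightarrow> x \<in> carrier V \<Longrightarrow> act V (a \<oplus>\<^bsub>A\<^esub> b) x = act V a x \<oplus> act V b x"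
    by (rule L.act_add_left)
  show "r \<in> K \<Longrightarrow> a \<in> carrier A \<Longrightarrow> x \<in> carrier V \<Longrightarrow> act V (r \<odot>\<^bsub>A\<^esub> a) x = r \<odot> act V a x"
    by (rule L.act_smult_left) simp_all
  show "r \<in> K \<Longrightarrow> a \<in> carrier A \<Longrightarrow> x \<in> carrier V \<Longrightarrow> act V a (r \<odot> x) = r \<odot> act V a x"
    by (rule L.act_smult_right) simp_all
  show "a \<in> carrier A \<Longrightarrow> b \<in> carrier A \<Longrightarrow> x \<in> carrier V \<Longrightarrow> act V (a \<otimes>\<^bsub>A\<^esub> b) x = act V a (act V b x)"
    by (rule L.act_mult)
  show "x \<in> carrier V \<Longrightarrow> act V \<one>\<^bsub>A\<^esub> x = x" by (rule L.act_one)
qed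

lemma lsubI:
  assumes "\<And>x. x \<in> W \<Longrightarrow> x \<in> carrier V" "\<zero> \<in> W" "\<And>x y. x \<in> W \<Longrightarrow> y \<in> W \<Longrightarrow> x \<oplus> y \<in> W"
    "\<And>r x. r \<in> K \<Longrightarrow> x \<in> W \<Longrightarrow> r \<odot> x \<in> W" "\<And>a x. a \<in> carrier A \<Longrightarrow> x \<in> W \<Longrightarrow> act V a x \<in> W"
  shows "lsub W"
  unfolding is_lsubmodule_def
proof (intro conjI ballI)
  show "submodule (ground_field K) W V"
  proof (rule submodule.intro[OF module_axioms])
    show "W \<subseteq> carrier V" using assms(1) by (rule subsetI)
    show "r \<odot> x \<in> W" if "r \<in> carrier (ground_field K)" "x \<in> W" for r x
      by (rule assms(4)) (use that in simp_all)
  qed (fact assms(2,3))+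
qed (fact assms(5))

lemma lsub_submodule: "lsub W \<Longrightarrow> submodule (ground_field K) W V"
  unfolding is_lsubmodule_def by (rule conjunct1)

lemma lsubD:
  assumes "lsub W"
  shows "x \<in> W \<Longrightarrow> x \<in> carrier V" "\<zero> \<in> W" "x \<in> W \<Longrightarrow> y \<in> W \<Longrightarrow> x \<oplus> y \<in> W"
    "r \<in> K \<Longrightarrow> x \<in> W \<Longrightarrow> r \<odot> x \<in> W" "a \<in> carrier A \<Longrightarrow> x \<in> W \<Longrightarrow> act V a x \<in> W"
    "x \<in> W \<Longrightarrow> y \<in> W \<Longrightarrow> x \<ominus> y \<in> W"
proof -
  have s: "submodule (ground_field K) W V" by (rule lsub_submodule[OF assms])
  show "x \<in> W \<Longrightarrow> x \<in> carrier V" using submodule.subset[OF s] by (rule subsetD)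
  show "\<zero> \<in> W" by (rule submodule.zero_closed[OF s])
  show "x \<in> W \<Longrightarrow> y \<in> W \<Longrightarrow> x \<oplus> y \<in> W" by (rule submodule.m_closed[OF s])
  show "r \<in> K \<Longrightarrow> x \<in> W \<Longrightarrow> r \<odot> x \<in> W" by (rule submodule.smult_closed[OF s]) simp_all
  show "a \<in> carrier A \<Longrightarrow> x \<in> W \<Longrightarrow> act V a x \<in> W"
    using assms unfolding is_lsubmodule_def by blast
  show "x \<in> W \<Longrightarrow> y \<in> W \<Longrightarrow> x \<ominus> y \<in> W" by (rule submodule_minus(1)[OF s])
qed

lemma lsub_subset: "lsub W \<Longrightarrow> W \<subseteq> carrier V"
  using lsubD(1) by blast

lemma lsub_carrier: "lsub (carrier V)"
  by (rule lsubI) (auto intro: vector_rules K_rules act_rules)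

lemma act_minus:
  assumes "a \<in> carrier A" "x \<in> carrier V" "y \<in> carrier V"
  shows "act V a (x \<ominus> y) = act V a x \<ominus> act V a y"
proof -
  have "act V a x = act V a ((x \<ominus> y) \<oplus> y)" by (simp only: vector_rules(9) assms)
  also have "\<dots> = act V a (x \<ominus> y) \<oplus> act V a y" by (simp only: act_rules(2) vector_rules(7) assms)
  finally have "act V a x \<ominus> act V a y = (act V a (x \<ominus> y) \<oplus> act V a y) \<ominus> act V a y" by (rule arg_cong)
  then show ?thesis by (simp only: vector_rules(7,10) act_rules(1) assms)
qed

lemma lsub_sum:
  assumes X: "lsub X" and Y: "lsub Y"
  shows "lsub {x \<oplus> y | x y. x \<in> X \<and> y \<in> Y}"
  unfolding is_lsubmodule_def
proof (intro conjI ballI)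
  show "submodule (ground_field K) {x \<oplus> y | x y. x \<in> X \<and> y \<in> Y} V"
    by (rule sum_submodule[OF lsub_submodule[OF X] lsub_submodule[OF Y]])
  fix a z assume a: "a \<in> carrier A" and "z \<in> {x \<oplus> y | x y. x \<in> X \<and> y \<in> Y}"
  then obtain x y where z: "x \<in> X" "y \<in> Y" "z = x \<oplus> y" by blast
  show "act V a z \<in> {x \<oplus> y | x y. x \<in> X \<and> y \<in> Y}"
    unfolding z act_rules(2)[OF a lsubD(1)[OF X z(1)] lsubD(1)[OF Y z(2)]]
    using lsubD(5)[OF X a z(1)] lsubD(5)[OF Y a z(2)] by blast
qed

text \<open>
  The operations of a subquotient are unions over all representatives of a coset. The members of each
  union coincide, because addition, scaling and action respect the congruence modulo \<open>U\<close>.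
\<close>

lemma quotient_map:
  assumes W: "lsub W" and U: "lsub U"
  shows "module_map_on K A V W (subquotient V W U) (\<lambda>w. U +> w)"
proof -
  let ?S = "subquotient V W U"
  note Us = lsub_submodule[OF U]
  have Un: "(\<Union>x\<in>U +> w. U +> f x) = U +> f w"
    if w: "w \<in> carrier V" and f: "\<And>x. x \<in> U +> w \<Longrightarrow> U +> f x = U +> f w" for w f
  proof -
    have "(\<Union>x\<in>U +> w. U +> f x) = (\<Union>x\<in>U +> w. U +> f w)" by (rule SUP_cong[OF refl f])
    also have "\<dots> = U +> f w" by (rule UN_constant_eq[OF coset_self[OF Us w] ballI[OF refl]])
    finally show ?thesis .
  qed
  have rep: "U +> f x = U +> f w"
    if w: "w \<in> carrier V" and x: "x \<in> U +> w" and f_closed: "\<And>x. x \<in> carrier V \<Longrightarrow> f x \<in> carrier V"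
      and f_U: "\<And>x. x \<in> U \<Longrightarrow> f x \<in> U"
      and f_minus: "\<And>x y. x \<in> carrier V \<Longrightarrow> y \<in> carrier V \<Longrightarrow> f (x \<ominus> y) = f x \<ominus> f y" for w x f
  proof -
    have xV: "x \<in> carrier V" by (rule coset_memD(1)[OF Us w x])
    have "x \<ominus> w \<in> U" using coset_memD(2)[OF Us w x] unfolding coset_eq_iff[OF Us xV w] .
    then have "f (x \<ominus> w) \<in> U" by (rule f_U)
    then have "f x \<ominus> f w \<in> U" unfolding f_minus[OF xV w] .
    then show ?thesis unfolding coset_eq_iff[OF Us f_closed[OF xV] f_closed[OF w]] .
  qed
  have smult_minus: "r \<odot> (x \<ominus> y) = r \<odot> x \<ominus> r \<odot> y" if r: "r \<in> K" and x: "x \<in> carrier V" and y: "y \<in> carrier V" for r x y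
  proof -
    have "r \<odot> x = r \<odot> ((x \<ominus> y) \<oplus> y)" by (simp only: vector_rules(9) x y)
    also have "\<dots> = r \<odot> (x \<ominus> y) \<oplus> r \<odot> y" by (simp only: K_rules(5) vector_rules(7) x y r)
    finally have "r \<odot> x \<ominus> r \<odot> y = (r \<odot> (x \<ominus> y) \<oplus> r \<odot> y) \<ominus> r \<odot> y" by (rule arg_cong)
    then show ?thesis by (simp only: vector_rules(7,10) K_rules(3) x y r)
  qed
  show ?thesis
    unfolding module_map_on_def
  proof (intro conjI ballI)
    fix w assume w: "w \<in> W"
    have wV: "w \<in> carrier V" by (rule lsubD(1)[OF W w])
    show "U +> w \<in> carrier ?S" using w by (simp add: subquotient_def)
    show "U +> (r \<odot> w) = r \<odot>\<^bsub>?S\<^esub> (U +> w)" if r: "r \<in> K" for r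
    proof -
      have "(\<Union>x\<in>U +> w. U +> (r \<odot> x)) = U +> (r \<odot> w)"
      proof (rule Un[OF wV], rule rep[OF wV])
        show "r \<odot> x \<in> carrier V" if "x \<in> carrier V" for x by (rule K_rules(3)[OF r that])
        show "r \<odot> x \<in> U" if "x \<in> U" for x by (rule lsubD(4)[OF U r that])
      qed (assumption, rule smult_minus[OF r])
      then show ?thesis by (simp add: subquotient_def)
    qed
    show "U +> act V a w = act ?S a (U +> w)" if a: "a \<in> carrier A" for a
    proof -
      have "(\<Union>x\<in>U +> w. U +> act V a x) = U +> act V a w"
      proof (rule Un[OF wV], rule rep[OF wV])
        show "act V a x \<in> carrier V" if "x \<in> carrier V" for x by (rule act_rules(1)[OF a that])
        show "act V a x \<in> U" if "x \<in> U" for x by (rule lsubD(5)[OF U a that])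
      qed (assumption, rule act_minus[OF a])
      then show ?thesis by (simp add: subquotient_def)
    qed
    fix w' assume w': "w' \<in> W"
    show "U +> (w \<oplus> w') = (U +> w) \<oplus>\<^bsub>?S\<^esub> (U +> w')"
      using coset_add[OF Us wV lsubD(1)[OF W w']] by (simp add: subquotient_def)
  qed
qed

lemma subquotient_simps:
  "carrier (subquotient V W U) = (\<lambda>w. U +> w) ` W" "\<zero>\<^bsub>subquotient V W U\<^esub> = U"
  by (simp_all add: subquotient_def)

lemma coset_zero: "lsub U \<Longrightarrow> U +> \<zero> = U"
  by (rule a_coset_add_zero) (use lsubD(1) in blast)

lemma coset_eq_U_iff:
  assumes U: "lsub U" and x: "x \<in> carrier V" shows "U +> x = U \<longleftrightarrow> x \<in> U"
  using coset_eq_iff[OF lsub_submodule[OF U] x vector_rules(8)] coset_zero[OF U] vector_rules(12)[OF x] by simp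

lemma subquotient_left_module:
  assumes W: "lsub W" and U: "lsub U"
  shows "left_module (ground_field K) A (subquotient V W U)"
  by (rule image_of_left_module[OF left_module_axiom W quotient_map[OF W U]])
    (simp_all only: subquotient_simps coset_zero[OF U])

end

lemma image_lsub:
  assumes C: "ground_module K A C" and V: "ground_module K A V"
    and \<phi>: "module_map_on K A C Z V \<phi>" and X: "is_lsubmodule (ground_field K) A C X" and XZ: "X \<subseteq> Z"
  shows "is_lsubmodule (ground_field K) A V (\<phi> ` X)" "\<phi> \<zero>\<^bsub>C\<^esub> = \<zero>\<^bsub>V\<^esub>"
proof -
  interpret C: ground_module K A C by fact
  interpret V: ground_module K A V by fact
  note pD = module_map_onD(1)[OF \<phi> subsetD[OF XZ]] module_map_onD(2)[OF \<phi> subsetD[OF XZ] subsetD[OF XZ]]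
    module_map_onD(3,4)[OF \<phi> _ subsetD[OF XZ]] and XD = C.lsubD[OF X]
  have "\<phi> \<zero>\<^bsub>C\<^esub> = \<phi> (0 \<odot>\<^bsub>C\<^esub> \<zero>\<^bsub>C\<^esub>)" by (simp only: C.K_rules(1) C.vector_rules(8))
  also have "\<dots> = \<zero>\<^bsub>V\<^esub>" by (simp only: pD(1,3) C.K_closed XD(2) V.K_rules(1))
  finally show z: "\<phi> \<zero>\<^bsub>C\<^esub> = \<zero>\<^bsub>V\<^esub>" .
  show "is_lsubmodule (ground_field K) A V (\<phi> ` X)"
  proof (rule V.lsubI)
    show "\<zero>\<^bsub>V\<^esub> \<in> \<phi> ` X" using imageI[OF XD(2), of \<phi>] unfolding z .
    fix p assume "p \<in> \<phi> ` X"
    then obtain x where x: "x \<in> X" "p = \<phi> x" by blast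
    show "p \<in> carrier V" unfolding x by (rule pD(1)[OF x(1)])
    show "r \<odot>\<^bsub>V\<^esub> p \<in> \<phi> ` X" if "r \<in> K" for r
      unfolding x pD(3)[OF that x(1), symmetric] by (rule imageI[OF XD(4)[OF that x(1)]])
    show "act V a p \<in> \<phi> ` X" if "a \<in> carrier A" for a
      unfolding x pD(4)[OF that x(1), symmetric] by (rule imageI[OF XD(5)[OF that x(1)]])
    fix q assume "q \<in> \<phi> ` X"
    then obtain y where y: "y \<in> X" "q = \<phi> y" by blast
    show "p \<oplus>\<^bsub>V\<^esub> q \<in> \<phi> ` X"
      unfolding x y pD(2)[OF x(1) y(1), symmetric] by (rule imageI[OF XD(3)[OF x(1) y(1)]])
  qed
qed

lemma preimage_lsub:
  assumes C: "ground_module K A C" and V: "ground_module K A V"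
    and \<phi>: "module_map_on K A C Z V \<phi>" and X: "is_lsubmodule (ground_field K) A C X" and XZ: "X \<subseteq> Z"
    and Y: "is_lsubmodule (ground_field K) A V Y"
  shows "is_lsubmodule (ground_field K) A C {x \<in> X. \<phi> x \<in> Y}"
proof -
  interpret C: ground_module K A C by fact
  interpret V: ground_module K A V by fact
  note XD = C.lsubD[OF X] and YD = V.lsubD[OF Y]
  note map = module_map_onD(2)[OF \<phi> subsetD[OF XZ] subsetD[OF XZ]] module_map_onD(3,4)[OF \<phi> _ subsetD[OF XZ]]
  show ?thesis
  proof (rule C.lsubI)
    show "\<zero>\<^bsub>C\<^esub> \<in> {x \<in> X. \<phi> x \<in> Y}"
      by (simp only: mem_Collect_eq image_lsub(2)[OF C V \<phi> X XZ] XD(2) YD(2))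
    fix x assume "x \<in> {x \<in> X. \<phi> x \<in> Y}"
    then have x: "x \<in> X" "\<phi> x \<in> Y" by blast+
    show "x \<in> carrier C" by (rule XD(1)[OF x(1)])
    show "r \<odot>\<^bsub>C\<^esub> x \<in> {x \<in> X. \<phi> x \<in> Y}" if "r \<in> K" for r
      by (simp only: mem_Collect_eq map(2) XD(4) YD(4) x that)
    show "act C a x \<in> {x \<in> X. \<phi> x \<in> Y}" if "a \<in> carrier A" for a
      by (simp only: mem_Collect_eq map(3) XD(5) YD(5) x that)
    fix y assume "y \<in> {x \<in> X. \<phi> x \<in> Y}"
    then have y: "y \<in> X" "\<phi> y \<in> Y" by blast+
    show "x \<oplus>\<^bsub>C\<^esub> y \<in> {x \<in> X. \<phi> x \<in> Y}"
      by (simp only: mem_Collect_eq map(1) XD(3) YD(3) x y)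
  qed
qed

context ground_module
begin

text \<open>
  The submodules of \<open>W / U\<close> correspond to those between \<open>U\<close> and \<open>W\<close>.
\<close>

lemma simple_subquotient_iff:
  assumes W: "lsub W" and U: "lsub U" and UW: "U \<subseteq> W"
  shows "simple_module (ground_field K) A (subquotient V W U) \<longleftrightarrow>
    U \<noteq> W \<and> (\<forall>X. lsub X \<longrightarrow> U \<subseteq> X \<longrightarrow> X \<subseteq> W \<longrightarrow> X = U \<or> X = W)"
proof -
  let ?S = "subquotient V W U"
  note Us = lsub_submodule[OF U]
  have lS: "left_module (ground_field K) A ?S" by (rule subquotient_left_module[OF W U])
  interpret S: ground_module K A ?S
    by (rule ground_module.intro[OF _ ground_module_axioms.intro[OF lS]])
      (use lS in \<open>unfold left_module_def ground_vectorspace_def, blast\<close>)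
  have WV: "w \<in> carrier V" if "w \<in> W" for w by (rule lsubD(1)[OF W that])
  have down: "S.lsub ((\<lambda>w. U +> w) ` X)" if X: "lsub X" and XW: "X \<subseteq> W" for X
    by (rule image_lsub(1)[OF ground_module_axioms S.ground_module_axioms quotient_map[OF W U] X XW])
  have up: "lsub {w \<in> W. U +> w \<in> Y}" if Y: "S.lsub Y" for Y
    by (rule preimage_lsub[OF ground_module_axioms S.ground_module_axioms quotient_map[OF W U] W subset_refl Y])
  have inW: "U +> x \<in> (\<lambda>w. U +> w) ` X \<longleftrightarrow> x \<in> X" if X: "lsub X" "U \<subseteq> X" and x: "x \<in> carrier V" for X x
  proof
    assume "U +> x \<in> (\<lambda>w. U +> w) ` X"
    then obtain y where y: "y \<in> X" "U +> x = U +> y" by blast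
    have yV: "y \<in> carrier V" by (rule lsubD(1)[OF X(1) y(1)])
    have "x \<ominus> y \<in> X" using y(2) X(2) unfolding coset_eq_iff[OF Us x yV] by blast
    then have "(x \<ominus> y) \<oplus> y \<in> X" by (rule lsubD(3)[OF X(1) _ y(1)])
    then show "x \<in> X" unfolding vector_rules(9)[OF x yV] .
  qed (rule imageI)
  have nonzero: "carrier ?S \<noteq> {\<zero>\<^bsub>?S\<^esub>} \<longleftrightarrow> U \<noteq> W"
  proof
    show "U \<noteq> W" if "carrier ?S \<noteq> {\<zero>\<^bsub>?S\<^esub>}"
    proof
      assume "U = W"
      then have "(\<lambda>w. U +> w) ` W = {U}"
        using coset_eq_U_iff[OF U WV] lsubD(2)[OF W] by auto
      then show False using that by (simp only: subquotient_simps)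
    qed
    show "carrier ?S \<noteq> {\<zero>\<^bsub>?S\<^esub>}" if "U \<noteq> W"
    proof
      assume "carrier ?S = {\<zero>\<^bsub>?S\<^esub>}"
      then have "U +> w = U" if "w \<in> W" for w using that by (simp only: subquotient_simps) blast
      then have "W \<subseteq> U" using coset_eq_U_iff[OF U WV] by blast
      then show False using that UW by blast
    qed
  qed
  show ?thesis
  proof
    assume "simple_module (ground_field K) A ?S"
    then have ne: "U \<noteq> W" and simple: "\<And>Y. S.lsub Y \<Longrightarrow> Y = {U} \<or> Y = (\<lambda>w. U +> w) ` W"
      unfolding simple_module_def nonzero by (auto simp only: subquotient_simps)
    have "X = U \<or> X = W" if X: "lsub X" "U \<subseteq> X" "X \<subseteq> W" for X
      using simple[OF down[OF X(1,3)]]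
    proof
      assume eq: "(\<lambda>w. U +> w) ` X = {U}"
      have "X \<subseteq> U"
      proof
        fix x assume x: "x \<in> X"
        then have "U +> x = U" using eq by blast
        then show "x \<in> U" using coset_eq_U_iff[OF U lsubD(1)[OF X(1) x]] by blast
      qed
      then show ?thesis using X(2) by blast
    next
      assume eq: "(\<lambda>w. U +> w) ` X = (\<lambda>w. U +> w) ` W"
      have "W \<subseteq> X"
      proof
        fix w assume w: "w \<in> W"
        then have "U +> w \<in> (\<lambda>w. U +> w) ` X" unfolding eq by (rule imageI)
        then show "w \<in> X" unfolding inW[OF X(1,2) WV[OF w]] .
      qed
      then show ?thesis using X(3) by blast
    qed
    then show "U \<noteq> W \<and> (\<forall>X. lsub X \<longrightarrow> U \<subseteq> X \<longrightarrow> X \<subseteq> W \<longrightarrow> X = U \<or> X = W)" using ne by blast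
  next
    assume R: "U \<noteq> W \<and> (\<forall>X. lsub X \<longrightarrow> U \<subseteq> X \<longrightarrow> X \<subseteq> W \<longrightarrow> X = U \<or> X = W)"
    have "Y = {\<zero>\<^bsub>?S\<^esub>} \<or> Y = carrier ?S" if Y: "S.lsub Y" for Y
    proof -
      let ?X = "{w \<in> W. U +> w \<in> Y}"
      have Yeq: "Y = (\<lambda>w. U +> w) ` ?X"
      proof
        show "Y \<subseteq> (\<lambda>w. U +> w) ` ?X"
        proof
          fix q assume q: "q \<in> Y"
          then have "q \<in> carrier ?S" by (rule S.lsubD(1)[OF Y])
          then obtain w where "w \<in> W" "q = U +> w" by (auto simp only: subquotient_simps)
          then show "q \<in> (\<lambda>w. U +> w) ` ?X" using q by blast
        qed
      qed blast
      have "U \<subseteq> ?X"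
      proof
        fix u assume u: "u \<in> U"
        then have "U +> u = U" using coset_eq_U_iff[OF U lsubD(1)[OF U u]] by blast
        then show "u \<in> ?X" using UW u S.lsubD(2)[OF Y] by (simp only: subquotient_simps mem_Collect_eq) blast
      qed
      then have "?X = U \<or> ?X = W" using R up[OF Y] by blast
      then show ?thesis
      proof
        assume "?X = U"
        then have "Y = (\<lambda>w. U +> w) ` U" using Yeq by simp
        also have "\<dots> = {U}" using coset_eq_U_iff[OF U lsubD(1)[OF U]] lsubD(2)[OF U] by auto
        finally show ?thesis unfolding subquotient_simps by (rule disjI1)
      next
        assume "?X = W"
        then have "Y = (\<lambda>w. U +> w) ` W" using Yeq by simp
        then show ?thesis unfolding subquotient_simps by (rule disjI2)
      qed
    qed
    then show "simple_module (ground_field K) A ?S"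
      unfolding simple_module_def nonzero using R lS by blast
  qed
qed

end

text \<open>
  Two surjections from one submodule that identify the same elements have isomorphic images. Isomorphisms
  between special subquotients are constructed in this way, since in general neither \<open>W / U\<close> nor
  \<open>W' / U'\<close> admits a natural map to the other.
\<close>

lemma iso_of_common_cover:
  assumes Z: "is_lsubmodule (ground_field K) A C Z" and C: "ground_module K A C"
    and p: "module_map_on K A C Z S p" and q: "module_map_on K A C Z T q"
    and p_surj: "p ` Z = carrier S" and q_surj: "q ` Z = carrier T"
    and ker: "\<And>x y. x \<in> Z \<Longrightarrow> y \<in> Z \<Longrightarrow> p x = p y \<longleftrightarrow> q x = q y"
  shows "lmodule_iso (ground_field K) A S T"
proof -
  interpret C: ground_module K A C by fact
  note pD = module_map_onD[OF p] and qD = module_map_onD[OF q] and ZD = C.lsubD[OF Z]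
  define f where "f = (\<lambda>s. q (SOME z. z \<in> Z \<and> p z = s))"
  have f: "f (p z) = q z" if z: "z \<in> Z" for z
  proof -
    have "(SOME z'. z' \<in> Z \<and> p z' = p z) \<in> Z \<and> p (SOME z'. z' \<in> Z \<and> p z' = p z) = p z"
      by (rule someI[of _ z]) (use z in blast)
    then show ?thesis unfolding f_def using ker[OF _ z] by blast
  qed
  have "f \<in> module_hom (ground_field K) S T"
    unfolding module_hom_def
  proof (intro CollectI conjI allI impI)
    show "f \<in> carrier S \<rightarrow> carrier T"
    proof
      fix s assume "s \<in> carrier S"
      then obtain x where "x \<in> Z" "s = p x" unfolding p_surj[symmetric] by blast
      then show "f s \<in> carrier T" using f qD(1) by simp
    qed
    fix s t assume "s \<in> carrier S \<and> t \<in> carrier S"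
    then obtain x y where xy: "x \<in> Z" "y \<in> Z" "s = p x" "t = p y" unfolding p_surj[symmetric] by blast
    show "f (s \<oplus>\<^bsub>S\<^esub> t) = f s \<oplus>\<^bsub>T\<^esub> f t"
      by (simp only: xy pD(2)[symmetric] f ZD(3) qD(2))
  next
    fix r s assume "r \<in> carrier (ground_field K) \<and> s \<in> carrier S"
    then obtain x where x: "r \<in> K" "x \<in> Z" "s = p x" unfolding p_surj[symmetric] by auto
    show "f (r \<odot>\<^bsub>S\<^esub> s) = r \<odot>\<^bsub>T\<^esub> f s"
      by (simp only: x pD(3)[symmetric] f ZD(4) qD(3))
  qed
  moreover have "bij_betw f (carrier S) (carrier T)"
    unfolding bij_betw_def
  proof
    show "inj_on f (carrier S)"
    proof (rule inj_onI)
      fix s t assume "s \<in> carrier S" "t \<in> carrier S" and eq: "f s = f t"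
      then obtain x y where xy: "x \<in> Z" "y \<in> Z" "s = p x" "t = p y" unfolding p_surj[symmetric] by blast
      then have "q x = q y" using eq f by simp
      then show "s = t" using ker[OF xy(1,2)] xy by simp
    qed
    show "f ` carrier S = carrier T"
      unfolding p_surj[symmetric] q_surj[symmetric] image_image by (rule image_cong[OF refl f])
  qed
  moreover have "f (act S a s) = act T a (f s)" if "a \<in> carrier A" "s \<in> carrier S" for a s
  proof -
    from that obtain x where x: "a \<in> carrier A" "x \<in> Z" "s = p x" unfolding p_surj[symmetric] by blast
    show ?thesis by (simp only: x pD(4)[symmetric] f ZD(5) qD(4))
  qed
  ultimately show ?thesis unfolding lmodule_iso_def by blast
qed

section \<open>Simple subquotients detected by a dominant functional\<close>

context ground_module
begin

text \<open>
  The pairs of submodules whose subquotient is simple, expressed inside the ambient module.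
\<close>

definition simple_pair :: "'v set \<Rightarrow> 'v set \<Rightarrow> bool" where
  "simple_pair W U \<longleftrightarrow> lsub W \<and> lsub U \<and> U \<subseteq> W \<and> U \<noteq> W \<and>
    (\<forall>X. lsub X \<longrightarrow> U \<subseteq> X \<longrightarrow> X \<subseteq> W \<longrightarrow> X = U \<or> X = W)"

lemma simple_subquotient_pair:
  "is_simple_subquotient (ground_field K) A V S \<longleftrightarrow> (\<exists>W U. simple_pair W U \<and> S = subquotient V W U)"
proof
  assume "is_simple_subquotient (ground_field K) A V S"
  then obtain W U where WU: "lsub W" "lsub U" "U \<subseteq> W" and S: "S = subquotient V W U"
    and simple: "simple_module (ground_field K) A S"
    unfolding is_simple_subquotient_def by blast
  have "simple_pair W U"
    using simple WU unfolding S simple_subquotient_iff[OF WU] simple_pair_def by (intro conjI) blast+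
  then show "\<exists>W U. simple_pair W U \<and> S = subquotient V W U" using S by blast
next
  assume "\<exists>W U. simple_pair W U \<and> S = subquotient V W U"
  then obtain W U where p: "simple_pair W U" and S: "S = subquotient V W U" by blast
  have WU: "lsub W" "lsub U" "U \<subseteq> W" using p unfolding simple_pair_def by blast+
  have "simple_module (ground_field K) A S"
    using p unfolding S simple_subquotient_iff[OF WU] simple_pair_def by blast
  then show "is_simple_subquotient (ground_field K) A V S"
    unfolding is_simple_subquotient_def using WU S by blast
qed

text \<open>
  Here \<open>U + X\<close> lies strictly above \<open>U\<close> and hence equals \<open>W\<close>, so \<open>X\<close> meets every coset of \<open>U\<close> in \<open>W\<close>.
\<close>

lemma simple_pair_cover:
  assumes WU: "simple_pair W U" and X: "lsub X" "X \<subseteq> W" "\<not> X \<subseteq> U" and w: "w \<in> W"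
  shows "\<exists>x\<in>X. w \<ominus> x \<in> U"
proof -
  let ?Y = "{u \<oplus> x | u x. u \<in> U \<and> x \<in> X}"
  have W: "lsub W" and U: "lsub U" and UW: "U \<subseteq> W"
    and simple: "\<And>Y. lsub Y \<Longrightarrow> U \<subseteq> Y \<Longrightarrow> Y \<subseteq> W \<Longrightarrow> Y = U \<or> Y = W"
    using WU unfolding simple_pair_def by blast+
  have UY: "U \<subseteq> ?Y"
  proof
    fix u assume u: "u \<in> U"
    have "u = u \<oplus> \<zero>" by (simp only: vector_rules(3) lsubD(1)[OF U u])
    then show "u \<in> ?Y" using u lsubD(2)[OF X(1)] by blast
  qed
  have XY: "X \<subseteq> ?Y"
  proof
    fix x assume x: "x \<in> X"
    have xV: "x \<in> carrier V" by (rule lsubD(1)[OF X(1) x])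
    have "x = \<zero> \<oplus> x" by (simp only: vector_rules(1)[OF vector_rules(8) xV] vector_rules(3)[OF xV])
    then show "x \<in> ?Y" using x lsubD(2)[OF U] by blast
  qed
  have YW: "?Y \<subseteq> W"
  proof
    fix y assume "y \<in> ?Y"
    then obtain u x where ux: "u \<in> U" "x \<in> X" "y = u \<oplus> x" by blast
    show "y \<in> W" unfolding ux(3) by (rule lsubD(3)[OF W subsetD[OF UW ux(1)] subsetD[OF X(2) ux(2)]])
  qed
  have "?Y = U \<or> ?Y = W" by (rule simple[OF lsub_sum[OF U X(1)] UY YW])
  moreover have "?Y \<noteq> U"
  proof
    assume eq: "?Y = U"
    show False using XY X(3) unfolding eq by (rule notE[rotated])
  qed
  ultimately have Y: "?Y = W" by (simp only: simp_thms)
  have "w \<in> ?Y" unfolding Y by (rule w)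
  then obtain u x where ux: "u \<in> U" "x \<in> X" "w = u \<oplus> x" by blast
  have "w \<ominus> x = u"
    unfolding ux(3) by (rule vector_rules(10)[OF lsubD(1)[OF U ux(1)] lsubD(1)[OF X(1) ux(2)]])
  then show ?thesis using ux by blast
qed

text \<open>
  A left eigenvector of the operator \<open>a\<close> whose eigenvalue stays simple on all submodules: every
  eigenfunctional for \<open>\<mu>\<close> on a submodule comes from \<open>f\<close>. This is the property of the Perron functional
  from which the uniqueness of the special subquotient derives.
\<close>

definition dominant_functional :: "'a \<Rightarrow> complex \<Rightarrow> ('v \<Rightarrow> complex) \<Rightarrow> bool" where
  "dominant_functional a \<mu> f \<longleftrightarrow> linear_functional K V (carrier V) f \<and>
    (\<exists>x\<in>carrier V. f x \<noteq> 0) \<and> (\<forall>x\<in>carrier V. f (act V a x) = \<mu> * f x) \<and>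
    (\<forall>W g. lsub W \<longrightarrow> linear_functional K V W g \<longrightarrow> (\<forall>x\<in>W. g (act V a x) = \<mu> * g x) \<longrightarrow>
      (\<exists>\<kappa>. \<forall>x\<in>W. g x = \<kappa> * f x))"

lemma functional_subset:
  "linear_functional K V W g \<Longrightarrow> X \<subseteq> W \<Longrightarrow> linear_functional K V X g"
  unfolding linear_functional_def by blast

lemma functionalD:
  assumes "linear_functional K V W g"
  shows "x \<in> W \<Longrightarrow> y \<in> W \<Longrightarrow> g (x \<oplus> y) = g x + g y" "r \<in> K \<Longrightarrow> x \<in> W \<Longrightarrow> g (r \<odot> x) = r * g x"
  using assms unfolding linear_functional_def by blast+

lemma subquotient_fin_dim:
  assumes fd: "fin_dim" and W: "lsub W" and U: "lsub U"
  obtains us where "is_basis (ground_field K) (subquotient V W U) us"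
proof -
  let ?S = "subquotient V W U"
  have lS: "left_module (ground_field K) A ?S" by (rule subquotient_left_module[OF W U])
  then have vS: "vectorspace (ground_field K) ?S" unfolding left_module_def by blast
  interpret S: ground_vectorspace K ?S by (rule ground_vectorspace.intro[OF vS])
  note vW = submodule_fin_dim[OF fd lsub_submodule[OF W]]
  interpret W: ground_vectorspace K "V\<lparr>carrier := W\<rparr>" by (rule ground_vectorspace.intro[OF vW(1)])
  note pD = module_map_onD[OF quotient_map[OF W U]]
  have hom: "(\<lambda>w. U +> w) \<in> module_hom (ground_field K) (V\<lparr>carrier := W\<rparr>) ?S"
    unfolding module_hom_def using pD(1-3) by simp
  interpret T: linear_map "ground_field K" "V\<lparr>carrier := W\<rparr>" ?S "\<lambda>w. U +> w"
    by (intro linear_map.intro mod_hom.intro mod_hom_axioms.intro vS vW(1) hom W.module_axioms S.module_axioms)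
  have "S.fin_dim"
    by (rule T.rank_nullity_main(2)[OF vW(2)]) (simp add: subquotient_def)
  then show ?thesis by (rule S.fin_dim_basis) (rule that)
qed

text \<open>
  An eigenfunctional on \<open>W / U\<close> pulls back to one on \<open>W\<close>, which is a nonzero multiple of \<open>f\<close> and
  vanishes on \<open>U\<close>. Conversely, \<open>f\<close> descends to \<open>W / U\<close> as soon as it vanishes on \<open>U\<close>.
\<close>

lemma subquotient_eigenvalue_iff:
  assumes fd: "fin_dim" and a: "a \<in> carrier A" and f: "dominant_functional a \<mu> f"
    and W: "lsub W" and U: "lsub U" and UW: "U \<subseteq> W"
  shows "operator_eigenvalue K (subquotient V W U) (act (subquotient V W U) a) \<mu> \<longleftrightarrow>
    (\<exists>w\<in>W. f w \<noteq> 0) \<and> (\<forall>u\<in>U. f u = 0)"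
proof -
  let ?S = "subquotient V W U"
  have lS: "left_module (ground_field K) A ?S" by (rule subquotient_left_module[OF W U])
  then have vS: "vectorspace (ground_field K) ?S" unfolding left_module_def by blast
  interpret S: ground_module K A ?S
    by (rule ground_module.intro[OF ground_vectorspace.intro[OF vS] ground_module_axioms.intro[OF lS]])
  note pD = module_map_onD[OF quotient_map[OF W U]]
  have WV: "w \<in> carrier V" if "w \<in> W" for w by (rule lsubD(1)[OF W that])
  have flin: "linear_functional K V (carrier V) f" and fa: "\<And>x. x \<in> carrier V \<Longrightarrow> f (act V a x) = \<mu> * f x"
    and dom: "\<And>W g. lsub W \<Longrightarrow> linear_functional K V W g \<Longrightarrow> (\<And>x. x \<in> W \<Longrightarrow> g (act V a x) = \<mu> * g x) \<Longrightarrow>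
      \<exists>\<kappa>. \<forall>x\<in>W. g x = \<kappa> * f x"
    using f unfolding dominant_functional_def by blast+
  obtain us0 where us0: "is_basis (ground_field K) ?S us0" by (rule subquotient_fin_dim[OF fd W U])
  have ev: "eigenvalue (matrix_of (ground_field K) ?S us (act ?S a)) \<mu> \<longleftrightarrow>
      (\<exists>g. linear_functional K ?S (carrier ?S) g \<and> (\<exists>x\<in>carrier ?S. g x \<noteq> 0) \<and>
        (\<forall>x\<in>carrier ?S. g (act ?S a x) = \<mu> * g x))"
    if "is_basis (ground_field K) ?S us" for us
    by (rule S.eigenvalue_matrix_of_iff[OF that S.act_rules(1)[OF a] S.act_rules(2)[OF a] S.act_rules(5)[OF _ a]])
  have op: "operator_eigenvalue K ?S (act ?S a) \<mu> \<longleftrightarrow>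
      (\<exists>g. linear_functional K ?S (carrier ?S) g \<and> (\<exists>x\<in>carrier ?S. g x \<noteq> 0) \<and>
        (\<forall>x\<in>carrier ?S. g (act ?S a x) = \<mu> * g x))"
    unfolding operator_eigenvalue_def using ev us0 by blast
  show ?thesis
    unfolding op
  proof
    assume "\<exists>g. linear_functional K ?S (carrier ?S) g \<and> (\<exists>x\<in>carrier ?S. g x \<noteq> 0) \<and>
        (\<forall>x\<in>carrier ?S. g (act ?S a x) = \<mu> * g x)"
    then obtain g q where g: "linear_functional K ?S (carrier ?S) g" and q: "q \<in> carrier ?S" "g q \<noteq> 0"
      and ga: "\<And>x. x \<in> carrier ?S \<Longrightarrow> g (act ?S a x) = \<mu> * g x" by blast
    define h where "h = (\<lambda>w. g (U +> w))"
    have "linear_functional K V W h"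
      unfolding linear_functional_def h_def by (intro conjI ballI) (simp_all only: pD S.functionalD[OF g])
    moreover have "h (act V a x) = \<mu> * h x" if "x \<in> W" for x
      unfolding h_def by (simp only: pD(4)[OF a that] ga pD(1)[OF that])
    ultimately obtain \<kappa> where \<kappa>: "\<And>x. x \<in> W \<Longrightarrow> h x = \<kappa> * f x" using dom[OF W] by blast
    obtain w where w: "w \<in> W" "q = U +> w" using q(1) unfolding subquotient_simps by blast
    have "h w \<noteq> 0" using q(2) w(2) unfolding h_def by simp
    then have nz: "\<kappa> \<noteq> 0" "f w \<noteq> 0" using \<kappa>[OF w(1)] by auto
    have "f u = 0" if u: "u \<in> U" for u
    proof -
      have "U +> u = \<zero>\<^bsub>?S\<^esub>"
        unfolding subquotient_simps using coset_eq_U_iff[OF U lsubD(1)[OF U u]] u by blast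
      then have "h u = 0" unfolding h_def using S.functional_zero[OF g S.carrier_submodule] by simp
      then show ?thesis using \<kappa>[of u] u UW nz(1) by auto
    qed
    then show "(\<exists>w\<in>W. f w \<noteq> 0) \<and> (\<forall>u\<in>U. f u = 0)" using w(1) nz(2) by blast
  next
    assume R: "(\<exists>w\<in>W. f w \<noteq> 0) \<and> (\<forall>u\<in>U. f u = 0)"
    define g where "g = (\<lambda>q. f (SOME w. w \<in> W \<and> U +> w = q))"
    have g: "g (U +> w) = f w" if w: "w \<in> W" for w
    proof -
      define w' where "w' = (SOME w'. w' \<in> W \<and> U +> w' = U +> w)"
      have w': "w' \<in> W \<and> U +> w' = U +> w"
        unfolding w'_def by (rule someI[of _ w]) (use w in blast)
      have "w' \<ominus> w \<in> U"
        using w' unfolding coset_eq_iff[OF lsub_submodule[OF U] WV[OF conjunct1[OF w']] WV[OF w], symmetric] by blast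
      then have "f (w' \<ominus> w) = 0" using R by blast
      then have "f w' = f w"
        using functional_minus[OF flin carrier_submodule WV[OF conjunct1[OF w']] WV[OF w]] by simp
      then show ?thesis unfolding g_def w'_def .
    qed
    have "linear_functional K ?S (carrier ?S) g"
      unfolding linear_functional_def subquotient_simps(1)
    proof (intro conjI ballI)
      fix x y assume "x \<in> (\<lambda>w. U +> w) ` W" "y \<in> (\<lambda>w. U +> w) ` W"
      then obtain v w where vw: "v \<in> W" "w \<in> W" "x = U +> v" "y = U +> w" by blast
      show "g (x \<oplus>\<^bsub>?S\<^esub> y) = g x + g y"
        by (simp only: vw pD(2)[symmetric] g lsubD(3)[OF W] functionalD[OF flin] WV)
    next
      fix r x assume "r \<in> K" "x \<in> (\<lambda>w. U +> w) ` W"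
      then obtain v where vw: "v \<in> W" "r \<in> K" "x = U +> v" by blast
      show "g (r \<odot>\<^bsub>?S\<^esub> x) = r * g x"
        by (simp only: vw pD(3)[symmetric] g lsubD(4)[OF W] functionalD[OF flin] WV)
    qed
    moreover have "g (act ?S a x) = \<mu> * g x" if x: "x \<in> carrier ?S" for x
    proof -
      obtain v where v: "v \<in> W" "x = U +> v" using x unfolding subquotient_simps by blast
      show ?thesis by (simp only: v pD(4)[symmetric] g lsubD(5)[OF W] fa WV a)
    qed
    moreover have "\<exists>x\<in>carrier ?S. g x \<noteq> 0" using R g pD(1) by metis
    ultimately show "\<exists>g. linear_functional K ?S (carrier ?S) g \<and> (\<exists>x\<in>carrier ?S. g x \<noteq> 0) \<and>
        (\<forall>x\<in>carrier ?S. g (act ?S a x) = \<mu> * g x)" by blast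
  qed
qed

text \<open>
  Take \<open>W\<close> minimal among the submodules on which \<open>f\<close> does not vanish, and let \<open>U\<close> be the largest
  submodule of \<open>W\<close> on which \<open>f\<close> vanishes. A submodule between them either has \<open>f \<noteq> 0\<close> on it and is
  \<open>W\<close> by minimality, or is contained in \<open>U\<close>.
\<close>

lemma exists_simple_pair:
  assumes fd: "fin_dim" and f: "linear_functional K V (carrier V) f" and x: "x \<in> carrier V" "f x \<noteq> 0"
  shows "\<exists>W U. simple_pair W U \<and> (\<exists>w\<in>W. f w \<noteq> 0) \<and> (\<forall>u\<in>U. f u = 0)"
proof -
  obtain rank :: "'v set \<Rightarrow> nat" where rank: "\<And>W W'. submodule (ground_field K) W V \<Longrightarrow>
      submodule (ground_field K) W' V \<Longrightarrow> W \<subset> W' \<Longrightarrow> rank W < rank W'"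
    using submodule_rank[OF fd] by blast
  define P where "P = (\<lambda>W. lsub W \<and> (\<exists>w\<in>W. f w \<noteq> 0))"
  have "P (carrier V)" unfolding P_def using lsub_carrier x by blast
  then obtain W where PW: "P W" and min: "\<And>W'. P W' \<Longrightarrow> rank W \<le> rank W'"
    using ex_has_least_nat[of P "carrier V" rank] by blast
  have W: "lsub W" and Wf: "\<exists>w\<in>W. f w \<noteq> 0" using PW unfolding P_def by blast+
  have WV: "w \<in> carrier V" if "w \<in> W" for w by (rule lsubD(1)[OF W that])
  \<comment> \<open>The largest submodule of \<open>W\<close> inside the kernel of \<open>f\<close>.\<close>
  define U where "U = {u \<in> W. \<forall>a\<in>carrier A. f (act V a u) = 0}"
  have UD: "u \<in> W" "\<And>a. a \<in> carrier A \<Longrightarrow> f (act V a u) = 0" if "u \<in> U" for u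
    using that unfolding U_def by blast+
  have UI: "u \<in> U" if "u \<in> W" "\<And>a. a \<in> carrier A \<Longrightarrow> f (act V a u) = 0" for u
    using that unfolding U_def by blast
  have U: "lsub U"
  proof (rule lsubI)
    show "u \<in> carrier V" if "u \<in> U" for u by (rule WV[OF UD(1)[OF that]])
    show "\<zero> \<in> U"
    proof (rule UI[OF lsubD(2)[OF W]])
      fix a assume a: "a \<in> carrier A"
      have "act V a \<zero> = act V a (0 \<odot> \<zero>)" by (simp only: K_rules(1) vector_rules(8))
      also have "\<dots> = 0 \<odot> act V a \<zero>" by (rule act_rules(5)[OF K_closed(1) a vector_rules(8)])
      also have "\<dots> = \<zero>" by (rule K_rules(1)[OF act_rules(1)[OF a vector_rules(8)]])
      finally show "f (act V a \<zero>) = 0" using functional_zero[OF f carrier_submodule] by simp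
    qed
    show "x \<oplus> y \<in> U" if "x \<in> U" "y \<in> U" for x y
      by (rule UI[OF lsubD(3)[OF W UD(1)[OF that(1)] UD(1)[OF that(2)]]])
        (simp only: act_rules(1,2) WV[OF UD(1)[OF that(1)]] WV[OF UD(1)[OF that(2)]] functionalD[OF f]
          UD(2)[OF that(1)] UD(2)[OF that(2)] add_0)
    show "r \<odot> x \<in> U" if "r \<in> K" "x \<in> U" for r x
      by (rule UI[OF lsubD(4)[OF W that(1) UD(1)[OF that(2)]]])
        (simp only: act_rules(1,5) that(1) WV[OF UD(1)[OF that(2)]] functionalD[OF f] UD(2)[OF that(2)] mult_zero_right)
    show "act V a x \<in> U" if "a \<in> carrier A" "x \<in> U" for a x
      by (rule UI[OF lsubD(5)[OF W that(1) UD(1)[OF that(2)]]])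
        (simp only: act_rules(6)[symmetric] that(1) WV[OF UD(1)[OF that(2)]] algebra_ring_rules(2)[OF algebra] UD(2)[OF that(2)])
  qed
  have Uf: "f u = 0" if u: "u \<in> U" for u
    using UD(2)[OF u algebra_ring_rules(1)[OF algebra]] by (simp only: act_rules(7) WV[OF UD(1)[OF u]])
  have "X = U \<or> X = W" if X: "lsub X" "U \<subseteq> X" "X \<subseteq> W" for X
  proof (cases "\<exists>w\<in>X. f w \<noteq> 0")
    case True
    then have "rank W \<le> rank X" using min[of X] X(1) unfolding P_def by blast
    then have "\<not> X \<subset> W" using rank[OF lsub_submodule[OF X(1)] lsub_submodule[OF W]] by (meson not_less)
    then show ?thesis using X(3) by blast
  next
    case False
    have "X \<subseteq> U"
    proof
      fix y assume y: "y \<in> X"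
      show "y \<in> U" by (rule UI[OF subsetD[OF X(3) y]]) (use False lsubD(5)[OF X(1) _ y] in blast)
    qed
    then show ?thesis using X(2) by blast
  qed
  moreover have "U \<noteq> W" using Wf Uf by blast
  moreover have "U \<subseteq> W" using UD(1) by blast
  ultimately have "simple_pair W U" unfolding simple_pair_def using W U by blast
  then show ?thesis using Wf Uf by blast
qed

text \<open>
  If \<open>f\<close> vanished on \<open>X \<inter> Y\<close>, gluing \<open>f\<close> on \<open>X\<close> with zero on \<open>Y\<close> would produce an eigenfunctional on
  \<open>X + Y\<close> that is not a multiple of \<open>f\<close>.
\<close>

lemma dominant_intersection:
  assumes f: "dominant_functional a \<mu> f" and a: "a \<in> carrier A"
    and X: "lsub X" and Y: "lsub Y"
    and fX: "\<exists>x\<in>X. f x \<noteq> 0" and fY: "\<exists>y\<in>Y. f y \<noteq> 0"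
  shows "\<exists>z\<in>X \<inter> Y. f z \<noteq> 0"
proof (rule ccontr)
  assume "\<not> (\<exists>z\<in>X \<inter> Y. f z \<noteq> 0)"
  then have zero: "f z = 0" if "z \<in> X" "z \<in> Y" for z using that by blast
  have flin: "linear_functional K V (carrier V) f" and fa: "\<And>x. x \<in> carrier V \<Longrightarrow> f (act V a x) = \<mu> * f x"
    and dom: "\<And>W g. lsub W \<Longrightarrow> linear_functional K V W g \<Longrightarrow> (\<And>x. x \<in> W \<Longrightarrow> g (act V a x) = \<mu> * g x) \<Longrightarrow>
      \<exists>\<kappa>. \<forall>x\<in>W. g x = \<kappa> * f x"
    using f unfolding dominant_functional_def by blast+
  note XV = lsubD(1)[OF X] and YV = lsubD(1)[OF Y]
  let ?Z = "{x \<oplus> y | x y. x \<in> X \<and> y \<in> Y}"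
  have "X \<subseteq> carrier V" using XV by (rule subsetI)
  then have "linear_functional K V X f" by (rule functional_subset[OF flin])
  from functional_glue[OF lsub_submodule[OF X] lsub_submodule[OF Y] this zero]
  obtain g where glin: "linear_functional K V ?Z g" and g: "\<And>x y. x \<in> X \<Longrightarrow> y \<in> Y \<Longrightarrow> g (x \<oplus> y) = f x"
    by blast
  have geig: "g (act V a z) = \<mu> * g z" if "z \<in> ?Z" for z
  proof -
    from that obtain x y where z: "x \<in> X" "y \<in> Y" "z = x \<oplus> y" by blast
    show ?thesis
      unfolding z act_rules(2)[OF a XV[OF z(1)] YV[OF z(2)]]
      by (simp only: g lsubD(5)[OF X a] lsubD(5)[OF Y a] z fa XV)
  qed
  have "\<exists>\<kappa>. \<forall>z\<in>?Z. g z = \<kappa> * f z" by (rule dom[OF lsub_sum[OF X Y] glin geig])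
  then obtain \<kappa> where "\<forall>z\<in>?Z. g z = \<kappa> * f z" by (elim exE)
  note \<kappa> = bspec[OF this]
  obtain x where x: "x \<in> X" "f x \<noteq> 0" using fX by blast
  obtain y where y: "y \<in> Y" "f y \<noteq> 0" using fY by blast
  have mem: "v \<oplus> w \<in> ?Z" if "v \<in> X" "w \<in> Y" for v w using that by blast
  have x0: "x \<oplus> \<zero> = x" by (rule vector_rules(3)[OF XV[OF x(1)]])
  have xZ: "x \<in> ?Z" "g x = f x"
    using mem[OF x(1) lsubD(2)[OF Y]] g[OF x(1) lsubD(2)[OF Y]] by (simp_all only: x0)
  have y0: "\<zero> \<oplus> y = y"
    by (simp only: vector_rules(1)[OF vector_rules(8) YV[OF y(1)]] vector_rules(3)[OF YV[OF y(1)]])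
  have yZ: "y \<in> ?Z" "g y = f \<zero>"
    using mem[OF lsubD(2)[OF X] y(1)] g[OF lsubD(2)[OF X] y(1)] by (simp_all only: y0)
  have "\<kappa> = 1" using \<kappa>[OF xZ(1)] xZ(2) x(2) by simp
  then show False using \<kappa>[OF yZ(1)] yZ(2) y(2) functional_zero[OF flin carrier_submodule] by simp
qed

end

lemma module_map_minus:
  assumes C: "ground_module K A C" and V: "ground_module K A V"
    and \<phi>: "module_map_on K A C (carrier C) V \<phi>" and x: "x \<in> carrier C" and y: "y \<in> carrier C"
  shows "\<phi> (x \<ominus>\<^bsub>C\<^esub> y) = \<phi> x \<ominus>\<^bsub>V\<^esub> \<phi> y"
proof -
  interpret C: ground_module K A C by fact
  interpret V: ground_module K A V by fact
  note pD = module_map_onD[OF \<phi>]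
  have "\<phi> x = \<phi> ((x \<ominus>\<^bsub>C\<^esub> y) \<oplus>\<^bsub>C\<^esub> y)" by (simp only: C.vector_rules(9) x y)
  also have "\<dots> = \<phi> (x \<ominus>\<^bsub>C\<^esub> y) \<oplus>\<^bsub>V\<^esub> \<phi> y" by (simp only: pD(2) C.vector_rules(7) x y)
  finally have "\<phi> x \<ominus>\<^bsub>V\<^esub> \<phi> y = (\<phi> (x \<ominus>\<^bsub>C\<^esub> y) \<oplus>\<^bsub>V\<^esub> \<phi> y) \<ominus>\<^bsub>V\<^esub> \<phi> y" by (rule arg_cong)
  then show ?thesis by (simp only: V.vector_rules(10) pD(1) C.vector_rules(7) x y)
qed

text \<open>
  The submodule \<open>Z = W' \<inter> \<phi>\<^sup>-\<^sup>1 W\<close> maps onto both simple subquotients, because neither image vanishes.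
  Let \<open>X\<close> and \<open>Y\<close> be the kernels of the maps to \<open>W' / U'\<close> and \<open>W / U\<close>. If one of them were not
  contained in the other, it would cover the other simple subquotient, and so \<open>Z = X + Y\<close>.
  But \<open>h\<close> vanishes on \<open>X\<close> and on \<open>Y\<close> and not on \<open>Z\<close>. Hence \<open>X = Y\<close>, and the subquotients are
  isomorphic.
\<close>

lemma iso_of_dominant_map:
  assumes C: "ground_module K A C" and V: "ground_module K A V"
    and \<phi>: "module_map_on K A C (carrier C) V \<phi>"
    and WU: "ground_module.simple_pair K A V W U" and WU': "ground_module.simple_pair K A C W' U'"
    and f: "linear_functional K V (carrier V) f" and h: "linear_functional K C (carrier C) h"
    and fU: "\<And>u. u \<in> U \<Longrightarrow> f u = 0" and hU': "\<And>u. u \<in> U' \<Longrightarrow> h u = 0"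
    and meet: "z \<in> W'" "\<phi> z \<in> W" "f (\<phi> z) \<noteq> 0"
    and same: "\<And>X. is_lsubmodule (ground_field K) A C X \<Longrightarrow> (\<forall>x\<in>X. h x = 0) \<longleftrightarrow> (\<forall>x\<in>X. f (\<phi> x) = 0)"
  shows "lmodule_iso (ground_field K) A (subquotient V W U) (subquotient C W' U')"
proof -
  interpret C: ground_module K A C by fact
  interpret V: ground_module K A V by fact
  note pD = module_map_onD[OF \<phi>]
  have W: "V.lsub W" and U: "V.lsub U" and UW: "U \<subseteq> W" using WU unfolding V.simple_pair_def by blast+
  have W': "C.lsub W'" and U': "C.lsub U'" and UW': "U' \<subseteq> W'" using WU' unfolding C.simple_pair_def by blast+
  note Us = V.lsub_submodule[OF U] and Us' = C.lsub_submodule[OF U']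
  define Z where "Z = {x \<in> W'. \<phi> x \<in> W}"
  have Z: "C.lsub Z" unfolding Z_def by (rule preimage_lsub[OF C V \<phi> W' C.lsub_subset[OF W'] W])
  have ZD: "x \<in> W'" "\<phi> x \<in> W" "x \<in> carrier C" "\<phi> x \<in> carrier V" if "x \<in> Z" for x
    using that pD(1) C.lsubD(1)[OF W'] unfolding Z_def by blast+
  have zZ: "z \<in> Z" unfolding Z_def using meet by blast
  have fh_Z: "\<exists>x\<in>Z. h x \<noteq> 0" using same[OF Z] zZ meet(3) by blast
  have minus_Z: "x \<ominus>\<^bsub>C\<^esub> y \<in> Z" if "x \<in> Z" "y \<in> Z" for x y by (rule C.lsubD(6)[OF Z that])
  define X where "X = {x \<in> Z. x \<in> U'}"
  define Y where "Y = {x \<in> Z. \<phi> x \<in> U}"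
  have Y: "C.lsub Y" unfolding Y_def by (rule preimage_lsub[OF C V \<phi> Z C.lsub_subset[OF Z] U])
  have X: "C.lsub X"
    unfolding X_def
    by (rule C.lsubI) (simp_all add: C.lsubD[OF Z] C.lsubD[OF U'] del: C.K_closed)
  have hX: "h x = 0" if "x \<in> X" for x using that hU' unfolding X_def by blast
  have hY: "h x = 0" if "x \<in> Y" for x
    using same[OF Y] fU that unfolding Y_def by blast
  have sum_zero: False if all: "\<And>x. x \<in> Z \<Longrightarrow> \<exists>u v. u \<in> X \<and> v \<in> Y \<and> x = u \<oplus>\<^bsub>C\<^esub> v"
  proof -
    obtain x where x: "x \<in> Z" "h x \<noteq> 0" using fh_Z by blast
    obtain u v where uv: "u \<in> X" "v \<in> Y" "x = u \<oplus>\<^bsub>C\<^esub> v" using all[OF x(1)] by blast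
    have "h x = h u + h v"
      unfolding uv(3) by (rule C.functionalD(1)[OF h C.lsubD(1)[OF X uv(1)] C.lsubD(1)[OF Y uv(2)]])
    then show False using x(2) hX[OF uv(1)] hY[OF uv(2)] by simp
  qed
  have XY: "X \<subseteq> Y"
  proof (rule ccontr)
    assume "\<not> X \<subseteq> Y"
    then have not: "\<not> \<phi> ` X \<subseteq> U" unfolding X_def Y_def by blast
    have sub: "\<phi> ` X \<subseteq> W" using ZD(2) unfolding X_def by blast
    show False
    proof (rule sum_zero)
      fix x assume x: "x \<in> Z"
      obtain u where u: "u \<in> X" "\<phi> x \<ominus>\<^bsub>V\<^esub> \<phi> u \<in> U"
        using V.simple_pair_cover[OF WU image_lsub(1)[OF C V \<phi> X C.lsub_subset[OF X]] sub not ZD(2)[OF x]] by blast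
      have uZ: "u \<in> Z" using u(1) unfolding X_def by blast
      have "x \<ominus>\<^bsub>C\<^esub> u \<in> Y"
        unfolding Y_def using minus_Z[OF x uZ] u(2) module_map_minus[OF C V \<phi> ZD(3)[OF x] ZD(3)[OF uZ]] by simp
      moreover have "x = u \<oplus>\<^bsub>C\<^esub> (x \<ominus>\<^bsub>C\<^esub> u)"
        using C.vector_rules(9)[OF ZD(3)[OF x] ZD(3)[OF uZ]]
          C.vector_rules(1)[OF C.vector_rules(7)[OF ZD(3)[OF x] ZD(3)[OF uZ]] ZD(3)[OF uZ]] by simp
      ultimately show "\<exists>u v. u \<in> X \<and> v \<in> Y \<and> x = u \<oplus>\<^bsub>C\<^esub> v" using u(1) by blast
    qed
  qed
  have YX: "Y \<subseteq> X"
  proof (rule ccontr)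
    assume "\<not> Y \<subseteq> X"
    then have not: "\<not> Y \<subseteq> U'" unfolding X_def Y_def by blast
    have sub: "Y \<subseteq> W'" using ZD(1) unfolding Y_def by blast
    show False
    proof (rule sum_zero)
      fix x assume x: "x \<in> Z"
      obtain v where v: "v \<in> Y" "x \<ominus>\<^bsub>C\<^esub> v \<in> U'"
        using C.simple_pair_cover[OF WU' Y sub not ZD(1)[OF x]] by blast
      have vZ: "v \<in> Z" using v(1) unfolding Y_def by blast
      have "x \<ominus>\<^bsub>C\<^esub> v \<in> X" unfolding X_def using minus_Z[OF x vZ] v(2) by blast
      moreover have "x = (x \<ominus>\<^bsub>C\<^esub> v) \<oplus>\<^bsub>C\<^esub> v"
        using C.vector_rules(9)[OF ZD(3)[OF x] ZD(3)[OF vZ]] by simp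
      ultimately show "\<exists>u v. u \<in> X \<and> v \<in> Y \<and> x = u \<oplus>\<^bsub>C\<^esub> v" using v(1) by blast
    qed
  qed
  define p where "p = (\<lambda>x. U +>\<^bsub>V\<^esub> \<phi> x)"
  define q where "q = (\<lambda>x. U' +>\<^bsub>C\<^esub> x)"
  note sV = module_map_onD[OF V.quotient_map[OF W U]] and sC = module_map_onD[OF C.quotient_map[OF W' U']]
  have p: "module_map_on K A C Z (subquotient V W U) p"
    unfolding module_map_on_def p_def by (intro conjI ballI) (simp_all only: sV pD ZD)
  have q: "module_map_on K A C Z (subquotient C W' U') q"
    unfolding module_map_on_def q_def by (intro conjI ballI) (simp_all only: sC ZD)
  have q_surj: "q ` Z = carrier (subquotient C W' U')"
  proof
    show "q ` Z \<subseteq> carrier (subquotient C W' U')" using module_map_onD(1)[OF q] by blast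
    have not: "\<not> Z \<subseteq> U'" using fh_Z hU' by blast
    show "carrier (subquotient C W' U') \<subseteq> q ` Z"
    proof
      fix s assume "s \<in> carrier (subquotient C W' U')"
      then obtain w where w: "w \<in> W'" "s = U' +>\<^bsub>C\<^esub> w" unfolding C.subquotient_simps by blast
      obtain x where x: "x \<in> Z" "w \<ominus>\<^bsub>C\<^esub> x \<in> U'"
        using C.simple_pair_cover[OF WU' Z _ not w(1)] ZD(1) by blast
      have "s = q x"
        unfolding w q_def C.coset_eq_iff[OF Us' C.lsubD(1)[OF W' w(1)] ZD(3)[OF x(1)]] by (rule x(2))
      then show "s \<in> q ` Z" using x(1) by blast
    qed
  qed
  have p_surj: "p ` Z = carrier (subquotient V W U)"
  proof
    show "p ` Z \<subseteq> carrier (subquotient V W U)" using module_map_onD(1)[OF p] by blast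
    have not: "\<not> \<phi> ` Z \<subseteq> U" using zZ meet(3) fU by blast
    show "carrier (subquotient V W U) \<subseteq> p ` Z"
    proof
      fix s assume "s \<in> carrier (subquotient V W U)"
      then obtain w where w: "w \<in> W" "s = U +>\<^bsub>V\<^esub> w" unfolding V.subquotient_simps by blast
      obtain x where x: "x \<in> Z" "w \<ominus>\<^bsub>V\<^esub> \<phi> x \<in> U"
        using V.simple_pair_cover[OF WU image_lsub(1)[OF C V \<phi> Z C.lsub_subset[OF Z]] _ not w(1)] ZD(2) by blast
      have "s = p x"
        unfolding w p_def V.coset_eq_iff[OF Us V.lsubD(1)[OF W w(1)] ZD(4)[OF x(1)]] by (rule x(2))
      then show "s \<in> p ` Z" using x(1) by blast
    qed
  qed
  show ?thesis
  proof (rule iso_of_common_cover[OF Z C p q p_surj q_surj])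
    fix x y assume x: "x \<in> Z" and y: "y \<in> Z"
    have "p x = p y \<longleftrightarrow> x \<ominus>\<^bsub>C\<^esub> y \<in> Y"
      unfolding p_def V.coset_eq_iff[OF Us ZD(4)[OF x] ZD(4)[OF y]] Y_def
        module_map_minus[OF C V \<phi> ZD(3)[OF x] ZD(3)[OF y], symmetric] using minus_Z[OF x y] by blast
    moreover have "q x = q y \<longleftrightarrow> x \<ominus>\<^bsub>C\<^esub> y \<in> X"
      unfolding q_def C.coset_eq_iff[OF Us' ZD(3)[OF x] ZD(3)[OF y]] X_def using minus_Z[OF x y] by blast
    ultimately show "p x = p y \<longleftrightarrow> q x = q y" using XY YX by blast
  qed
qed

section \<open>Perron functionals of positive operators\<close>

lemma nonneg_Reals_eq: "z \<in> \<real>\<^sub>\<ge>\<^sub>0 \<Longrightarrow> z = of_real (Re z) \<and> Re z \<ge> 0"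
  by (auto simp: nonneg_Reals_def)

lemma functional_weighted_sum:
  assumes A: "ground_vectorspace K A" and F: "linear_functional K A (carrier A) F"
    and bs: "set bs \<subseteq> carrier A" and c: "\<And>i. i < length bs \<Longrightarrow> c i \<in> K"
  shows "weighted_sum A bs c \<in> carrier A" "F (weighted_sum A bs c) = (\<Sum>i<length bs. c i * F (bs ! i))"
proof -
  interpret A: ground_vectorspace K A by fact
  have b: "bs ! i \<in> carrier A" if "i < length bs" for i using bs nth_mem[OF that] by blast
  have *: "weighted_sum A bs c \<in> carrier A \<and> F (weighted_sum A bs c) = (\<Sum>i<length bs. F (c i \<odot>\<^bsub>A\<^esub> bs ! i))"
    unfolding weighted_sum_def
    by (rule A.functional_finsum[OF F A.carrier_submodule]) (simp_all add: A.K_rules(3) b c)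
  then show "weighted_sum A bs c \<in> carrier A" by blast
  have "F (c i \<odot>\<^bsub>A\<^esub> bs ! i) = c i * F (bs ! i)" if "i < length bs" for i
    using F b[OF that] c[OF that] unfolding linear_functional_def by blast
  then show "F (weighted_sum A bs c) = (\<Sum>i<length bs. c i * F (bs ! i))" using * by simp
qed

context ground_module
begin

text \<open>
  The Perron-Frobenius package of an operator \<open>a\<close> in the basis \<open>us\<close>: eigenvalue \<open>r\<close>, left eigenvector \<open>l\<close> as
  a functional, right eigenvector \<open>v\<close> as a list of real coordinates (its components need not lie
  in \<open>K\<close>, so it need not be an element of the module), and the resulting asymptotics of the
  iterates of \<open>a\<close>, in the normalisation where \<open>l\<close> and \<open>v\<close> pair to one.
\<close>

definition perron_data :: "'v list \<Rightarrow> 'a \<Rightarrow> real \<Rightarrow> ('v \<Rightarrow> complex) \<Rightarrow> (nat \<Rightarrow> real) \<Rightarrow> bool" where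
  "perron_data us a r l v \<longleftrightarrow> r > 0 \<and>
    perron_frobenius_eigenvalue (matrix_of (ground_field K) V us (act V a)) r \<and>
    linear_functional K V (carrier V) l \<and> (\<forall>i<length us. Im (l (us ! i)) = 0 \<and> Re (l (us ! i)) > 0) \<and>
    (\<forall>x\<in>carrier V. l (act V a x) = of_real r * l x) \<and> (\<forall>i<length us. v i > 0) \<and>
    (\<forall>g x. linear_functional K V (carrier V) g \<longrightarrow> x \<in> carrier V \<longrightarrow>
      (\<lambda>k. g ((act V a ^^ k) x) / of_real r ^ k) \<longlonglongrightarrow> (\<Sum>i<length us. g (us ! i) * of_real (v i)) * l x)"

lemma functional_act:
  "linear_functional K V (carrier V) g \<Longrightarrow> a \<in> carrier A \<Longrightarrow> linear_functional K V (carrier V) (\<lambda>x. g (act V a x))"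
  unfolding linear_functional_def by (intro conjI ballI) (simp_all only: act_rules)

lemma functional_act_power:
  assumes g: "linear_functional K V (carrier V) g" and a: "a \<in> carrier A"
  shows "linear_functional K V (carrier V) (\<lambda>x. g ((act V a ^^ k) x))"
proof (induction k)
  case (Suc k)
  show ?case unfolding funpow_Suc_right o_def by (rule functional_act[OF Suc a])
qed (simp add: g)

lemma act_power_closed:
  assumes "lsub W" "a \<in> carrier A" "x \<in> W" shows "(act V a ^^ k) x \<in> W"
  by (induction k) (simp_all add: assms(3) lsubD(5)[OF assms(1,2)])

text \<open>
  The functional \<open>g - \<langle>g, v\<rangle> l\<close> is orthogonal to \<open>v\<close>, hence its iterates under \<open>a / r\<close> vanish in the limit.
  The contraction estimate also bounds the absolute values of all other eigenvalues, as the row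
  eigenvectors for \<open>\<mu> \<noteq> r\<close> are orthogonal to \<open>v\<close>.
\<close>

lemma positive_operator_perron_data:
  assumes bas: "is_basis (ground_field K) V us" and ne: "us \<noteq> []" and a: "a \<in> carrier A"
    and real: "\<And>i j. i < length us \<Longrightarrow> j < length us \<Longrightarrow>
      Im (coord (ground_field K) V us (act V a (us ! j)) i) = 0 \<and>
      Re (coord (ground_field K) V us (act V a (us ! j)) i) > 0"
  shows "\<exists>r l v. perron_data us a r l v"
proof -
  let ?n = "length us" and ?c = "coord (ground_field K) V us"
  note cs = basis_coordinate_system[OF bas]
  have usV: "us ! i \<in> carrier V" if "i < ?n" for i
    using cs nth_mem[OF that] unfolding coordinate_system_def by blast
  have clin: "linear_functional K V (carrier V) (\<lambda>x. ?c x i)" if "i < ?n" for i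
    using cs that unfolding coordinate_system_def by blast
  define M where "M = (\<lambda>i j. Re (?c (act V a (us ! j)) i))"
  have M: "?c (act V a (us ! j)) i = of_real (M i j)" if "i < ?n" "j < ?n" for i j
    using real[OF that] by (simp add: M_def complex_eq_iff)
  have Mpos: "M i j > 0" if "i \<in> {..<?n}" "j \<in> {..<?n}" for i j
    using real[of i j] that by (simp add: M_def)
  have fin: "finite {..<?n}" "{..<?n} \<noteq> {}" using ne by auto
  obtain r v l0 where r: "r > 0" and v: "\<And>i. i \<in> {..<?n} \<Longrightarrow> v i > 0" and l0: "\<And>i. i \<in> {..<?n} \<Longrightarrow> l0 i > 0"
    and Mv: "\<And>i. i \<in> {..<?n} \<Longrightarrow> (\<Sum>j<?n. M i j * v j) = r * v i"
    and lM: "\<And>j. j \<in> {..<?n} \<Longrightarrow> (\<Sum>i<?n. l0 i * M i j) = r * l0 j"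
    and lv: "(\<Sum>i<?n. l0 i * v i) = 1"
    using positive_matrix_perron[of "{..<?n}" M] fin Mpos by blast
  define l where "l = (\<lambda>x. \<Sum>i<?n. ?c x i * of_real (l0 i))"
  have llin: "linear_functional K V (carrier V) l"
    using clin unfolding l_def linear_functional_def
    by (simp add: sum.distrib sum_distrib_left algebra_simps)
  have lu: "l (us ! j) = of_real (l0 j)" if "j < ?n" for j
  proof -
    have "l (us ! j) = (\<Sum>i<?n. if i = j then of_real (l0 i) else 0)"
      unfolding l_def using cs that by (intro sum.cong refl) (simp add: coordinate_system_def)
    then show ?thesis using that by simp
  qed
  have act_coord: "g (act V a (us ! j)) = (\<Sum>i<?n. g (us ! i) * of_real (M i j))"
    if g: "linear_functional K V (carrier V) g" and j: "j < ?n" for g j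
  proof -
    have "g (act V a (us ! j)) = (\<Sum>i<?n. ?c (act V a (us ! j)) i * g (us ! i))"
      by (rule functional_expansion[OF cs act_rules(1)[OF a usV[OF j]] g])
    also have "\<dots> = (\<Sum>i<?n. g (us ! i) * of_real (M i j))"
      using M[OF _ j] by (intro sum.cong refl) simp
    finally show ?thesis .
  qed
  have la: "l (act V a x) = of_real r * l x" if x: "x \<in> carrier V" for x
  proof -
    have lau: "l (act V a (us ! j)) = of_real r * l (us ! j)" if j: "j < ?n" for j
    proof -
      have "l (act V a (us ! j)) = of_real (\<Sum>i<?n. l0 i * M i j)"
        unfolding act_coord[OF llin j] by (simp add: lu)
      then show ?thesis using lM[of j] j by (simp add: lu)
    qed
    have "l (act V a x) = (\<Sum>j<?n. ?c x j * l (act V a (us ! j)))"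
      by (rule functional_expansion[OF cs x functional_act[OF llin a]])
    also have "\<dots> = (\<Sum>j<?n. of_real r * (?c x j * l (us ! j)))"
      by (intro sum.cong refl) (simp add: lau)
    also have "\<dots> = of_real r * l x"
      using functional_expansion[OF cs x llin] by (simp add: sum_distrib_left)
    finally show ?thesis .
  qed
  have lpow: "l ((act V a ^^ k) x) = of_real r ^ k * l x" if x: "x \<in> carrier V" for k x
  proof (induction k)
    case (Suc k)
    show ?case using la[OF act_power_closed[OF lsub_carrier a x]] Suc by simp
  qed simp
  have conv: "(\<lambda>k. g ((act V a ^^ k) x) / of_real r ^ k) \<longlonglongrightarrow> (\<Sum>i<?n. g (us ! i) * of_real (v i)) * l x"
    if g: "linear_functional K V (carrier V) g" and x: "x \<in> carrier V" for g x
  proof -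
    define \<kappa> where "\<kappa> = (\<Sum>i<?n. g (us ! i) * of_real (v i))"
    define D where "D = (\<lambda>x. g x - \<kappa> * l x)"
    have D: "linear_functional K V (carrier V) D"
      using g llin unfolding D_def linear_functional_def by (simp add: algebra_simps)
    define h where "h = (\<lambda>k i. D ((act V a ^^ k) (us ! i)))"
    have h: "h (Suc k) j = (\<Sum>i<?n. h k i * of_real (M i j))" if "j \<in> {..<?n}" for k j
      unfolding h_def funpow_Suc_right o_def
      by (rule act_coord[OF functional_act_power[OF D a]]) (use that in simp)
    have h0: "(\<Sum>i<?n. h 0 i * of_real (v i)) = 0"
    proof -
      have "(\<Sum>i<?n. h 0 i * of_real (v i)) = \<kappa> - \<kappa> * (\<Sum>i<?n. l (us ! i) * of_real (v i))"
        by (simp add: h_def D_def \<kappa>_def left_diff_distrib sum_subtractf sum_distrib_left mult.assoc)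
      also have "(\<Sum>i<?n. l (us ! i) * of_real (v i)) = of_real (\<Sum>i<?n. l0 i * v i)" by (simp add: lu)
      finally show ?thesis using lv by simp
    qed
    have "(\<lambda>k. \<Sum>j<?n. ?c x j * (h k j / of_real r ^ k)) \<longlonglongrightarrow> (\<Sum>j<?n. ?c x j * 0)"
      by (intro tendsto_sum tendsto_mult_left
          positive_matrix_iterates_vanish[OF fin Mpos r v Mv h h0])
    moreover have "(\<Sum>j<?n. ?c x j * (h k j / of_real r ^ k)) = g ((act V a ^^ k) x) / of_real r ^ k - \<kappa> * l x" for k
    proof -
      have "(\<Sum>j<?n. ?c x j * h k j) = D ((act V a ^^ k) x)"
        unfolding h_def by (rule functional_expansion[OF cs x functional_act_power[OF D a], symmetric])
      then have "(\<Sum>j<?n. ?c x j * (h k j / of_real r ^ k)) = D ((act V a ^^ k) x) / of_real r ^ k"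
        by (simp flip: sum_divide_distrib)
      then show ?thesis using r by (simp add: D_def lpow[OF x] diff_divide_distrib)
    qed
    ultimately have "(\<lambda>k. g ((act V a ^^ k) x) / of_real r ^ k - \<kappa> * l x) \<longlonglongrightarrow> 0" by simp
    then show ?thesis unfolding \<kappa>_def[symmetric] by (simp add: LIM_zero_iff)
  qed
  have pf: "perron_frobenius_eigenvalue (matrix_of (ground_field K) V us (act V a)) r"
  proof -
    have ev: "eigenvalue (matrix_of (ground_field K) V us (act V a)) \<mu> \<longleftrightarrow>
        (\<exists>y. (\<exists>i<?n. y i \<noteq> 0) \<and> (\<forall>t<?n. (\<Sum>s<?n. y s * of_real (M s t)) = \<mu> * y t))" for \<mu>
      unfolding matrix_of_def eigenvalue_mat_iff_left_eigenvector using M by (simp add: mult.commute)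
    obtain q where q: "0 \<le> q" "q < r"
      and contract: "\<And>g :: nat \<Rightarrow> complex. (\<Sum>i<?n. g i * of_real (v i)) = 0 \<Longrightarrow>
        (\<Sum>j<?n. cmod (\<Sum>i<?n. g i * of_real (M i j)) * v j) \<le> q * (\<Sum>i<?n. cmod (g i) * v i)"
      using positive_matrix_contraction[of "{..<?n}" M r v] fin Mpos r v Mv by blast
    have "cmod \<mu> < r" if \<mu>: "eigenvalue (matrix_of (ground_field K) V us (act V a)) \<mu>" "\<mu> \<noteq> of_real r" for \<mu>
    proof -
      obtain y i where i: "i < ?n" "y i \<noteq> 0" and y: "\<And>t. t < ?n \<Longrightarrow> (\<Sum>s<?n. y s * of_real (M s t)) = \<mu> * y t"
        using \<mu>(1) unfolding ev by blast
      have "of_real r * (\<Sum>s<?n. y s * of_real (v s)) = (\<Sum>s<?n. y s * of_real (\<Sum>t<?n. M s t * v t))"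
        unfolding sum_distrib_left[of "of_real r"] by (intro sum.cong refl) (simp add: Mv del: of_real_sum)
      also have "\<dots> = (\<Sum>t<?n. (\<Sum>s<?n. y s * of_real (M s t)) * of_real (v t))"
        by (simp add: sum_distrib_left sum_distrib_right mult.assoc) (rule sum.swap)
      also have "\<dots> = \<mu> * (\<Sum>s<?n. y s * of_real (v s))"
        by (simp add: y sum_distrib_left mult.assoc)
      finally have "(\<Sum>s<?n. y s * of_real (v s)) = 0" using \<mu>(2) by auto
      from contract[OF this]
      have "cmod \<mu> * (\<Sum>s<?n. cmod (y s) * v s) \<le> q * (\<Sum>s<?n. cmod (y s) * v s)"
        by (simp add: y norm_mult sum_distrib_left mult.assoc)
      moreover have "(\<Sum>s<?n. cmod (y s) * v s) > 0"
        by (rule sum_pos2[of _ i]) (use i v in \<open>simp_all add: less_imp_le\<close>)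
      ultimately have "cmod \<mu> \<le> q" by simp
      then show ?thesis using q by simp
    qed
    moreover have "eigenvalue (matrix_of (ground_field K) V us (act V a)) (of_real r)"
      unfolding ev
    proof (intro exI[of _ "\<lambda>i. of_real (l0 i)"] conjI allI impI)
      show "\<exists>i<?n. complex_of_real (l0 i) \<noteq> 0" using l0[of 0] ne by (intro exI[of _ 0]) auto
      show "(\<Sum>s<?n. complex_of_real (l0 s) * of_real (M s t)) = of_real r * of_real (l0 t)" if "t < ?n" for t
        using lM[of t] that by (simp flip: of_real_mult of_real_sum)
    qed
    ultimately show ?thesis unfolding perron_frobenius_eigenvalue_def using r by blast
  qed
  have "perron_data us a r l v"
    unfolding perron_data_def using r pf llin lu l0 la v conv by auto
  then show ?thesis by blast
qed

text \<open>
  Extend an eigenfunctional \<open>g\<close> for \<open>r\<close> from \<open>W\<close> to \<open>V\<close>. On \<open>W\<close> the sequence \<open>g (a^k x) / r^k\<close> is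
  constant, and its limit is a fixed multiple of \<open>l x\<close>.
\<close>

lemma perron_dominant:
  assumes bas: "is_basis (ground_field K) V us" and ne: "us \<noteq> []" and a: "a \<in> carrier A"
    and data: "perron_data us a r l v"
  shows "dominant_functional a (of_real r) l"
proof -
  have r: "r > 0" and llin: "linear_functional K V (carrier V) l"
    and lpos: "\<And>i. i < length us \<Longrightarrow> Re (l (us ! i)) > 0"
    and la: "\<And>x. x \<in> carrier V \<Longrightarrow> l (act V a x) = of_real r * l x"
    and conv: "\<And>g x. linear_functional K V (carrier V) g \<Longrightarrow> x \<in> carrier V \<Longrightarrow>
      (\<lambda>k. g ((act V a ^^ k) x) / of_real r ^ k) \<longlonglongrightarrow> (\<Sum>i<length us. g (us ! i) * of_real (v i)) * l x"
    using data unfolding perron_data_def by blast+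
  have us0: "us ! 0 \<in> carrier V"
    using basis_coordinate_system[OF bas] nth_mem[of 0 us] ne unfolding coordinate_system_def by auto
  have nz: "\<exists>x\<in>carrier V. l x \<noteq> 0"
    using us0 lpos[of 0] ne by (intro bexI[of _ "us ! 0"]) auto
  have "\<exists>\<kappa>. \<forall>x\<in>W. g x = \<kappa> * l x"
    if W: "lsub W" and g: "linear_functional K V W g" and ga: "\<And>x. x \<in> W \<Longrightarrow> g (act V a x) = of_real r * g x" for W g
  proof -
    obtain g' where g': "linear_functional K V (carrier V) g'" and ext: "\<And>x. x \<in> W \<Longrightarrow> g' x = g x"
      by (rule functional_extension[OF bas lsub_submodule[OF W] g]) (rule that)
    have "g x = (\<Sum>i<length us. g' (us ! i) * of_real (v i)) * l x" if x: "x \<in> W" for x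
    proof -
      have pow: "g ((act V a ^^ k) x) = of_real r ^ k * g x" for k
      proof (induction k)
        case (Suc k)
        show ?case using ga[OF act_power_closed[OF W a x]] Suc by simp
      qed simp
      have "g' ((act V a ^^ k) x) / of_real r ^ k = g x" for k
        using ext[OF act_power_closed[OF W a x]] pow r by simp
      then have "(\<lambda>k. g x) \<longlonglongrightarrow> (\<Sum>i<length us. g' (us ! i) * of_real (v i)) * l x"
        using conv[OF g' lsubD(1)[OF W x]] by simp
      then show ?thesis by (simp add: LIMSEQ_const_iff)
    qed
    then show ?thesis by blast
  qed
  then show ?thesis unfolding dominant_functional_def using llin nz la by blast
qed

text \<open>
  Nonnegative and nonzero is enough for a nonzero pairing with a positive Perron vector, and it is
  evident for the pull-back of a Perron functional along a map with nonnegative matrix.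
\<close>

definition positive_functional :: "'v list \<Rightarrow> ('v \<Rightarrow> complex) \<Rightarrow> bool" where
  "positive_functional us g \<longleftrightarrow> linear_functional K V (carrier V) g \<and>
    (\<forall>i<length us. Im (g (us ! i)) = 0 \<and> Re (g (us ! i)) \<ge> 0) \<and> (\<exists>i<length us. g (us ! i) \<noteq> 0)"

lemma positive_functional_pairing:
  assumes g: "positive_functional us g" and v: "\<And>i. i < length us \<Longrightarrow> v i > 0"
  shows "(\<Sum>i<length us. g (us ! i) * of_real (v i)) \<noteq> 0"
proof -
  have gr: "g (us ! i) = of_real (Re (g (us ! i)))" "Re (g (us ! i)) \<ge> 0" if "i < length us" for i
    using g that unfolding positive_functional_def by (auto simp: complex_eq_iff)
  obtain k where k: "k < length us" "g (us ! k) \<noteq> 0" using g unfolding positive_functional_def by blast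
  have "Re (g (us ! k)) \<noteq> 0" using gr(1)[OF k(1)] k(2) by (metis of_real_0)
  then have "(\<Sum>i<length us. Re (g (us ! i)) * v i) > 0"
    using gr(2) v k(1) by (intro sum_pos2[of _ k]) (simp_all add: less_imp_le order_less_le)
  moreover have "(\<Sum>i<length us. g (us ! i) * of_real (v i)) = of_real (\<Sum>i<length us. Re (g (us ! i)) * v i)"
    unfolding of_real_sum by (intro sum.cong refl) (simp add: gr(1)[symmetric])
  ultimately show ?thesis by (metis less_irrefl of_real_eq_0_iff)
qed

text \<open>
  The iterates \<open>a^k x\<close> stay in \<open>X\<close>, so the limit \<open>\<langle>g, v\<rangle> l x\<close> is zero, and \<open>\<langle>g, v\<rangle> \<noteq> 0\<close> by positivity.
  With \<open>g\<close> the Perron functional of a second operator, this compares the two operators.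
\<close>

lemma perron_vanishing:
  assumes data: "perron_data us a r l v" and a: "a \<in> carrier A" and g: "positive_functional us g"
    and X: "lsub X" and gX: "\<And>x. x \<in> X \<Longrightarrow> g x = 0" and x: "x \<in> X"
  shows "l x = 0"
proof -
  have v: "\<And>i. i < length us \<Longrightarrow> v i > 0"
    and conv: "\<And>g x. linear_functional K V (carrier V) g \<Longrightarrow> x \<in> carrier V \<Longrightarrow>
      (\<lambda>k. g ((act V a ^^ k) x) / of_real r ^ k) \<longlonglongrightarrow> (\<Sum>i<length us. g (us ! i) * of_real (v i)) * l x"
    using data unfolding perron_data_def by blast+
  have glin: "linear_functional K V (carrier V) g" using g unfolding positive_functional_def by blast
  have "(\<lambda>k. 0) \<longlonglongrightarrow> (\<Sum>i<length us. g (us ! i) * of_real (v i)) * l x"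
    using conv[OF glin lsubD(1)[OF X x]] gX[OF act_power_closed[OF X a x]] by simp
  then have "(\<Sum>i<length us. g (us ! i) * of_real (v i)) * l x = 0" by (simp add: LIMSEQ_const_iff)
  then show ?thesis using positive_functional_pairing[OF g v] by simp
qed

text \<open>
  For a nonnegative eigenfunctional with eigenvalue \<open>\<mu>\<close> the sequence \<open>(\<mu> / r)^k g x\<close> converges to
  \<open>\<kappa> l x\<close> with \<open>\<kappa> \<noteq> 0\<close>. Shifting the sequence by one step forces \<open>\<mu> = r\<close>.
\<close>

lemma perron_eigenfunctional:
  assumes bas: "is_basis (ground_field K) V us" and ne: "us \<noteq> []"
    and data: "perron_data us a r l v" and a: "a \<in> carrier A" and g: "positive_functional us g"
    and ga: "\<And>x. x \<in> carrier V \<Longrightarrow> g (act V a x) = \<mu> * g x"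
  shows "\<exists>\<kappa>. \<forall>x\<in>carrier V. g x = \<kappa> * l x"
proof -
  have r: "r > 0" and v: "\<And>i. i < length us \<Longrightarrow> v i > 0"
    and lpos: "\<And>i. i < length us \<Longrightarrow> Re (l (us ! i)) > 0"
    and la: "\<And>x. x \<in> carrier V \<Longrightarrow> l (act V a x) = of_real r * l x"
    and conv: "\<And>g x. linear_functional K V (carrier V) g \<Longrightarrow> x \<in> carrier V \<Longrightarrow>
      (\<lambda>k. g ((act V a ^^ k) x) / of_real r ^ k) \<longlonglongrightarrow> (\<Sum>i<length us. g (us ! i) * of_real (v i)) * l x"
    using data unfolding perron_data_def by blast+
  have glin: "linear_functional K V (carrier V) g" using g unfolding positive_functional_def by blast
  define \<kappa> where "\<kappa> = (\<Sum>i<length us. g (us ! i) * of_real (v i))"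
  have \<kappa>: "\<kappa> \<noteq> 0" unfolding \<kappa>_def by (rule positive_functional_pairing[OF g v])
  have pow: "g ((act V a ^^ k) x) = \<mu> ^ k * g x" if x: "x \<in> carrier V" for k x
  proof (induction k)
    case (Suc k)
    show ?case using ga[OF act_power_closed[OF lsub_carrier a x]] Suc by simp
  qed simp
  have lim: "(\<lambda>k. \<mu> ^ k * g x / of_real r ^ k) \<longlonglongrightarrow> \<kappa> * l x" if x: "x \<in> carrier V" for x
    using conv[OF glin x] unfolding pow[OF x] \<kappa>_def .
  have x0: "us ! 0 \<in> carrier V"
    using basis_coordinate_system[OF bas] nth_mem[of 0 us] ne unfolding coordinate_system_def by auto
  have l0: "l (us ! 0) \<noteq> 0" using lpos[of 0] ne by auto
  have "(\<lambda>k. \<mu> * (\<mu> ^ k * g (us ! 0) / of_real r ^ k)) \<longlonglongrightarrow> \<mu> * (\<kappa> * l (us ! 0))"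
    by (intro tendsto_mult_left lim x0)
  moreover have "(\<lambda>k. \<mu> * (\<mu> ^ k * g (us ! 0) / of_real r ^ k)) \<longlonglongrightarrow> \<kappa> * (of_real r * l (us ! 0))"
    using lim[OF act_rules(1)[OF a x0]] unfolding ga[OF x0] la[OF x0] by (simp add: mult_ac)
  ultimately have "\<mu> * (\<kappa> * l (us ! 0)) = \<kappa> * (of_real r * l (us ! 0))" by (rule LIMSEQ_unique)
  then have \<mu>: "\<mu> = of_real r" using \<kappa> l0 by (simp add: mult_ac)
  have "g x = \<kappa> * l x" if x: "x \<in> carrier V" for x
  proof -
    have "(\<lambda>k. g x) \<longlonglongrightarrow> \<kappa> * l x" using lim[OF x] r unfolding \<mu> by simp
    then show ?thesis by (simp add: LIMSEQ_const_iff)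
  qed
  then show ?thesis by blast
qed

end

lemma perron_frobenius_eigenvalue_unique:
  assumes "perron_frobenius_eigenvalue M r" "perron_frobenius_eigenvalue M s" shows "r = s"
proof (rule ccontr)
  assume ne: "r \<noteq> s"
  have "cmod (of_real s) < r" "cmod (of_real r) < s"
    using assms ne unfolding perron_frobenius_eigenvalue_def by (metis of_real_eq_iff)+
  then show False by simp
qed

section \<open>Cell orders of a positively based algebra\<close>

lemma regular_module_simps [simp]:
  "carrier (regular_module A) = carrier A" "\<zero>\<^bsub>regular_module A\<^esub> = \<zero>\<^bsub>A\<^esub>"
  "add (regular_module A) = add A" "smult (regular_module A) = smult A" "act (regular_module A) = mult A"
  by (simp_all add: regular_module_def)

lemma coset_regular_module: "H +>\<^bsub>regular_module A\<^esub> x = H +>\<^bsub>A\<^esub> x"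
  by (simp add: a_r_coset_def r_coset_def regular_module_def)

lemma regular_left_module:
  assumes alg: "unital_algebra (ground_field K) A"
  shows "left_module (ground_field K) A (regular_module A)"
proof -
  interpret A: unital_algebra "ground_field K" A by (rule alg)
  interpret A: ground_vectorspace K A by (rule ground_vectorspace.intro[OF A.vectorspace_axioms])
  note arr = algebra_ring_rules[OF alg]
  have vs: "vectorspace (ground_field K) (regular_module A)"
  proof (rule vs_criteria)
    show "Ring.field (ground_field K)" by (rule A.field_axioms)
    show "\<zero>\<^bsub>regular_module A\<^esub> \<in> carrier (regular_module A)" by (simp only: regular_module_simps A.vector_rules)
    show "\<forall>v\<in>carrier (regular_module A). \<exists>neg_v\<in>carrier (regular_module A).
        v \<oplus>\<^bsub>regular_module A\<^esub> neg_v = \<zero>\<^bsub>regular_module A\<^esub>"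
      unfolding regular_module_simps using A.vector_rules(4,6) by blast
    show "\<forall>v w. v \<in> carrier (regular_module A) \<and> w \<in> carrier (regular_module A) \<longrightarrow>
        v \<oplus>\<^bsub>regular_module A\<^esub> w = w \<oplus>\<^bsub>regular_module A\<^esub> v"
      unfolding regular_module_simps using A.vector_rules(1) by blast
  qed (simp_all add: A.vector_rules(2,3,5) A.K_rules)
  show ?thesis
  proof (intro left_module.intro left_module_axioms.intro vs alg)
    show "act (regular_module A) (r \<odot>\<^bsub>A\<^esub> a) x = r \<odot>\<^bsub>regular_module A\<^esub> act (regular_module A) a x"
      if "r \<in> carrier (ground_field K)" "a \<in> carrier A" "x \<in> carrier (regular_module A)" for r a x
      using A.smult_mult_left[OF that(1,2)] that(3) by (simp only: regular_module_simps)
    show "act (regular_module A) a (r \<odot>\<^bsub>regular_module A\<^esub> x) = r \<odot>\<^bsub>regular_module A\<^esub> act (regular_module A) a x"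
      if "r \<in> carrier (ground_field K)" "a \<in> carrier A" "x \<in> carrier (regular_module A)" for r a x
      using A.smult_mult_right[OF that(1,2)] that(3) by (simp only: regular_module_simps)
  qed (simp_all only: regular_module_simps arr)
qed

lemma exists_positive_summand:
  fixes f :: "nat \<Rightarrow> real"
  assumes "(\<Sum>m<n. f m) > 0" shows "\<exists>m<n. f m > 0"
proof (rule ccontr)
  assume "\<not> (\<exists>m<n. f m > 0)"
  then have "f m \<le> 0" if "m < n" for m using that by (meson not_less)
  then have "(\<Sum>m<n. f m) \<le> 0" by (intro sum_nonpos) simp
  then show False using assms by simp
qed

locale positively_based =
  fixes K :: "complex set" and A :: "(complex, 'a) module" and bs :: "'a list"
  assumes positively_based: "positively_based_algebra K A bs"
begin

abbreviation "N \<equiv> length bs"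
abbreviation "co \<equiv> coord (ground_field K) A bs"

definition \<gamma> :: "nat \<Rightarrow> nat \<Rightarrow> nat \<Rightarrow> real" where
  "\<gamma> i j l = Re (structure_const K A bs i j l)"

lemma alg: "unital_algebra (ground_field K) A" and basis: "is_basis (ground_field K) A bs"
  and bs_nonempty: "bs \<noteq> []" and bs_one: "bs ! 0 = \<one>\<^bsub>A\<^esub>"
  using positively_based unfolding positively_based_algebra_def by blast+

sublocale A: ground_vectorspace K A
  using alg unfolding unital_algebra_def ground_vectorspace_def by blast

sublocale R: ground_module K A "regular_module A"
proof (intro ground_module.intro ground_module_axioms.intro regular_left_module[OF alg])
  show "ground_vectorspace K (regular_module A)"
    using regular_left_module[OF alg] unfolding left_module_def ground_vectorspace_def by blast
qed

lemmas arr = algebra_ring_rules[OF alg]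
lemmas cs = A.basis_coordinate_system[OF basis]

lemma N_pos: "0 < N" using bs_nonempty by simp

lemma bs_carrier: "i < N \<Longrightarrow> bs ! i \<in> carrier A"
  using cs nth_mem[of i bs] unfolding coordinate_system_def by blast

lemma co_linear: "i < N \<Longrightarrow> linear_functional K A (carrier A) (\<lambda>x. co x i)"
  using cs unfolding coordinate_system_def by blast

lemma co_bs: "i < N \<Longrightarrow> j < N \<Longrightarrow> co (bs ! j) i = (if i = j then 1 else 0)"
  using cs unfolding coordinate_system_def by blast

lemma structure_const_gamma:
  assumes "i < N" "j < N" "l < N"
  shows "co (bs ! i \<otimes>\<^bsub>A\<^esub> bs ! j) l = of_real (\<gamma> i j l)" "\<gamma> i j l \<ge> 0"
proof -
  have "structure_const K A bs i j l \<in> \<real>\<^sub>\<ge>\<^sub>0"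
    using positively_based assms unfolding positively_based_algebra_def by blast
  from nonneg_Reals_eq[OF this]
  show "co (bs ! i \<otimes>\<^bsub>A\<^esub> bs ! j) l = of_real (\<gamma> i j l)" "\<gamma> i j l \<ge> 0"
    unfolding \<gamma>_def structure_const_def by blast+
qed

lemma functional_mult:
  assumes F: "linear_functional K A (carrier A) F" and b: "b \<in> carrier A"
  shows "linear_functional K A (carrier A) (\<lambda>x. F (x \<otimes>\<^bsub>A\<^esub> b))"
    and "linear_functional K A (carrier A) (\<lambda>x. F (b \<otimes>\<^bsub>A\<^esub> x))"
proof -
  note FD = F[unfolded linear_functional_def]
  have FD: "F (x \<oplus>\<^bsub>A\<^esub> y) = F x + F y" "r \<in> K \<Longrightarrow> F (r \<odot>\<^bsub>A\<^esub> x) = r * F x"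
    if "x \<in> carrier A" "y \<in> carrier A" for x y r using FD that by blast+
  have sl: "(r \<odot>\<^bsub>A\<^esub> x) \<otimes>\<^bsub>A\<^esub> y = r \<odot>\<^bsub>A\<^esub> (x \<otimes>\<^bsub>A\<^esub> y)" "x \<otimes>\<^bsub>A\<^esub> (r \<odot>\<^bsub>A\<^esub> y) = r \<odot>\<^bsub>A\<^esub> (x \<otimes>\<^bsub>A\<^esub> y)"
    if "r \<in> K" "x \<in> carrier A" "y \<in> carrier A" for r x y
    using R.act_rules(4,5)[OF that(1), of x y] that by simp_all
  show "linear_functional K A (carrier A) (\<lambda>x. F (x \<otimes>\<^bsub>A\<^esub> b))"
    unfolding linear_functional_def
    by (intro conjI ballI) (simp_all only: arr sl b FD)
  show "linear_functional K A (carrier A) (\<lambda>x. F (b \<otimes>\<^bsub>A\<^esub> x))"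
    unfolding linear_functional_def
    by (intro conjI ballI) (simp_all only: arr sl b FD)
qed

lemma gamma_assoc:
  assumes "i < N" "j < N" "k < N" "l < N"
  shows "(\<Sum>m<N. \<gamma> i j m * \<gamma> m k l) = (\<Sum>m<N. \<gamma> j k m * \<gamma> i m l)"
proof -
  note b = bs_carrier
  have "co ((bs ! i \<otimes>\<^bsub>A\<^esub> bs ! j) \<otimes>\<^bsub>A\<^esub> bs ! k) l =
      (\<Sum>m<N. co (bs ! i \<otimes>\<^bsub>A\<^esub> bs ! j) m * co (bs ! m \<otimes>\<^bsub>A\<^esub> bs ! k) l)"
    by (rule A.functional_expansion[OF cs arr(2)[OF b b] functional_mult(1)[OF co_linear b]]) (rule assms)+
  also have "\<dots> = of_real (\<Sum>m<N. \<gamma> i j m * \<gamma> m k l)"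
    unfolding of_real_sum using structure_const_gamma(1) assms by (intro sum.cong refl) simp
  finally have 1: "co ((bs ! i \<otimes>\<^bsub>A\<^esub> bs ! j) \<otimes>\<^bsub>A\<^esub> bs ! k) l = of_real (\<Sum>m<N. \<gamma> i j m * \<gamma> m k l)" .
  have "co (bs ! i \<otimes>\<^bsub>A\<^esub> (bs ! j \<otimes>\<^bsub>A\<^esub> bs ! k)) l =
      (\<Sum>m<N. co (bs ! j \<otimes>\<^bsub>A\<^esub> bs ! k) m * co (bs ! i \<otimes>\<^bsub>A\<^esub> bs ! m) l)"
    by (rule A.functional_expansion[OF cs arr(2)[OF b b] functional_mult(2)[OF co_linear b]]) (rule assms)+
  also have "\<dots> = of_real (\<Sum>m<N. \<gamma> j k m * \<gamma> i m l)"
    unfolding of_real_sum using structure_const_gamma(1) assms by (intro sum.cong refl) simp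
  finally have "complex_of_real (\<Sum>m<N. \<gamma> i j m * \<gamma> m k l) = of_real (\<Sum>m<N. \<gamma> j k m * \<gamma> i m l)"
    unfolding 1[symmetric] arr(3)[OF b[OF assms(1)] b[OF assms(2)] b[OF assms(3)]] .
  then show ?thesis by (rule iffD1[OF of_real_eq_iff])
qed

text \<open>
  Sums of nonnegative reals cannot cancel, so associativity descends to the multivalued product on
  indices that only records which structure constants are positive.
\<close>

lemma gamma_reassoc:
  assumes "i < N" "j < N" "k < N" "l < N"
  shows "(\<exists>m<N. \<gamma> i j m > 0 \<and> \<gamma> m k l > 0) \<longleftrightarrow> (\<exists>m<N. \<gamma> j k m > 0 \<and> \<gamma> i m l > 0)"
proof -
  have pos: "(\<Sum>m<N. f m * g m) > 0 \<longleftrightarrow> (\<exists>m<N. f m > 0 \<and> g m > 0)"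
    if f: "\<And>m. m < N \<Longrightarrow> f m \<ge> 0" and g: "\<And>m. m < N \<Longrightarrow> g m \<ge> 0" for f g :: "nat \<Rightarrow> real"
  proof
    assume "(\<Sum>m<N. f m * g m) > 0"
    from exists_positive_summand[OF this] obtain m where m: "m < N" "f m * g m > 0" by blast
    have "f m > 0 \<and> g m > 0"
      using m(2) f[OF m(1)] g[OF m(1)] by (auto simp: zero_less_mult_iff)
    then show "\<exists>m<N. f m > 0 \<and> g m > 0" using m(1) by blast
  next
    assume "\<exists>m<N. f m > 0 \<and> g m > 0"
    then obtain m where m: "m < N" "f m > 0" "g m > 0" by blast
    show "(\<Sum>m<N. f m * g m) > 0"
    proof (rule sum_pos2[of _ m])
      show "0 \<le> f x * g x" if "x \<in> {..<N}" for x
        using f[of x] g[of x] that by simp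
    qed (use m in simp_all)
  qed
  have nn: "\<gamma> a b c \<ge> 0" if "a < N" "b < N" "c < N" for a b c by (rule structure_const_gamma(2)[OF that])
  show ?thesis
    using gamma_assoc[OF assms] pos[of "\<gamma> i j" "\<lambda>m. \<gamma> m k l"] pos[of "\<gamma> j k" "\<lambda>m. \<gamma> i m l"] assms
    by (simp add: nn)
qed

lemma gamma_unit:
  assumes "j < N" shows "\<gamma> 0 j j > 0" "\<gamma> j 0 j > 0"
  using structure_const_gamma(1)[OF N_pos assms assms] structure_const_gamma(1)[OF assms N_pos assms]
    arr(4,5)[OF bs_carrier[OF assms]] co_bs[OF assms assms]
  unfolding bs_one by (simp_all add: complex_eq_iff)

text \<open>
  The cell preorders, with the two-sided order factored into a left and a right step through an
  intermediate index.
\<close>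

definition leL :: "nat \<Rightarrow> nat \<Rightarrow> bool" where "leL i j \<longleftrightarrow> j < N \<and> (\<exists>s<N. \<gamma> s i j > 0)"
definition leR :: "nat \<Rightarrow> nat \<Rightarrow> bool" where "leR i j \<longleftrightarrow> j < N \<and> (\<exists>t<N. \<gamma> i t j > 0)"
definition leJ :: "nat \<Rightarrow> nat \<Rightarrow> bool" where "leJ i j \<longleftrightarrow> (\<exists>m<N. leL i m \<and> leR m j)"

lemma star_singleton:
  assumes "s < N" "i < N" shows "star K A bs {s} {i} = {l. l < N \<and> \<gamma> s i l > 0}"
proof -
  have "structure_const K A bs s i l \<in> \<real>\<^sub>\<ge>\<^sub>0 - {0} \<longleftrightarrow> \<gamma> s i l > 0" if "l < N" for l
    unfolding structure_const_def structure_const_gamma(1)[OF assms that] by auto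
  then show ?thesis unfolding star_def by auto
qed

lemma le_L_iff: "i < N \<Longrightarrow> le_L K A bs i j \<longleftrightarrow> leL i j"
  unfolding le_L_def leL_def by (auto simp: star_singleton)

lemma star_UN: "star K A bs X {t} = (\<Union>m\<in>X. star K A bs {m} {t})"
  unfolding star_def by auto

lemma le_J_iff:
  assumes i: "i < N" shows "le_J K A bs i j \<longleftrightarrow> leJ i j"
proof -
  have e: "j \<in> star K A bs (star K A bs {s} {i}) {t} \<longleftrightarrow> (\<exists>m<N. \<gamma> s i m > 0 \<and> j < N \<and> \<gamma> m t j > 0)"
    if "s < N" "t < N" for s t
    unfolding star_singleton[OF that(1) i] star_UN[of "{l. l < N \<and> 0 < \<gamma> s i l}"]
    using star_singleton[OF _ that(2)] by auto
  have "le_J K A bs i j \<longleftrightarrow> (\<exists>s<N. \<exists>t<N. \<exists>m<N. \<gamma> s i m > 0 \<and> j < N \<and> \<gamma> m t j > 0)"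
    unfolding le_J_def using e by (simp cong: conj_cong)
  also have "\<dots> \<longleftrightarrow> leJ i j" unfolding leJ_def leL_def leR_def by blast
  finally show ?thesis .
qed

lemma leL_refl: "i < N \<Longrightarrow> leL i i" and leR_refl: "i < N \<Longrightarrow> leR i i"
  unfolding leL_def leR_def using gamma_unit N_pos by blast+

lemma leL_trans:
  assumes i: "i < N" and ij: "leL i j" and jk: "leL j k" shows "leL i k"
proof -
  obtain s where s: "s < N" "j < N" "\<gamma> s i j > 0" using ij unfolding leL_def by blast
  obtain t where t: "t < N" "k < N" "\<gamma> t j k > 0" using jk unfolding leL_def by blast
  have "\<exists>m<N. \<gamma> t s m > 0 \<and> \<gamma> m i k > 0"
    unfolding gamma_reassoc[OF t(1) s(1) i t(2)] using s t by blast
  then show ?thesis unfolding leL_def using t(2) by blast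
qed

lemma leR_trans:
  assumes i: "i < N" and ij: "leR i j" and jk: "leR j k" shows "leR i k"
proof -
  obtain s where s: "s < N" "j < N" "\<gamma> i s j > 0" using ij unfolding leR_def by blast
  obtain t where t: "t < N" "k < N" "\<gamma> j t k > 0" using jk unfolding leR_def by blast
  have "\<exists>m<N. \<gamma> s t m > 0 \<and> \<gamma> i m k > 0"
    unfolding gamma_reassoc[OF i s(1) t(1) t(2), symmetric] using s t by blast
  then show ?thesis unfolding leR_def using t(2) by blast
qed

lemma leLR_commute:
  assumes i: "i < N" shows "(\<exists>m<N. leL i m \<and> leR m j) \<longleftrightarrow> (\<exists>m<N. leR i m \<and> leL m j)"
proof -
  have "(\<exists>m<N. leL i m \<and> leR m j) \<longleftrightarrow> (\<exists>s<N. \<exists>t<N. j < N \<and> (\<exists>m<N. \<gamma> s i m > 0 \<and> \<gamma> m t j > 0))"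
    unfolding leL_def leR_def by blast
  also have "\<dots> \<longleftrightarrow> (\<exists>s<N. \<exists>t<N. j < N \<and> (\<exists>m<N. \<gamma> i t m > 0 \<and> \<gamma> s m j > 0))"
    using gamma_reassoc[OF _ i] by (simp cong: conj_cong)
  also have "\<dots> \<longleftrightarrow> (\<exists>m<N. leR i m \<and> leL m j)"
    unfolding leL_def leR_def by blast
  finally show ?thesis .
qed

lemma leL_leJ: "leL i j \<Longrightarrow> leJ i j"
  unfolding leJ_def using leR_refl leL_def by blast

lemma leR_leJ: "i < N \<Longrightarrow> leR i j \<Longrightarrow> leJ i j"
  unfolding leJ_def using leL_refl by blast

lemma leJ_bound: "leJ i j \<Longrightarrow> j < N"
  unfolding leJ_def leR_def by blast

lemma leJ_trans:
  assumes i: "i < N" and ij: "leJ i j" and jk: "leJ j k" shows "leJ i k"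
proof -
  obtain m where m: "m < N" "leL i m" "leR m j" using ij unfolding leJ_def by blast
  obtain m' where m': "m' < N" "leL j m'" "leR m' k" using jk unfolding leJ_def by blast
  have j: "j < N" by (rule leJ_bound[OF ij])
  obtain p where p: "p < N" "leL m p" "leR p m'" using leLR_commute[OF m(1)] m(3) m'(2) j by blast
  have "leL i p" by (rule leL_trans[OF i m(2) p(2)])
  moreover have "leR p k" by (rule leR_trans[OF p(1) p(3) m'(3)])
  ultimately show ?thesis unfolding leJ_def using p(1) by blast
qed

text \<open>
  Let \<open>J\<close> be the two-sided cell of \<open>i\<close> and \<open>j\<close>, and let \<open>\<Lambda>\<close> and \<open>\<rho>\<close> be the matrices on \<open>J\<close> of left and right
  multiplication by the sum of all basis elements. Cells are convex for the orders; so restricting to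
  \<open>J\<close> loses nothing in products, and associativity says that \<open>\<Lambda>\<close> and \<open>\<rho>\<close> commute. Their product \<open>P\<close>
  is positive, since any two elements of \<open>J\<close> are related by a left and a right step. The set \<open>U\<close> of
  elements of \<open>J\<close> above \<open>j\<close> in the left order is invariant under \<open>\<Lambda>\<close>, hence \<open>\<Lambda>\<close> is block diagonal with
  respect to it. If \<open>i\<close> were not in \<open>U\<close>, the entry of \<open>\<Lambda>\<close> that witnesses \<open>i \<le>\<^sub>L j\<close> would be zero.
\<close>

lemma stability:
  assumes i: "i < N" and ij: "leL i j" and ji: "leJ j i"
  shows "leL j i"
proof (rule ccontr)
  assume not: "\<not> leL j i"
  have j: "j < N" using ij unfolding leL_def by blast
  define J where "J = {k. k < N \<and> leJ i k \<and> leJ k i}"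
  define U where "U = {k \<in> J. leL j k}"
  define \<Lambda> where "\<Lambda> = (\<lambda>l k. \<Sum>s<N. \<gamma> s k l)"
  define \<rho> where "\<rho> = (\<lambda>l k. \<Sum>t<N. \<gamma> k t l)"
  define P where "P = (\<lambda>l k. \<Sum>m\<in>J. \<rho> l m * \<Lambda> m k)"
  have J: "k < N" "leJ i k" "leJ k i" if "k \<in> J" for k using that unfolding J_def by blast+
  have finJ: "finite J" unfolding J_def by simp
  have JN: "J \<subseteq> {..<N}" using J(1) by auto
  have nnL: "\<Lambda> l k \<ge> 0" and nnR: "\<rho> l k \<ge> 0" if "l < N" "k < N" for l k
    unfolding \<Lambda>_def \<rho>_def by (intro sum_nonneg; use that structure_const_gamma(2) in simp)+
  have posL: "\<Lambda> l k > 0 \<longleftrightarrow> leL k l" if lk: "l < N" "k < N" for l k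
  proof
    assume "\<Lambda> l k > 0"
    from exists_positive_summand[OF this[unfolded \<Lambda>_def]] show "leL k l" unfolding leL_def using lk by blast
  next
    assume "leL k l"
    then obtain s where "s < N" "\<gamma> s k l > 0" unfolding leL_def by blast
    then show "\<Lambda> l k > 0" unfolding \<Lambda>_def using lk structure_const_gamma(2) by (intro sum_pos2[of _ s]) simp_all
  qed
  have posR: "\<rho> l k > 0 \<longleftrightarrow> leR k l" if lk: "l < N" "k < N" for l k
  proof
    assume "\<rho> l k > 0"
    from exists_positive_summand[OF this[unfolded \<rho>_def]] show "leR k l" unfolding leR_def using lk by blast
  next
    assume "leR k l"
    then obtain s where "s < N" "\<gamma> k s l > 0" unfolding leR_def by blast
    then show "\<rho> l k > 0" unfolding \<rho>_def using lk structure_const_gamma(2) by (intro sum_pos2[of _ s]) simp_all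
  qed
  \<comment> \<open>Convexity of the two-sided cell.\<close>
  have between: "m \<in> J" if "k \<in> J" "l \<in> J" "m < N" "leJ k m" "leJ m l" for k l m
    unfolding J_def using that(3) leJ_trans[OF i J(2)[OF that(1)] that(4)] leJ_trans[OF that(3,5) J(3)[OF that(2)]]
    by blast
  have comm: "(\<Sum>m\<in>J. \<rho> l m * \<Lambda> m k) = (\<Sum>m\<in>J. \<Lambda> l m * \<rho> m k)" if l: "l \<in> J" and k: "k \<in> J" for l k
  proof -
    \<comment> \<open>Indices outside the cell contribute nothing to either product, by convexity.\<close>
    have zero1: "\<rho> l m * \<Lambda> m k = 0" if m: "m \<in> {..<N} - J" for m
    proof (rule ccontr)
      assume "\<rho> l m * \<Lambda> m k \<noteq> 0"
      then have "leR m l" "leL k m"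
        using posR[of l m] posL[of m k] nnL[of m k] nnR[of l m] m J(1)[OF l] J(1)[OF k] by (auto simp: less_le)
      then show False using between[OF k l, of m] leL_leJ leR_leJ[of m l] m by auto
    qed
    have zero2: "\<Lambda> l m * \<rho> m k = 0" if m: "m \<in> {..<N} - J" for m
    proof (rule ccontr)
      assume "\<Lambda> l m * \<rho> m k \<noteq> 0"
      then have "leL m l" "leR k m"
        using posL[of l m] posR[of m k] nnR[of m k] nnL[of l m] m J(1)[OF l] J(1)[OF k] by (auto simp: less_le)
      then show False using between[OF k l, of m] leL_leJ leR_leJ[OF J(1)[OF k], of m] m by auto
    qed
    have "(\<Sum>m\<in>J. \<rho> l m * \<Lambda> m k) = (\<Sum>m<N. \<rho> l m * \<Lambda> m k)"
      by (rule sum.mono_neutral_left[OF _ JN]) (simp_all add: zero1)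
    also have "\<dots> = (\<Sum>m<N. \<Sum>s<N. \<Sum>t<N. \<gamma> s k m * \<gamma> m t l)"
      unfolding \<rho>_def \<Lambda>_def sum_product by (rule sum.cong[OF refl], subst sum.swap) (simp add: mult.commute)
    also have "\<dots> = (\<Sum>s<N. \<Sum>t<N. \<Sum>m<N. \<gamma> s k m * \<gamma> m t l)"
      by (subst sum.swap, rule sum.cong[OF refl], subst sum.swap) (rule refl)
    also have "\<dots> = (\<Sum>s<N. \<Sum>t<N. \<Sum>m<N. \<gamma> k t m * \<gamma> s m l)"
      by (intro sum.cong refl gamma_assoc) (use J(1)[OF l] J(1)[OF k] in auto)
    also have "\<dots> = (\<Sum>m<N. \<Sum>s<N. \<Sum>t<N. \<gamma> k t m * \<gamma> s m l)"
      by (subst (2) sum.swap, rule sum.cong[OF refl], subst sum.swap) (rule refl)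
    also have "\<dots> = (\<Sum>m<N. \<Lambda> l m * \<rho> m k)"
      unfolding \<rho>_def \<Lambda>_def sum_product by (intro sum.cong refl) (simp add: mult.commute)
    also have "\<dots> = (\<Sum>m\<in>J. \<Lambda> l m * \<rho> m k)"
      by (rule sum.mono_neutral_right[OF _ JN]) (simp_all add: zero2)
    finally show ?thesis .
  qed
  have Ppos: "P l k > 0" if l: "l \<in> J" and k: "k \<in> J" for l k
  proof -
    have "leJ k l" by (rule leJ_trans[OF J(1)[OF k] J(3)[OF k] J(2)[OF l]])
    then obtain m where m: "m < N" "leL k m" "leR m l" unfolding leJ_def by blast
    have mJ: "m \<in> J" by (rule between[OF k l m(1) leL_leJ[OF m(2)] leR_leJ[OF m(1,3)]])
    show ?thesis
      unfolding P_def
    proof (rule sum_pos2[OF finJ mJ])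
      show "0 < \<rho> l m * \<Lambda> m k"
        using posR[OF J(1)[OF l] m(1)] posL[OF m(1) J(1)[OF k]] m by simp
      show "0 \<le> \<rho> l x * \<Lambda> x k" if "x \<in> J" for x
        using nnR[OF J(1)[OF l] J(1)[OF that]] nnL[OF J(1)[OF that] J(1)[OF k]] by simp
    qed
  qed
  have Pcomm: "(\<Sum>m\<in>J. P l m * \<Lambda> m k) = (\<Sum>m\<in>J. \<Lambda> l m * P m k)" if l: "l \<in> J" and k: "k \<in> J" for l k
  proof -
    have "(\<Sum>m\<in>J. P l m * \<Lambda> m k) = (\<Sum>m\<in>J. (\<Sum>p\<in>J. \<Lambda> l p * \<rho> p m) * \<Lambda> m k)"
      unfolding P_def by (intro sum.cong refl) (simp add: comm l)
    also have "\<dots> = (\<Sum>p\<in>J. \<Lambda> l p * (\<Sum>m\<in>J. \<rho> p m * \<Lambda> m k))"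
      by (simp add: sum_distrib_left sum_distrib_right mult.assoc) (rule sum.swap)
    finally show ?thesis unfolding P_def .
  qed
  have iJ: "i \<in> J" unfolding J_def using i leL_leJ[OF leL_refl[OF i]] by blast
  have jJ: "j \<in> J" unfolding J_def using j leL_leJ[OF ij] ji by blast
  have "\<Lambda> j i = 0"
  proof (rule commuting_matrix_blocks[of J P \<Lambda> U])
    show "\<Lambda> a b = 0" if a: "a \<in> J - U" and b: "b \<in> U" for a b
    proof (rule ccontr)
      assume "\<Lambda> a b \<noteq> 0"
      have bJ: "b \<in> J" "leL j b" and aJ: "a \<in> J" using a b unfolding U_def by blast+
      have "leL b a" using \<open>\<Lambda> a b \<noteq> 0\<close> posL[OF J(1)[OF aJ] J(1)[OF bJ(1)]] nnL[OF J(1)[OF aJ] J(1)[OF bJ(1)]]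
        by (simp add: less_le)
      then have "leL j a" by (rule leL_trans[OF j bJ(2)])
      then show False using a unfolding U_def by blast
    qed
    show "\<Lambda> a b \<ge> 0" if "a \<in> J" "b \<in> J" for a b by (rule nnL[OF J(1)[OF that(1)] J(1)[OF that(2)]])
    show "U \<subseteq> J" unfolding U_def by blast
    show "j \<in> U" unfolding U_def using jJ leL_refl[OF j] by blast
    show "i \<in> J - U" unfolding U_def using iJ not by blast
  qed (fact finJ, fact Ppos, fact Pcomm)
  moreover have "\<Lambda> j i > 0" using posL[OF j i] ij by blast
  ultimately show False by simp
qed

lemma left_cell_cases:
  assumes "L \<in> left_cells K A bs"
  obtains i where "i < N" "i \<in> L" "L = {j. leL i j \<and> leL j i}"
proof -
  obtain i where i: "i < N" and L: "L = {(i, j). i < N \<and> j < N \<and> le_L K A bs i j \<and> le_L K A bs j i} `` {i}"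
    using assms unfolding left_cells_def by (auto elim!: quotientE)
  have "L = {j. leL i j \<and> leL j i}"
    unfolding L using i by (auto simp: le_L_iff leL_def)
  moreover have "i \<in> {j. leL i j \<and> leL j i}" using leL_refl[OF i] by blast
  ultimately show ?thesis using i by (intro that[of i]) simp_all
qed

lemma left_cell_of: "j < N \<Longrightarrow> {k. leL j k \<and> leL k j} \<in> left_cells K A bs"
proof -
  assume j: "j < N"
  have eq: "{k. leL j k \<and> leL k j} = {(i, j). i < N \<and> j < N \<and> le_L K A bs i j \<and> le_L K A bs j i} `` {j}"
    using j by (auto simp: le_L_iff leL_def)
  show ?thesis unfolding left_cells_def eq by (rule quotientI) (simp add: j)
qed

text \<open>
  The union over all left cells above \<open>L\<close> is a single up-set of the preorder on indices.
\<close>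

lemma upper_closure_eq:
  assumes i: "i < N" and L: "L = {j. leL i j \<and> leL j i}"
  shows "upper_closure K A bs L = {j. leL i j}"
proof
  show "upper_closure K A bs L \<subseteq> {j. leL i j}"
  proof
    fix j assume "j \<in> upper_closure K A bs L"
    then obtain L' where L': "L' \<in> left_cells K A bs" "cell_le_L K A bs L L'" "j \<in> L'"
      unfolding upper_closure_def by blast
    obtain k where k: "k < N" "L' = {j. leL k j \<and> leL j k}" by (rule left_cell_cases[OF L'(1)])
    obtain x y where xy: "x \<in> L" "y \<in> L'" "le_L K A bs x y" using L'(2) unfolding cell_le_L_def by blast
    have x: "x < N" "leL i x" using xy(1) unfolding L leL_def by blast+
    have y: "y < N" "leL y k" using xy(2) unfolding k(2) leL_def by blast+
    have "leL x y" using xy(3) le_L_iff[OF x(1)] by blast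
    then have "leL i k" using leL_trans[OF i leL_trans[OF i x(2)] y(2)] by blast
    then show "j \<in> {j. leL i j}" using leL_trans[OF i] L'(3) unfolding k(2) by blast
  qed
  show "{j. leL i j} \<subseteq> upper_closure K A bs L"
  proof
    fix j assume "j \<in> {j. leL i j}"
    then have ij: "leL i j" and j: "j < N" unfolding leL_def by blast+
    have "i \<in> L" unfolding L using leL_refl[OF i] by blast
    moreover have "j \<in> {k. leL j k \<and> leL k j}" using leL_refl[OF j] by blast
    moreover have "le_L K A bs i j" using ij le_L_iff[OF i] by blast
    ultimately show "j \<in> upper_closure K A bs L"
      unfolding upper_closure_def cell_le_L_def using left_cell_of[OF j] by blast
  qed
qed

lemma two_sided_cell_cases:
  assumes "X \<in> two_sided_cells K A bs" "i \<in> X"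
  shows "i < N" "X = {j. leJ i j \<and> leJ j i}"
proof -
  obtain k where k: "k < N" and X: "X = {(i, j). i < N \<and> j < N \<and> le_J K A bs i j \<and> le_J K A bs j i} `` {k}"
    using assms unfolding two_sided_cells_def by (auto elim!: quotientE)
  have Xk: "X = {j. leJ k j \<and> leJ j k}"
    unfolding X using k leJ_bound by (auto simp: le_J_iff)
  then show i: "i < N" using assms(2) leJ_bound by blast
  have ki: "leJ k i" "leJ i k" using assms(2) unfolding Xk by blast+
  show "X = {j. leJ i j \<and> leJ j i}"
    unfolding Xk
  proof (intro Collect_cong iffI; elim conjE)
    fix j assume kj: "leJ k j" and jk: "leJ j k"
    have "leJ i j" by (rule leJ_trans[OF i ki(2) kj])
    moreover have "leJ j i" by (rule leJ_trans[OF leJ_bound[OF kj] jk ki(1)])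
    ultimately show "leJ i j \<and> leJ j i" by (rule conjI)
  next
    fix j assume ij: "leJ i j" and ji: "leJ j i"
    have "leJ k j" by (rule leJ_trans[OF k ki(1) ij])
    moreover have "leJ j k" by (rule leJ_trans[OF leJ_bound[OF ij] ji ki(2)])
    ultimately show "leJ k j \<and> leJ j k" by (rule conjI)
  qed
qed

lemma two_sided_cell_of: "j < N \<Longrightarrow> {k. leJ j k \<and> leJ k j} \<in> two_sided_cells K A bs"
proof -
  assume j: "j < N"
  have eq: "{k. leJ j k \<and> leJ k j} = {(i, j). i < N \<and> j < N \<and> le_J K A bs i j \<and> le_J K A bs j i} `` {j}"
    using j leJ_bound by (auto simp: le_J_iff)
  show ?thesis unfolding two_sided_cells_def eq by (rule quotientI) (simp add: j)
qed

end

section \<open>Transitive modules and their apex\<close>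

lemma linear_functional_regular:
  "linear_functional K (regular_module A) W f \<longleftrightarrow> linear_functional K A W f"
  unfolding linear_functional_def by simp

locale transitive = positively_based K A bs
  for K :: "complex set" and A :: "(complex, 'a) module" and bs :: "'a list" +
  fixes V :: "(complex, 'a, 'v) lmodule" and vs :: "'v list"
  assumes transitive: "transitive_module K A bs V vs"
begin

lemma V_left_module: "left_module (ground_field K) A V" and V_basis: "is_basis (ground_field K) V vs"
  and V_nonzero: "carrier V \<noteq> {\<zero>\<^bsub>V\<^esub>}"
  using transitive unfolding transitive_module_def positively_based_module_def by blast+

sublocale V: ground_module K A V
proof (intro ground_module.intro ground_module_axioms.intro V_left_module)
  show "ground_vectorspace K V"
    using V_left_module unfolding left_module_def ground_vectorspace_def by blast
qed

abbreviation "cv \<equiv> coord (ground_field K) V vs"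

lemmas V_cs = V.basis_coordinate_system[OF V_basis]

lemma vs_carrier: "i < length vs \<Longrightarrow> vs ! i \<in> carrier V"
  using V_cs nth_mem[of i vs] unfolding coordinate_system_def by blast

lemma cv_linear: "i < length vs \<Longrightarrow> linear_functional K V (carrier V) (\<lambda>x. cv x i)"
  using V_cs unfolding coordinate_system_def by blast

lemma vs_nonempty: "vs \<noteq> []"
proof
  assume "vs = []"
  then have "x = \<zero>\<^bsub>V\<^esub>" if "x \<in> carrier V" for x
    using V_cs that unfolding coordinate_system_def by simp
  then show False using V_nonzero V.vector_rules(8) by blast
qed

lemma cv_nonneg:
  assumes "i < N" "s < length vs" "t < length vs"
  shows "cv (act V (bs ! i) (vs ! s)) t = of_real (Re (cv (act V (bs ! i) (vs ! s)) t))"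
    "Re (cv (act V (bs ! i) (vs ! s)) t) \<ge> 0"
proof -
  have "cv (act V (bs ! i) (vs ! s)) t \<in> \<real>\<^sub>\<ge>\<^sub>0"
    using transitive assms unfolding transitive_module_def positively_based_module_def by blast
  from nonneg_Reals_eq[OF this]
  show "cv (act V (bs ! i) (vs ! s)) t = of_real (Re (cv (act V (bs ! i) (vs ! s)) t))"
    "Re (cv (act V (bs ! i) (vs ! s)) t) \<ge> 0" by blast+
qed

lemma functional_orbit:
  assumes F: "linear_functional K V (carrier V) F" and v: "v \<in> carrier V"
  shows "linear_functional K A (carrier A) (\<lambda>a. F (act V a v))"
  unfolding linear_functional_def
  by (intro conjI ballI) (simp_all only: V.act_rules v V.functionalD[OF F])

lemma weighted_sum_carrier:
  assumes c: "positive_coeffs K N c"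
  shows "weighted_sum A bs c \<in> carrier A"
proof (rule functional_weighted_sum(1)[OF A.ground_vectorspace_axioms co_linear[OF N_pos]])
  show "set bs \<subseteq> carrier A" using cs unfolding coordinate_system_def by blast
  show "c i \<in> K" if "i < N" for i using c that unfolding positive_coeffs_def by blast
qed

text \<open>
  Each entry of the matrix of \<open>a(c)\<close> is a sum of nonnegative terms, and transitivity makes one of them nonzero.
\<close>

lemma weighted_sum_positive:
  assumes c: "positive_coeffs K N c" and i: "i < length vs" and j: "j < length vs"
  shows "Im (cv (act V (weighted_sum A bs c) (vs ! j)) i) = 0 \<and>
    Re (cv (act V (weighted_sum A bs c) (vs ! j)) i) > 0"
proof -
  have cK: "c k \<in> K" and cpos: "c k \<in> \<real>\<^sub>\<ge>\<^sub>0 - {0}" if "k < N" for k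
    using c that unfolding positive_coeffs_def by blast+
  have ck: "c k = of_real (Re (c k))" "Re (c k) > 0" if "k < N" for k
  proof -
    have "c k = of_real (Re (c k)) \<and> Re (c k) \<ge> 0" using nonneg_Reals_eq[of "c k"] cpos[OF that] by blast
    then show "c k = of_real (Re (c k))" "Re (c k) > 0" using cpos[OF that] by (auto simp: less_le complex_eq_iff)
  qed
  have "set bs \<subseteq> carrier A" using cs unfolding coordinate_system_def by blast
  from functional_weighted_sum(2)[OF A.ground_vectorspace_axioms functional_orbit[OF cv_linear[OF i] vs_carrier[OF j]] this cK]
  have "cv (act V (weighted_sum A bs c) (vs ! j)) i = (\<Sum>k<N. c k * cv (act V (bs ! k) (vs ! j)) i)" .
  also have "\<dots> = of_real (\<Sum>k<N. Re (c k) * Re (cv (act V (bs ! k) (vs ! j)) i))"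
    unfolding of_real_sum of_real_mult
  proof (rule sum.cong[OF refl])
    fix k assume "k \<in> {..<N}"
    then have k: "k < N" by simp
    show "c k * cv (act V (bs ! k) (vs ! j)) i = of_real (Re (c k)) * of_real (Re (cv (act V (bs ! k) (vs ! j)) i))"
      unfolding ck(1)[OF k, symmetric] cv_nonneg(1)[OF k j i, symmetric] by (rule refl)
  qed
  finally have eq: "cv (act V (weighted_sum A bs c) (vs ! j)) i =
      of_real (\<Sum>k<N. Re (c k) * Re (cv (act V (bs ! k) (vs ! j)) i))" .
  obtain k where k: "k < N" "cv (act V (bs ! k) (vs ! j)) i \<noteq> 0"
    using transitive i j unfolding transitive_module_def by blast
  have pos: "Re (cv (act V (bs ! k) (vs ! j)) i) > 0"
    using cv_nonneg[OF k(1) j i] k(2) by (metis less_eq_real_def of_real_0)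
  have "(\<Sum>k<N. Re (c k) * Re (cv (act V (bs ! k) (vs ! j)) i)) > 0"
  proof (rule sum_pos2[of _ k])
    show "0 \<le> Re (c m) * Re (cv (act V (bs ! m) (vs ! j)) i)" if "m \<in> {..<N}" for m
      using ck(2)[of m] cv_nonneg(2)[of m, OF _ j i] that by simp
    show "0 < Re (c k) * Re (cv (act V (bs ! k) (vs ! j)) i)" using ck(2)[OF k(1)] pos by simp
  qed (use k(1) in simp_all)
  then show ?thesis unfolding eq by simp
qed

lemma exists_perron_data:
  assumes c: "positive_coeffs K N c"
  shows "\<exists>r l v. V.perron_data vs (weighted_sum A bs c) r l v"
  by (rule V.positive_operator_perron_data[OF V_basis vs_nonempty weighted_sum_carrier[OF c] weighted_sum_positive[OF c]])

text \<open>
  The special subquotients expressed through the Perron functional \<open>l\<close>: neither eigenvalues nor matrices of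
  subquotients occur any more.
\<close>

lemma special_subquotient_iff:
  assumes c: "positive_coeffs K N c" and data: "V.perron_data vs (weighted_sum A bs c) r l v"
  shows "is_special_subquotient K A bs c V vs S \<longleftrightarrow>
    (\<exists>W U. V.simple_pair W U \<and> S = subquotient V W U \<and> (\<exists>w\<in>W. l w \<noteq> 0) \<and> (\<forall>u\<in>U. l u = 0))"
proof -
  let ?a = "weighted_sum A bs c"
  have pf: "perron_frobenius_eigenvalue (matrix_of (ground_field K) V vs (act V ?a)) r"
    using data unfolding V.perron_data_def by blast
  note a = weighted_sum_carrier[OF c]
  have dom: "V.dominant_functional ?a (of_real r) l"
    by (rule V.perron_dominant[OF V_basis vs_nonempty a data])
  have ev: "operator_eigenvalue K (subquotient V W U) (act (subquotient V W U) ?a) (of_real r) \<longleftrightarrow>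
      (\<exists>w\<in>W. l w \<noteq> 0) \<and> (\<forall>u\<in>U. l u = 0)" if "V.simple_pair W U" for W U
  proof (rule V.subquotient_eigenvalue_iff[OF V.basis_fin_dim[OF V_basis] a dom])
  qed (use that in \<open>unfold V.simple_pair_def, blast+\<close>)
  have "is_special_subquotient K A bs c V vs S \<longleftrightarrow>
      is_simple_subquotient (ground_field K) A V S \<and> operator_eigenvalue K S (act S ?a) (of_real r)"
    unfolding is_special_subquotient_def using pf perron_frobenius_eigenvalue_unique by metis
  also have "\<dots> \<longleftrightarrow> (\<exists>W U. V.simple_pair W U \<and> S = subquotient V W U \<and>
      operator_eigenvalue K (subquotient V W U) (act (subquotient V W U) ?a) (of_real r))"
    unfolding V.simple_subquotient_pair by blast
  also have "\<dots> \<longleftrightarrow> (\<exists>W U. V.simple_pair W U \<and> S = subquotient V W U \<and> (\<exists>w\<in>W. l w \<noteq> 0) \<and> (\<forall>u\<in>U. l u = 0))"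
    using ev by blast
  finally show ?thesis .
qed

lemma perron_positive_functional:
  "V.perron_data vs a r l v \<Longrightarrow> V.positive_functional vs l"
  unfolding V.perron_data_def V.positive_functional_def using vs_nonempty
  by (auto simp: less_imp_le intro!: exI[of _ 0])

lemma exists_special_subquotient:
  assumes c: "positive_coeffs K N c" shows "\<exists>S. is_special_subquotient K A bs c V vs S"
proof -
  obtain r l v where data: "V.perron_data vs (weighted_sum A bs c) r l v" using exists_perron_data[OF c] by blast
  have l: "linear_functional K V (carrier V) l" and l0: "l (vs ! 0) \<noteq> 0"
    using data vs_nonempty unfolding V.perron_data_def by (blast, force)
  have v0: "vs ! 0 \<in> carrier V" by (rule vs_carrier) (use vs_nonempty in simp)
  show ?thesis
    using V.exists_simple_pair[OF V.basis_fin_dim[OF V_basis] l v0 l0]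
    unfolding special_subquotient_iff[OF c data] by blast
qed

definition kills :: "nat \<Rightarrow> bool" where
  "kills i \<longleftrightarrow> (\<forall>x\<in>carrier V. act V (bs ! i) x = \<zero>\<^bsub>V\<^esub>)"

lemma killsI:
  assumes i: "i < N" and zero: "\<And>s t. s < length vs \<Longrightarrow> t < length vs \<Longrightarrow> cv (act V (bs ! i) (vs ! s)) t = 0"
  shows "kills i"
  unfolding kills_def
proof
  fix x assume x: "x \<in> carrier V"
  have "cv (act V (bs ! i) x) t = 0" if t: "t < length vs" for t
    unfolding V.functional_expansion[OF V_cs x V.functional_act[OF cv_linear[OF t] bs_carrier[OF i]]]
    by (rule sum.neutral) (use zero t in simp)
  then show "act V (bs ! i) x = \<zero>\<^bsub>V\<^esub>"
    using V_cs V.act_rules(1)[OF bs_carrier[OF i] x] unfolding coordinate_system_def by blast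
qed

text \<open>
  If \<open>a\<^sub>i a\<^sub>j\<close> annihilates \<open>V\<close>, then, matrix entries being nonnegative, so does every basis element that
  occurs in this product.
\<close>

lemma kills_product:
  assumes i: "i < N" and j: "j < N" and k: "k < N" and ij: "\<gamma> i j k > 0"
    and zero: "\<And>x. x \<in> carrier V \<Longrightarrow> act V (bs ! i) (act V (bs ! j) x) = \<zero>\<^bsub>V\<^esub>"
  shows "kills k"
proof (rule killsI[OF k])
  fix s t assume s: "s < length vs" and t: "t < length vs"
  let ?d = "\<lambda>m. Re (cv (act V (bs ! m) (vs ! s)) t)"
  have "0 = cv \<zero>\<^bsub>V\<^esub> t" using V.functional_zero[OF cv_linear[OF t] V.carrier_submodule] by simp
  also have "\<dots> = cv (act V (bs ! i \<otimes>\<^bsub>A\<^esub> bs ! j) (vs ! s)) t"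
    by (simp only: V.act_rules(6) bs_carrier i j vs_carrier s zero)
  also have "\<dots> = (\<Sum>m<N. co (bs ! i \<otimes>\<^bsub>A\<^esub> bs ! j) m * cv (act V (bs ! m) (vs ! s)) t)"
    by (rule A.functional_expansion[OF cs arr(2)[OF bs_carrier[OF i] bs_carrier[OF j]]
          functional_orbit[OF cv_linear[OF t] vs_carrier[OF s]]])
  also have "\<dots> = of_real (\<Sum>m<N. \<gamma> i j m * ?d m)"
    unfolding of_real_sum of_real_mult
  proof (rule sum.cong[OF refl])
    fix m assume "m \<in> {..<N}"
    then have m: "m < N" by simp
    show "co (bs ! i \<otimes>\<^bsub>A\<^esub> bs ! j) m * cv (act V (bs ! m) (vs ! s)) t = of_real (\<gamma> i j m) * of_real (?d m)"
      unfolding structure_const_gamma(1)[OF i j m] cv_nonneg(1)[OF m s t, symmetric] by (rule refl)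
  qed
  finally have "complex_of_real (\<Sum>m<N. \<gamma> i j m * ?d m) = 0" by (rule sym)
  then have "(\<Sum>m<N. \<gamma> i j m * ?d m) = 0" by (rule iffD1[OF of_real_eq_0_iff])
  moreover have "\<gamma> i j m * ?d m \<ge> 0" if "m \<in> {..<N}" for m
    using structure_const_gamma(2)[OF i j, of m] cv_nonneg(2)[of m, OF _ s t] that by simp
  ultimately have "\<gamma> i j k * ?d k = 0"
    using sum_nonneg_eq_0_iff[of "{..<N}" "\<lambda>m. \<gamma> i j m * ?d m"] k by simp
  then have "?d k = 0" using ij by simp
  then show "cv (act V (bs ! k) (vs ! s)) t = 0" using cv_nonneg(1)[OF k s t] by simp
qed

lemma act_zero: "a \<in> carrier A \<Longrightarrow> act V a \<zero>\<^bsub>V\<^esub> = \<zero>\<^bsub>V\<^esub>"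
  using V.act_rules(5)[OF V.K_closed(1) _ V.vector_rules(8)] V.K_rules(1)[OF V.act_rules(1)[OF _ V.vector_rules(8)]]
    V.K_rules(1)[OF V.vector_rules(8)] by simp

lemma kills_leJ:
  assumes i: "i < N" and k: "kills i" and ij: "leJ i j" shows "kills j"
proof -
  obtain m where m: "m < N" "leL i m" "leR m j" using ij unfolding leJ_def by blast
  obtain s where s: "s < N" "\<gamma> s i m > 0" using m(2) unfolding leL_def by blast
  obtain t where t: "t < N" "j < N" "\<gamma> m t j > 0" using m(3) unfolding leR_def by blast
  have km: "kills m"
  proof (rule kills_product[OF s(1) i m(1) s(2)])
    fix x assume "x \<in> carrier V"
    then have "act V (bs ! i) x = \<zero>\<^bsub>V\<^esub>" using k unfolding kills_def by blast
    then show "act V (bs ! s) (act V (bs ! i) x) = \<zero>\<^bsub>V\<^esub>" using act_zero[OF bs_carrier[OF s(1)]] by simp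
  qed
  show ?thesis
  proof (rule kills_product[OF m(1) t(1) t(2) t(3)])
    fix x assume "x \<in> carrier V"
    then show "act V (bs ! m) (act V (bs ! t) x) = \<zero>\<^bsub>V\<^esub>"
      using km V.act_rules(1)[OF bs_carrier[OF t(1)]] unfolding kills_def by blast
  qed
qed

text \<open>
  The annihilator of \<open>V\<close> contains the span of the basis elements that annihilate \<open>V\<close>.
\<close>

lemma kills_supported:
  assumes xA: "x \<in> carrier A" and x0: "\<And>k. k < N \<Longrightarrow> \<not> kills k \<Longrightarrow> co x k = 0" and v: "v \<in> carrier V"
  shows "act V x v = \<zero>\<^bsub>V\<^esub>"
proof -
  have "cv (act V x v) t = 0" if t: "t < length vs" for t
    unfolding A.functional_expansion[OF cs xA functional_orbit[OF cv_linear[OF t] v]]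
  proof (rule sum.neutral, rule ballI)
    fix k assume "k \<in> {..<N}"
    then have k: "k < N" by simp
    show "co x k * cv (act V (bs ! k) v) t = 0"
    proof (cases "kills k")
      case True
      then have "act V (bs ! k) v = \<zero>\<^bsub>V\<^esub>" using v unfolding kills_def by blast
      then show ?thesis using V.functional_zero[OF cv_linear[OF t] V.carrier_submodule] by simp
    qed (use x0[OF k] in simp)
  qed
  then show ?thesis
    using V_cs V.act_rules(1)[OF xA v] unfolding coordinate_system_def by blast
qed

text \<open>
  The vector \<open>a\<^sub>j v\<^sub>s\<close> has nonnegative coordinates and \<open>l\<close> is positive on the basis, so \<open>l\<close> detects whether
  the vector is zero.
\<close>

lemma perron_functional_positive:
  assumes data: "V.perron_data vs a r l w" and j: "j < N" and s: "s < length vs"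
  shows "Im (l (act V (bs ! j) (vs ! s))) = 0" "Re (l (act V (bs ! j) (vs ! s))) \<ge> 0"
    and "act V (bs ! j) (vs ! s) \<noteq> \<zero>\<^bsub>V\<^esub> \<Longrightarrow> l (act V (bs ! j) (vs ! s)) \<noteq> 0"
proof -
  let ?x = "act V (bs ! j) (vs ! s)" and ?n = "length vs"
  let ?d = "\<lambda>t. Re (cv ?x t)"
  have l: "linear_functional K V (carrier V) l"
    and l_vs: "\<And>t. t < ?n \<Longrightarrow> Im (l (vs ! t)) = 0 \<and> Re (l (vs ! t)) > 0"
    using data unfolding V.perron_data_def by blast+
  have d: "cv ?x t = of_real (?d t)" "?d t \<ge> 0" if "t < ?n" for t
    by (rule cv_nonneg(1)[OF j s that], rule cv_nonneg(2)[OF j s that])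
  have lr: "l (vs ! t) = of_real (Re (l (vs ! t)))" if "t < ?n" for t
    using l_vs[OF that] by (simp add: complex_eq_iff)
  have xV: "?x \<in> carrier V" by (rule V.act_rules(1)[OF bs_carrier[OF j] vs_carrier[OF s]])
  have "l ?x = (\<Sum>t<?n. cv ?x t * l (vs ! t))"
    by (rule V.functional_expansion[OF V_cs xV l])
  also have "\<dots> = of_real (\<Sum>t<?n. ?d t * Re (l (vs ! t)))"
    unfolding of_real_sum of_real_mult
  proof (rule sum.cong[OF refl])
    fix t assume "t \<in> {..<?n}"
    then have t: "t < ?n" by simp
    show "cv ?x t * l (vs ! t) = of_real (?d t) * of_real (Re (l (vs ! t)))"
      unfolding d(1)[OF t, symmetric] lr[OF t, symmetric] by (rule refl)
  qed
  finally have eq: "l ?x = of_real (\<Sum>t<?n. ?d t * Re (l (vs ! t)))" .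
  have nonneg: "?d t * Re (l (vs ! t)) \<ge> 0" if "t \<in> {..<?n}" for t
    using d(2)[of t] l_vs[of t] that by simp
  show "Im (l ?x) = 0" unfolding eq by simp
  show "Re (l ?x) \<ge> 0"
    unfolding eq using sum_nonneg[of "{..<?n}" "\<lambda>t. ?d t * Re (l (vs ! t))"] nonneg by simp
  assume ne: "?x \<noteq> \<zero>\<^bsub>V\<^esub>"
  show "l ?x \<noteq> 0"
  proof
    assume "l ?x = 0"
    then have "(\<Sum>t<?n. ?d t * Re (l (vs ! t))) = 0" unfolding eq by (rule iffD1[OF of_real_eq_0_iff])
    then have "?d t * Re (l (vs ! t)) = 0" if "t < ?n" for t
      using sum_nonneg_eq_0_iff[of "{..<?n}" "\<lambda>t. ?d t * Re (l (vs ! t))"] nonneg that by simp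
    then have "?d t = 0" if "t < ?n" for t using l_vs[OF that] that by (metis less_irrefl mult_eq_0_iff)
    then have "cv ?x t = 0" if "t < ?n" for t using d(1)[OF that] that by simp
    then show False using ne xV V_cs unfolding coordinate_system_def by blast
  qed
qed

lemma apex_not_kills:
  assumes apex: "is_apex K A bs V J" and i: "i \<in> J"
  shows "i < N" "\<not> kills i"
proof -
  have J: "J \<in> two_sided_cells K A bs" and ex: "\<exists>j\<in>J. \<exists>x\<in>carrier V. act V (bs ! j) x \<noteq> \<zero>\<^bsub>V\<^esub>"
    using apex unfolding is_apex_def nonannihilating_cells_def by blast+
  note J_eq = two_sided_cell_cases[OF J i]
  show iN: "i < N" by (rule J_eq(1))
  obtain j where j: "j \<in> J" "\<not> kills j" using ex unfolding kills_def by blast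
  have "leJ i j" using j(1) J_eq(2) by blast
  then show "\<not> kills i" using kills_leJ[OF iN] j(2) by blast
qed

text \<open>
  Otherwise the two-sided cell of \<open>j\<close> would be below the apex by maximality of the latter, hence equal to
  it, and stability would give \<open>j \<le>\<^sub>L i\<close>.
\<close>

lemma apex_kills_above:
  assumes apex: "is_apex K A bs V J" and i: "i \<in> J" and ij: "leL i j" and ji: "\<not> leL j i"
  shows "kills j"
proof (rule ccontr)
  assume not: "\<not> kills j"
  have j: "j < N" using ij unfolding leL_def by blast
  let ?X = "{k. leJ j k \<and> leJ k j}"
  have J: "J \<in> two_sided_cells K A bs" and max: "\<And>X. X \<in> nonannihilating_cells K A bs V \<Longrightarrow> cell_le_J K A bs X J"
    using apex unfolding is_apex_def nonannihilating_cells_def by blast+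
  note J_eq = two_sided_cell_cases[OF J i]
  have jX: "j \<in> ?X" using leL_leJ[OF leL_refl[OF j]] by blast
  have "?X \<in> nonannihilating_cells K A bs V"
    unfolding nonannihilating_cells_def using two_sided_cell_of[OF j] jX not unfolding kills_def by blast
  from max[OF this] obtain x y where xy: "x \<in> ?X" "y \<in> J" "le_J K A bs x y" unfolding cell_le_J_def by blast
  have jx: "leJ j x" and x: "x < N" using xy(1) leJ_bound by blast+
  have "leJ x y" using xy(3) le_J_iff[OF x] by blast
  moreover have "leJ y i" using xy(2) J_eq(2) by blast
  ultimately have "leJ j i" using leJ_trans[OF j leJ_trans[OF j jx]] by blast
  then show False using stability[OF J_eq(1) ij] ji by blast
qed

end

section \<open>Cell modules\<close>

context positively_based
begin

text \<open>
  The span of the basis elements with index in \<open>P\<close>, described by vanishing coordinates.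
\<close>

abbreviation supported :: "nat set \<Rightarrow> 'a set" where
  "supported P \<equiv> {x \<in> carrier A. \<forall>k<N. k \<notin> P \<longrightarrow> co x k = 0}"

lemma supported_submodule: "submodule (ground_field K) (supported P) A"
proof (rule submodule.intro[OF A.module_axioms])
  show "supported P \<subseteq> carrier A" by blast
  show "\<zero>\<^bsub>A\<^esub> \<in> supported P"
    using A.functional_zero[OF co_linear A.carrier_submodule] A.vector_rules(8) by simp
  show "v \<oplus>\<^bsub>A\<^esub> w \<in> supported P" if "v \<in> supported P" "w \<in> supported P" for v w
  proof -
    have "v \<in> carrier A" "w \<in> carrier A" using that by blast+
    then show ?thesis
      using that co_linear A.vector_rules(5)[of v w] unfolding linear_functional_def by simp
  qed
  show "c \<odot>\<^bsub>A\<^esub> v \<in> supported P" if "c \<in> carrier (ground_field K)" "v \<in> supported P" for c v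
  proof -
    have "v \<in> carrier A" "c \<in> K" using that by simp_all
    then show ?thesis
      using that co_linear A.K_rules(3)[of c v] unfolding linear_functional_def by simp
  qed
qed

lemma supported_lsub:
  assumes closed: "\<And>m k. m \<in> P \<Longrightarrow> m < N \<Longrightarrow> leL m k \<Longrightarrow> k \<in> P"
  shows "R.lsub (supported P)"
proof (rule R.lsubI)
  note sub = supported_submodule[of P]
  show "\<zero>\<^bsub>regular_module A\<^esub> \<in> supported P"
    using submodule.zero_closed[OF sub] by (simp only: regular_module_simps)
  show "x \<in> carrier (regular_module A)" if "x \<in> supported P" for x using that by simp
  show "x \<oplus>\<^bsub>regular_module A\<^esub> y \<in> supported P" if "x \<in> supported P" "y \<in> supported P" for x y
    using submodule.m_closed[OF sub that] by (simp only: regular_module_simps)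
  show "r \<odot>\<^bsub>regular_module A\<^esub> x \<in> supported P" if "r \<in> K" "x \<in> supported P" for r x
    using submodule.smult_closed[OF sub _ that(2), of r] that(1) by (simp only: regular_module_simps ground_field_simps)
  show "act (regular_module A) a x \<in> supported P" if a: "a \<in> carrier A" and x: "x \<in> supported P" for a x
  proof -
    have xA: "x \<in> carrier A" using x by blast
    have "co (a \<otimes>\<^bsub>A\<^esub> x) k = 0" if k: "k < N" "k \<notin> P" for k
    proof -
      have term_zero: "co x m * co (a \<otimes>\<^bsub>A\<^esub> bs ! m) k = 0" if m: "m < N" for m
      proof (cases "m \<in> P")
        case True
        have "\<gamma> j m k = 0" if j: "j < N" for j
        proof -
          have "\<not> 0 < \<gamma> j m k" using closed[OF True m, of k] k j unfolding leL_def by blast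
          then show ?thesis using structure_const_gamma(2)[OF j m k(1)] by linarith
        qed
        then have "co (a \<otimes>\<^bsub>A\<^esub> bs ! m) k = 0"
          unfolding A.functional_expansion[OF cs a functional_mult(1)[OF co_linear[OF k(1)] bs_carrier[OF m]]]
          by (intro sum.neutral ballI) (simp only: lessThan_iff structure_const_gamma(1) m k(1) of_real_0 mult_zero_right)
        then show ?thesis by simp
      next
        case False
        then show ?thesis using x m by simp
      qed
      show ?thesis
        unfolding A.functional_expansion[OF cs xA functional_mult(2)[OF co_linear[OF k(1)] a]]
        by (rule sum.neutral) (use term_zero in simp)
    qed
    then show ?thesis using arr(2)[OF a xA] by simp
  qed
qed

lemma span_bs:
  assumes P: "P \<subseteq> {..<N}"
  shows "A.span ((!) bs ` P) = supported P"
proof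
  show "A.span ((!) bs ` P) \<subseteq> supported P"
  proof (rule A.span_is_subset[OF _ supported_submodule])
    show "(!) bs ` P \<subseteq> supported P"
    proof
      fix x assume "x \<in> (!) bs ` P"
      then obtain i where i: "i \<in> P" "x = bs ! i" by blast
      then have "i < N" using P by blast
      then show "x \<in> supported P" using bs_carrier co_bs i by auto
    qed
  qed
  have gen: "(!) bs ` P \<subseteq> carrier A" using P bs_carrier by auto
  have sp: "submodule (ground_field K) (A.span ((!) bs ` P)) A" by (rule A.span_is_submodule[OF gen])
  show "supported P \<subseteq> A.span ((!) bs ` P)"
  proof
    fix x assume x: "x \<in> supported P"
    then have xA: "x \<in> carrier A" by blast
    have "co x j \<odot>\<^bsub>A\<^esub> bs ! j \<in> A.span ((!) bs ` P)" if j: "j \<in> {..<N}" for j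
    proof (cases "j \<in> P")
      case True
      have "bs ! j \<in> A.span ((!) bs ` P)" using A.in_own_span[OF gen] True by blast
      moreover have "co x j \<in> carrier (ground_field K)" using cs xA j unfolding coordinate_system_def by simp
      ultimately show ?thesis by (rule submodule.smult_closed[OF sp, rotated])
    next
      case False
      then have "co x j = 0" using x j by simp
      then have "co x j \<odot>\<^bsub>A\<^esub> bs ! j = \<zero>\<^bsub>A\<^esub>" using A.K_rules(1)[OF bs_carrier] j by simp
      then show ?thesis using submodule.zero_closed[OF sp] by simp
    qed
    then have "(\<Oplus>\<^bsub>A\<^esub>j\<in>{..<N}. co x j \<odot>\<^bsub>A\<^esub> bs ! j) \<in> A.span ((!) bs ` P)"
      using A.functional_finsum[OF _ sp, of "\<lambda>_. 0" "{..<N}" "\<lambda>j. co x j \<odot>\<^bsub>A\<^esub> bs ! j"]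
      by (simp add: linear_functional_def)
    then show "x \<in> A.span ((!) bs ` P)" unfolding A.coordinate_expansion[OF cs xA, symmetric] .
  qed
qed

end

locale left_cell = positively_based K A bs
  for K :: "complex set" and A :: "(complex, 'a) module" and bs :: "'a list" +
  fixes L :: "nat set"
  assumes cell: "L \<in> left_cells K A bs"
begin

text \<open>
  A fixed element of the cell, which turns the cell and its upper closure into the sets of indices
  equivalent to \<open>rep\<close> and above \<open>rep\<close>.
\<close>

definition rep :: nat where "rep = (SOME i. i < N \<and> i \<in> L \<and> L = {j. leL i j \<and> leL j i})"

lemma rep: "rep < N" "rep \<in> L" "L = {j. leL rep j \<and> leL j rep}"
proof -
  obtain i where "i < N" "i \<in> L" "L = {j. leL i j \<and> leL j i}" by (rule left_cell_cases[OF cell])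
  then have "i < N \<and> i \<in> L \<and> L = {j. leL i j \<and> leL j i}" by blast
  from someI[of "\<lambda>i. i < N \<and> i \<in> L \<and> L = {j. leL i j \<and> leL j i}", OF this]
  show "rep < N" "rep \<in> L" "L = {j. leL rep j \<and> leL j rep}" unfolding rep_def by blast+
qed

abbreviation "M \<equiv> cell_M K A bs L"
abbreviation "M' \<equiv> cell_N K A bs L"
abbreviation "C \<equiv> cell_module K A bs L"
abbreviation "ls \<equiv> sorted_list_of_set L"
abbreviation "us \<equiv> cell_basis K A bs L"
abbreviation "\<pi> x \<equiv> M' +>\<^bsub>regular_module A\<^esub> x"

lemma L_bound: "j \<in> L \<Longrightarrow> j < N" using rep(3) unfolding leL_def by blast

lemma finite_L: "finite L"
  by (rule finite_subset[of _ "{..<N}"]) (use L_bound in auto)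

lemma ls: "set ls = L" "distinct ls" "i < length ls \<Longrightarrow> ls ! i \<in> L"
  using finite_L nth_mem[of i ls] by auto

lemma ls_index:
  assumes "k \<in> L" obtains i where "i < length ls" "ls ! i = k"
proof -
  have "k \<in> set ls" unfolding ls(1) by (rule assms)
  then show ?thesis unfolding in_set_conv_nth using that by blast
qed

lemma M_eq: "M = supported {j. leL rep j}"
  unfolding cell_M_def upper_closure_eq[OF rep(1,3)] by (rule span_bs) (auto simp: leL_def)

lemma M'_eq: "M' = supported ({j. leL rep j} - L)"
  unfolding cell_N_def upper_closure_eq[OF rep(1,3)] by (rule span_bs) (auto simp: leL_def)

lemma M_lsub: "R.lsub M"
  unfolding M_eq by (rule supported_lsub) (use leL_trans[OF rep(1)] in blast)

lemma M'_lsub: "R.lsub M'"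
  unfolding M'_eq
proof (rule supported_lsub)
  fix m k assume m: "m \<in> {j. leL rep j} - L" "m < N" and mk: "leL m k"
  have k: "leL rep k" by (rule leL_trans[OF rep(1) _ mk]) (use m in blast)
  moreover have "k \<notin> L"
  proof
    assume "k \<in> L"
    then have "leL k rep" using rep(3) by blast
    then have "leL m rep" by (rule leL_trans[OF m(2) mk])
    then show False using m rep(3) by blast
  qed
  ultimately show "k \<in> {j. leL rep j} - L" by blast
qed

lemma M'_M: "M' \<subseteq> M" unfolding M_eq M'_eq by blast

lemma bs_M: "j \<in> L \<Longrightarrow> bs ! j \<in> M"
  unfolding M_eq using L_bound[of j] bs_carrier[of j] co_bs rep(3) by auto

sublocale C: ground_module K A C
proof (intro ground_module.intro ground_module_axioms.intro)
  show lm: "left_module (ground_field K) A C"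
    unfolding cell_module_def by (rule R.subquotient_left_module[OF M_lsub M'_lsub])
  then show "ground_vectorspace K C" unfolding left_module_def ground_vectorspace_def by blast
qed

lemmas proj = module_map_onD[OF R.quotient_map[OF M_lsub M'_lsub], folded cell_module_def]

lemma C_carrier: "carrier C = (\<lambda>x. \<pi> x) ` M" "\<zero>\<^bsub>C\<^esub> = M'"
  unfolding cell_module_def R.subquotient_simps by (rule refl)+

text \<open>
  Coordinates on the cell module: the coefficients of a representative in \<open>M\<close> at the indices of the cell.
  They do not depend on the representative, since elements of \<open>M'\<close> have no such coefficients.
\<close>

definition \<kappa> :: "'a set \<Rightarrow> nat \<Rightarrow> complex" where
  "\<kappa> X k = co (SOME x. x \<in> M \<and> \<pi> x = X) (ls ! k)"

lemma same_coset_coordinates: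
  assumes x: "x \<in> M" and y: "y \<in> M" and eq: "\<pi> x = \<pi> y" and F: "linear_functional K A (carrier A) F"
    and zero: "\<And>z. z \<in> M' \<Longrightarrow> F z = 0"
  shows "F x = F y"
proof -
  have xR: "x \<in> carrier (regular_module A)" and yR: "y \<in> carrier (regular_module A)"
    by (rule R.lsubD(1)[OF M_lsub x], rule R.lsubD(1)[OF M_lsub y])
  have "x \<ominus>\<^bsub>regular_module A\<^esub> y \<in> M'"
    using eq unfolding R.coset_eq_iff[OF R.lsub_submodule[OF M'_lsub] xR yR] .
  then have "F (x \<ominus>\<^bsub>regular_module A\<^esub> y) = 0" by (rule zero)
  moreover have "F (x \<ominus>\<^bsub>regular_module A\<^esub> y) = F x - F y"
  proof (rule R.functional_minus[OF _ R.carrier_submodule xR yR])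
    show "linear_functional K (regular_module A) (carrier (regular_module A)) F"
      using F by (simp add: linear_functional_regular)
  qed
  ultimately show ?thesis by simp
qed

lemma some_representative:
  assumes "x \<in> M"
  shows "(SOME y. y \<in> M \<and> \<pi> y = \<pi> x) \<in> M" "\<pi> (SOME y. y \<in> M \<and> \<pi> y = \<pi> x) = \<pi> x"
  using someI[of "\<lambda>y. y \<in> M \<and> \<pi> y = \<pi> x" x] assms by blast+

lemma \<kappa>_proj:
  assumes x: "x \<in> M" and k: "k < length ls"
  shows "\<kappa> (\<pi> x) k = co x (ls ! k)"
  unfolding \<kappa>_def
proof (rule same_coset_coordinates[OF some_representative(1)[OF x] x some_representative(2)[OF x]])
  show "linear_functional K A (carrier A) (\<lambda>x. co x (ls ! k))" by (rule co_linear[OF L_bound[OF ls(3)[OF k]]])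
  show "co z (ls ! k) = 0" if "z \<in> M'" for z
    using that L_bound[OF ls(3)[OF k]] ls(3)[OF k] unfolding M'_eq by blast
qed

lemma us: "length us = length ls" "k < length ls \<Longrightarrow> us ! k = \<pi> (bs ! (ls ! k))"
  unfolding cell_basis_def by (simp_all add: coset_regular_module)

lemma cell_coordinates: "coordinate_system K C us \<kappa>"
  unfolding coordinate_system_def us(1)
proof (intro conjI ballI allI impI)
  have MA: "x \<in> carrier A" if "x \<in> M" for x using R.lsubD(1)[OF M_lsub that] by simp
  show "set us \<subseteq> carrier C"
    unfolding C_carrier cell_basis_def coset_regular_module using bs_M ls(1) by auto
  show "linear_functional K C (carrier C) (\<lambda>X. \<kappa> X i)" if i: "i < length ls" for i
    unfolding linear_functional_def C_carrier(1)
  proof (intro conjI ballI)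
    note lin = co_linear[OF L_bound[OF ls(3)[OF i]], unfolded linear_functional_def]
    fix X Y assume "X \<in> (\<lambda>x. \<pi> x) ` M" "Y \<in> (\<lambda>x. \<pi> x) ` M"
    then obtain x y where xy: "x \<in> M" "y \<in> M" "X = \<pi> x" "Y = \<pi> y" by blast
    have "X \<oplus>\<^bsub>C\<^esub> Y = \<pi> (x \<oplus>\<^bsub>A\<^esub> y)" using proj(2)[OF xy(1,2)] xy by simp
    moreover have "x \<oplus>\<^bsub>A\<^esub> y \<in> M" using R.lsubD(3)[OF M_lsub xy(1,2)] by simp
    moreover have "co (x \<oplus>\<^bsub>A\<^esub> y) (ls ! i) = co x (ls ! i) + co y (ls ! i)"
      using lin MA[OF xy(1)] MA[OF xy(2)] by blast
    ultimately show "\<kappa> (X \<oplus>\<^bsub>C\<^esub> Y) i = \<kappa> X i + \<kappa> Y i" unfolding xy by (simp only: \<kappa>_proj i xy)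
  next
    note lin = co_linear[OF L_bound[OF ls(3)[OF i]], unfolded linear_functional_def]
    fix r X assume r: "r \<in> K" and "X \<in> (\<lambda>x. \<pi> x) ` M"
    then obtain x where x: "x \<in> M" "X = \<pi> x" by blast
    have "r \<odot>\<^bsub>C\<^esub> X = \<pi> (r \<odot>\<^bsub>A\<^esub> x)" using proj(3)[OF r x(1)] x by simp
    moreover have "r \<odot>\<^bsub>A\<^esub> x \<in> M" using R.lsubD(4)[OF M_lsub r x(1)] by simp
    moreover have "co (r \<odot>\<^bsub>A\<^esub> x) (ls ! i) = r * co x (ls ! i)"
      using lin MA[OF x(1)] r by blast
    ultimately show "\<kappa> (r \<odot>\<^bsub>C\<^esub> X) i = r * \<kappa> X i" unfolding x by (simp only: \<kappa>_proj i x)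
  qed
  show "\<kappa> X i \<in> K" if X: "X \<in> carrier C" and i: "i < length ls" for X i
  proof -
    obtain x where x: "x \<in> M" "X = \<pi> x" using X unfolding C_carrier by blast
    show ?thesis unfolding x \<kappa>_proj[OF x(1) i]
      using cs MA[OF x(1)] L_bound[OF ls(3)[OF i]] unfolding coordinate_system_def by blast
  qed
  show "\<kappa> (us ! j) i = (if i = j then 1 else 0)" if "i < length ls" "j < length ls" for i j
    unfolding us(2)[OF that(2)] \<kappa>_proj[OF bs_M[OF ls(3)[OF that(2)]] that(1)]
      co_bs[OF L_bound[OF ls(3)[OF that(1)]] L_bound[OF ls(3)[OF that(2)]]]
    using ls(2) that by (simp add: nth_eq_iff_index_eq)
  show "X = \<zero>\<^bsub>C\<^esub>" if X: "X \<in> carrier C" and zero: "\<forall>i<length ls. \<kappa> X i = 0" for X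
  proof -
    obtain x where x: "x \<in> M" "X = \<pi> x" using X unfolding C_carrier by blast
    have "co x k = 0" if k: "k \<in> L" for k
    proof -
      obtain i where i: "i < length ls" "ls ! i = k" by (rule ls_index[OF k])
      show ?thesis using zero i(1) \<kappa>_proj[OF x(1) i(1)] unfolding x(2) i(2) by simp
    qed
    then have "x \<in> M'" using x(1) unfolding M_eq M'_eq by blast
    then show ?thesis
      unfolding x(2) C_carrier using R.coset_eq_U_iff[OF M'_lsub R.lsubD(1)[OF M_lsub x(1)]] by blast
  qed
qed

lemmas C_basis = C.basis_of_coordinate_system(1)[OF cell_coordinates]
lemmas C_coord = C.basis_of_coordinate_system(2)[OF cell_coordinates, unfolded us(1)]

text \<open>
  The matrices of the cell module are the blocks of those of the regular module at the cell.
\<close>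

lemma cell_action:
  assumes i: "i < N" and s: "s < length ls" and t: "t < length ls"
  shows "coord (ground_field K) C us (act C (bs ! i) (us ! s)) t = of_real (\<gamma> i (ls ! s) (ls ! t))"
proof -
  note sL = ls(3)[OF s] and tL = ls(3)[OF t]
  have "act C (bs ! i) (us ! s) = \<pi> (bs ! i \<otimes>\<^bsub>A\<^esub> bs ! (ls ! s))"
    using proj(4)[OF bs_carrier[OF i] bs_M[OF sL]] by (simp add: us(2)[OF s])
  moreover have m: "bs ! i \<otimes>\<^bsub>A\<^esub> bs ! (ls ! s) \<in> M"
    using R.lsubD(5)[OF M_lsub bs_carrier[OF i] bs_M[OF sL]] by simp
  ultimately show ?thesis
    using C_coord[of "\<pi> (bs ! i \<otimes>\<^bsub>A\<^esub> bs ! (ls ! s))" t] t \<kappa>_proj[OF m t]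
      structure_const_gamma(1)[OF i L_bound[OF sL] L_bound[OF tL]] proj(1)[OF m] by simp
qed

lemma cell_module_transitive: "transitive_module K A bs C us"
  unfolding transitive_module_def positively_based_module_def us(1)
proof (intro conjI allI impI)
  show "left_module (ground_field K) A C" by (rule C.left_module_axiom)
  show "is_basis (ground_field K) C us" by (rule C_basis)
  show "carrier C \<noteq> {\<zero>\<^bsub>C\<^esub>}"
  proof
    assume eq: "carrier C = {\<zero>\<^bsub>C\<^esub>}"
    obtain k where k: "k < length ls" "ls ! k = rep" by (rule ls_index[OF rep(2)])
    have "us ! k = \<zero>\<^bsub>C\<^esub>"
      using eq proj(1)[OF bs_M[OF rep(2)]] unfolding us(2)[OF k(1)] k(2) by blast
    then have "\<kappa> (us ! k) k = 0"
      using C.functional_zero[OF _ C.carrier_submodule, of "\<lambda>X. \<kappa> X k"] cell_coordinates k(1) us(1)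
      unfolding coordinate_system_def by simp
    then show False using cell_coordinates k(1) us(1) unfolding coordinate_system_def by simp
  qed
  show "coord (ground_field K) C us (act C (bs ! i) (us ! s)) t \<in> \<real>\<^sub>\<ge>\<^sub>0"
    if "i < N" "s < length ls" "t < length ls" for i s t
    unfolding cell_action[OF that]
    using structure_const_gamma(2)[OF that(1) L_bound[OF ls(3)[OF that(2)]] L_bound[OF ls(3)[OF that(3)]]] by simp
  show "\<exists>i<N. coord (ground_field K) C us (act C (bs ! i) (us ! s)) t \<noteq> 0"
    if s: "s < length ls" and t: "t < length ls" for s t
  proof -
    have "leL (ls ! s) rep" "leL rep (ls ! t)" using rep(3) ls(3)[OF s] ls(3)[OF t] by blast+
    then have "leL (ls ! s) (ls ! t)" by (rule leL_trans[OF L_bound[OF ls(3)[OF s]]])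
    then obtain i where "i < N" "\<gamma> i (ls ! s) (ls ! t) > 0" unfolding leL_def by blast
    then show ?thesis using cell_action[OF _ s t, of i] by (intro exI[of _ i]) simp
  qed
qed

text \<open>
  Homomorphisms out of the cell module arise from orbit maps \<open>a \<mapsto> a v\<close> that vanish on \<open>M'\<close>.
\<close>

lemma cell_module_map:
  assumes V: "ground_module K A V" and v: "v \<in> carrier V" and kill: "\<And>x. x \<in> M' \<Longrightarrow> act V x v = \<zero>\<^bsub>V\<^esub>"
  shows "\<exists>\<phi>. module_map_on K A C (carrier C) V \<phi> \<and> (\<forall>x\<in>M. \<phi> (\<pi> x) = act V x v)"
proof -
  interpret V: ground_module K A V by (rule V)
  have MA: "x \<in> carrier A" if "x \<in> M" for x using R.lsubD(1)[OF M_lsub that] by simp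
  define \<phi> where "\<phi> = (\<lambda>X. act V (SOME x. x \<in> M \<and> \<pi> x = X) v)"
  have \<phi>: "\<phi> (\<pi> x) = act V x v" if x: "x \<in> M" for x
  proof -
    define y where "y = (SOME y. y \<in> M \<and> \<pi> y = \<pi> x)"
    have y: "y \<in> M" "\<pi> y = \<pi> x" unfolding y_def by (rule some_representative[OF x])+
    have yR: "y \<in> carrier (regular_module A)" and xR: "x \<in> carrier (regular_module A)"
      by (rule R.lsubD(1)[OF M_lsub y(1)], rule R.lsubD(1)[OF M_lsub x])
    define d where "d = y \<ominus>\<^bsub>regular_module A\<^esub> x"
    have d: "d \<in> M'"
      using y(2) unfolding d_def R.coset_eq_iff[OF R.lsub_submodule[OF M'_lsub] yR xR] .
    have dA: "d \<in> carrier A" using d M'_M MA by blast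
    have "y = d \<oplus>\<^bsub>A\<^esub> x" using R.vector_rules(9)[OF yR xR] unfolding d_def by simp
    then have "act V y v = act V d v \<oplus>\<^bsub>V\<^esub> act V x v" using V.act_rules(3)[OF dA MA[OF x] v] by simp
    also have "\<dots> = act V x v \<oplus>\<^bsub>V\<^esub> \<zero>\<^bsub>V\<^esub>"
      unfolding kill[OF d] by (rule V.vector_rules(1)[OF V.vector_rules(8) V.act_rules(1)[OF MA[OF x] v]])
    also have "\<dots> = act V x v" by (rule V.vector_rules(3)[OF V.act_rules(1)[OF MA[OF x] v]])
    finally show ?thesis unfolding \<phi>_def y_def .
  qed
  have "module_map_on K A C (carrier C) V \<phi>"
    unfolding module_map_on_def C_carrier(1)
  proof (intro conjI ballI)
    fix X assume "X \<in> (\<lambda>x. \<pi> x) ` M"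
    then obtain x where x: "x \<in> M" "X = \<pi> x" by blast
    show "\<phi> X \<in> carrier V" unfolding x(2) \<phi>[OF x(1)] by (rule V.act_rules(1)[OF MA[OF x(1)] v])
    show "\<phi> (r \<odot>\<^bsub>C\<^esub> X) = r \<odot>\<^bsub>V\<^esub> \<phi> X" if r: "r \<in> K" for r
      unfolding x(2) proj(3)[OF r x(1), symmetric] \<phi>[OF x(1)] \<phi>[OF R.lsubD(4)[OF M_lsub r x(1)], unfolded regular_module_simps] regular_module_simps
      by (rule V.act_rules(4)[OF r MA[OF x(1)] v])
    show "\<phi> (act C a X) = act V a (\<phi> X)" if a: "a \<in> carrier A" for a
      unfolding x(2) proj(4)[OF a x(1), symmetric] \<phi>[OF x(1)] \<phi>[OF R.lsubD(5)[OF M_lsub a x(1)], unfolded regular_module_simps] regular_module_simps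
      by (rule V.act_rules(6)[OF a MA[OF x(1)] v])
    fix Y assume "Y \<in> (\<lambda>x. \<pi> x) ` M"
    then obtain y where y: "y \<in> M" "Y = \<pi> y" by blast
    show "\<phi> (X \<oplus>\<^bsub>C\<^esub> Y) = \<phi> X \<oplus>\<^bsub>V\<^esub> \<phi> Y"
      unfolding x(2) y(2) proj(2)[OF x(1) y(1), symmetric] \<phi>[OF x(1)] \<phi>[OF y(1)]
        \<phi>[OF R.lsubD(3)[OF M_lsub x(1) y(1)], unfolded regular_module_simps] regular_module_simps
      by (rule V.act_rules(3)[OF MA[OF x(1)] MA[OF y(1)] v])
  qed
  then show ?thesis using \<phi> by blast
qed

end

section \<open>Comparison of a transitive module with the cell modules of its apex\<close>

theorem theorem21:
  fixes K :: "complex set"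
    and A :: "(complex, 'a) module" and bs :: "'a list"
    and V :: "(complex, 'a, 'v) lmodule" and vs :: "'v list"
    and J L :: "nat set" and c d :: "nat \<Rightarrow> complex"
  assumes "subfield K class_ring"
    and "positively_based_algebra K A bs"
    and "transitive_module K A bs V vs"
    and "is_apex K A bs V J"
    and "L \<in> left_cells K A bs" and "L \<subseteq> J"
    and "positive_coeffs K (length bs) c"
    and "positive_coeffs K (length bs) d"
  shows "(\<exists>S. is_special_subquotient K A bs c V vs S) \<and>
    (\<exists>T. is_special_subquotient K A bs d (cell_module K A bs L) (cell_basis K A bs L) T) \<and>
    (\<forall>S T. is_special_subquotient K A bs c V vs S \<longrightarrow>
       is_special_subquotient K A bs d (cell_module K A bs L) (cell_basis K A bs L) T \<longrightarrow>
       lmodule_iso (ground_field K) A S T)"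
proof -
  note apex = assms(4) and LJ = assms(6) and c = assms(7) and d = assms(8)
  interpret V: transitive K A bs V vs
    by (intro transitive.intro positively_based.intro transitive_axioms.intro assms)
  interpret L: left_cell K A bs L
    by (intro left_cell.intro positively_based.intro left_cell_axioms.intro assms)
  interpret C: transitive K A bs "cell_module K A bs L" "cell_basis K A bs L"
    by (intro transitive.intro positively_based.intro transitive_axioms.intro assms L.cell_module_transitive)
  let ?a = "weighted_sum A bs c" and ?n = "length vs"
  note a = V.weighted_sum_carrier[OF c]
  have rJ: "L.rep \<in> J" using L.rep(2) LJ by (rule rev_subsetD)
  \<comment> \<open>By definition of the apex, \<open>bs ! rep\<close> acts nontrivially, hence nontrivially on a basis vector. A basis
    vector is chosen in order to make the map out of the cell module nonnegative.\<close>
  obtain s where s: "s < ?n" and nz: "act V (bs ! L.rep) (vs ! s) \<noteq> \<zero>\<^bsub>V\<^esub>"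
  proof -
    have "\<not> V.kills L.rep" by (rule V.apex_not_kills(2)[OF apex rJ])
    then obtain s t where st: "s < ?n" "t < ?n" "V.cv (act V (bs ! L.rep) (vs ! s)) t \<noteq> 0"
      using V.killsI[OF L.rep(1)] by blast
    have "act V (bs ! L.rep) (vs ! s) \<noteq> \<zero>\<^bsub>V\<^esub>"
      using st(3) V.V.functional_zero[OF V.cv_linear[OF st(2)] V.V.carrier_submodule] by metis
    then show ?thesis using st(1) that by blast
  qed
  define v where "v = vs ! s"
  have v: "v \<in> carrier V" unfolding v_def by (rule V.vs_carrier[OF s])
  have kill: "act V x v = \<zero>\<^bsub>V\<^esub>" if x: "x \<in> cell_N K A bs L" for x
  proof -
    have xA: "x \<in> carrier A" and x0: "\<And>k. k < length bs \<Longrightarrow> k \<notin> {j. V.leL L.rep j} - L \<Longrightarrow> V.co x k = 0"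
      using x unfolding L.M'_eq by blast+
    show ?thesis
    proof (rule V.kills_supported[OF xA x0 v])
      show "k \<notin> {j. V.leL L.rep j} - L" if "\<not> V.kills k" for k
        using V.apex_kills_above[OF apex rJ, of k] that L.rep(3) by blast
    qed
  qed
  obtain \<phi> where \<phi>: "module_map_on K A (cell_module K A bs L) (carrier (cell_module K A bs L)) V \<phi>"
    and \<phi>_proj: "\<And>x. x \<in> cell_M K A bs L \<Longrightarrow>
      \<phi> (cell_N K A bs L +>\<^bsub>regular_module A\<^esub> x) = act V x v"
    using L.cell_module_map[OF V.V.ground_module_axioms v kill] by blast
  let ?C = "cell_module K A bs L" and ?us = "cell_basis K A bs L"
  \<comment> \<open>The Perron functionals \<open>l\<close> of \<open>a(c)\<close> on \<open>V\<close>, \<open>h\<close> of \<open>a(d)\<close> and \<open>hc\<close> of \<open>a(c)\<close> on the cell module. The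
    last one links the other two.\<close>
  obtain r l w where data: "V.V.perron_data vs ?a r l w" using V.exists_perron_data[OF c] by blast
  obtain rd h wd where data_d: "L.C.perron_data ?us (weighted_sum A bs d) rd h wd"
    using C.exists_perron_data[OF d] by blast
  obtain rc hc wc where data_c: "L.C.perron_data ?us ?a rc hc wc"
    using C.exists_perron_data[OF c] by blast
  have l: "linear_functional K V (carrier V) l"
    and la: "\<And>x. x \<in> carrier V \<Longrightarrow> l (act V ?a x) = of_real r * l x"
    using data unfolding V.V.perron_data_def by blast+
  define g where "g = (\<lambda>X. l (\<phi> X))"
  note pD = module_map_onD[OF \<phi>]
  have glin: "linear_functional K ?C (carrier ?C) g"
    unfolding g_def linear_functional_def
    by (intro conjI ballI) (simp_all only: pD V.V.functionalD[OF l])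
  have ga: "g (act ?C ?a X) = of_real r * g X" if "X \<in> carrier ?C" for X
    unfolding g_def by (simp only: pD that a la)
  have g_us: "g (?us ! k) = l (act V (bs ! (L.ls ! k)) (vs ! s))" if k: "k < length L.ls" for k
    unfolding g_def L.us(2)[OF k] \<phi>_proj[OF L.bs_M[OF L.ls(3)[OF k]]] v_def by (rule refl)
  note l_pos = V.perron_functional_positive[OF data L.L_bound[OF L.ls(3)] s]
  have g_pos: "L.C.positive_functional ?us g"
    unfolding L.C.positive_functional_def L.us(1)
  proof (intro conjI allI impI)
    obtain k where k: "k < length L.ls" "L.ls ! k = L.rep" by (rule L.ls_index[OF L.rep(2)])
    show "\<exists>i<length L.ls. g (?us ! i) \<noteq> 0"
      using g_us[OF k(1)] l_pos(3)[OF k(1)] nz k by auto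
  qed (simp_all add: glin g_us l_pos)
  \<comment> \<open>From \<open>l \<circ> \<phi>\<close> to \<open>h\<close> by positivity of the former; back via \<open>hc\<close>, of which \<open>l \<circ> \<phi>\<close> is a multiple.\<close>
  have same: "(\<forall>x\<in>X. h x = 0) \<longleftrightarrow> (\<forall>x\<in>X. l (\<phi> x) = 0)" if X: "is_lsubmodule (ground_field K) A ?C X" for X
  proof
    assume "\<forall>x\<in>X. l (\<phi> x) = 0"
    then have g0: "\<And>x. x \<in> X \<Longrightarrow> g x = 0" unfolding g_def by blast
    show "\<forall>x\<in>X. h x = 0"
      using L.C.perron_vanishing[OF data_d C.weighted_sum_carrier[OF d] g_pos X g0] by blast
  next
    assume "\<forall>x\<in>X. h x = 0"
    then have h0: "\<And>x. x \<in> X \<Longrightarrow> h x = 0" by blast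
    have hc0: "hc x = 0" if "x \<in> X" for x
      by (rule L.C.perron_vanishing[OF data_c a C.perron_positive_functional[OF data_d] X h0 that])
    obtain \<kappa> where \<kappa>: "\<forall>x\<in>carrier ?C. g x = \<kappa> * hc x"
      using L.C.perron_eigenfunctional[OF C.V_basis C.vs_nonempty data_c a g_pos ga] by blast
    show "\<forall>x\<in>X. l (\<phi> x) = 0"
    proof
      fix x assume x: "x \<in> X"
      have "x \<in> carrier ?C" by (rule L.C.lsubD(1)[OF X x])
      then have "g x = 0" using \<kappa> hc0[OF x] by simp
      then show "l (\<phi> x) = 0" unfolding g_def .
    qed
  qed
  have dom: "V.V.dominant_functional ?a (of_real r) l"
    by (rule V.V.perron_dominant[OF V.V_basis V.vs_nonempty a data])
  have iso: "lmodule_iso (ground_field K) A S T"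
    if S: "is_special_subquotient K A bs c V vs S" and T: "is_special_subquotient K A bs d ?C ?us T" for S T
  proof -
    obtain W U where WU: "V.V.simple_pair W U" and S_eq: "S = subquotient V W U"
      and lW: "\<exists>w\<in>W. l w \<noteq> 0" and lU: "\<And>u. u \<in> U \<Longrightarrow> l u = 0"
      using S unfolding V.special_subquotient_iff[OF c data] by blast
    obtain W' U' where WU': "L.C.simple_pair W' U'" and T_eq: "T = subquotient ?C W' U'"
      and hW: "\<exists>w\<in>W'. h w \<noteq> 0" and hU: "\<And>u. u \<in> U' \<Longrightarrow> h u = 0"
      using T unfolding C.special_subquotient_iff[OF d data_d] by blast
    have W: "V.V.lsub W" using WU unfolding V.V.simple_pair_def by blast
    have W': "L.C.lsub W'" using WU' unfolding L.C.simple_pair_def by blast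
    have "\<exists>y\<in>\<phi> ` W'. l y \<noteq> 0" using same[OF W'] hW by blast
    then obtain z where z: "z \<in> W'" "\<phi> z \<in> W" "l (\<phi> z) \<noteq> 0"
      using V.V.dominant_intersection[OF dom a
          image_lsub(1)[OF L.C.ground_module_axioms V.V.ground_module_axioms \<phi> W' L.C.lsub_subset[OF W']] W _ lW] by blast
    show ?thesis
      unfolding S_eq T_eq
      by (rule iso_of_dominant_map[OF L.C.ground_module_axioms V.V.ground_module_axioms \<phi> WU WU' l _ lU hU z same])
        (use data_d in \<open>unfold L.C.perron_data_def, blast\<close>)
  qed
  show ?thesis
    using V.exists_special_subquotient[OF c] C.exists_special_subquotient[OF d] iso by blast
qed

end
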